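(* Assume that the stochastic kernel $p(\cdot\,|x,a)$ is weakly continuous in $(x,a)\in\mathsf X\times\mathsf A$. Then, for the discounted cost criterion, $$\lim_{n\to\infty}\bigl|\min(\mathbf{CP}_n^{\mathbf k})-\min(\mathbf{CP}^{\mathbf k})\bigr|=0,$$ that is, the optimal value of the finite-state constrained model MDP$_n$ converges to the optimal value of the original constrained MDP as $n\to\infty$.
   Context: **Model.** $\mathsf X$ (states) and $\mathsf A$ (actions) are compact metric spaces with their Borel $\sigma$-algebras; $d_{\mathsf X}$ is the metric of $\mathsf X$; every action is admissible in every state. $p(\cdot\,|x,a)$ is a stochastic kernel on $\mathsf X$ given $\mathsf X\times\mathsf A$; $c,d_1,\dots,d_q:\mathsf X\times\mathsf A\to[0,\infty)$ are continuous; $\gamma$ is a probability measure on $\mathsf X$ (initial distribution); $\mathbf k=(k_1,\dots,k_q)\in[0,\infty)^q$. A policy $\pi=\{\pi_t\}$ is a sequence of stochastic kernels on $\mathsf A$ given the history spaces $\mathsf H_t=(\mathsf X\times\mathsf A)^t\times\mathsf X$; $\Pi$ is the set of all policies. $\mathbb E_\gamma^\pi$ is expectation under the law of $(X_t,A_t)_{t\ge0}$ determined by $\gamma$, $\pi$, $p$. **Discounted criterion.** Fix $\beta\in(0,1)$. $J(\pi,\gamma)=(1-\beta)\mathbb E_\gamma^\pi[\sum_{t\ge0}\beta^tc(X_t,A_t)]$, and $J_l(\pi,\gamma)$ is the same with $d_l$ in place of $c$. $(\mathbf{CP}^{\mathbf k})$: minimize $J(\pi,\gamma)$ over $\pi\in\Pi$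 subject to $J_l(\pi,\gamma)\le k_l$, $l=1,\dots,q$. Standing assumption: there is $\pi\in\Pi$ with $J_l(\pi,\gamma)<k_l$ for all $l$. **Finite models.** For each $n\ge1$ let $\mathsf X_n=\{x_{n,1},\dots,x_{n,k_n}\}\subset\mathsf X$ be finite with $\min_i d_{\mathsf X}(x,x_{n,i})<1/n$ for all $x\in\mathsf X$; $Q_n:\mathsf X\to\mathsf X_n$ is a nearest-point map (ties broken so that $Q_n$ is measurable); $\mathcal S_{n,i}=Q_n^{-1}(x_{n,i})$. Let $\nu_n$ be a finite measure on $\mathsf X$ with $\nu_n(\mathcal S_{n,i})>0$ for all $i$, and let $\nu_{n,i}$ be the probability measure on $\mathcal S_{n,i}$ given by $\nu_{n,i}(\cdot)=\nu_n(\cdot)/\nu_n(\mathcal S_{n,i})$. MDP$_n$ has state space $\mathsf X_n$, action space $\mathsf A$, initial distribution $\gamma_n=\gamma\circ Q_n^{-1}$, and $p_n(x_{n,j}|x_{n,i},a)=\int_{\mathcal S_{n,i}}p(\mathcal S_{n,j}|x,a)\,\nu_{n,i}(dx)$, $c_n(x_{n,i},a)=\int_{\mathcal S_{n,i}}c(x,a)\,\nu_{n,i}(dx)$, $d_{l,n}(x_{n,i},a)=\int_{\mathcal S_{n,i}}d_l(x,a)\,\nu_{n,i}(dx)$. Its policies $\Pi_n$ and discounted costs $J_n,J_{l,n}$ (for $c_n,d_{l,n}$) are defined as for the original model. $(\mathbf{CP}_n^{\mathbf k})$: minimize $J_n(\pi,\gamma_n)$ over $\pi\in\Pi_n$ subject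 to $J_{l,n}(\pi,\gamma_n)\le k_l$ for all $l$. $\min(\cdot)$ denotes the optimal value of a problem (with value $+\infty$ if it is infeasible). *)

theory Defs
  imports "HOL-Probability.Probability"
begin

class compact_metric_space = metric_space +
  assumes compact_UNIV: "compact (UNIV :: 'a set)"

text \<open>
  Compact metric spaces are second countable; with this instance the Borel algebra of
  a product of two such spaces is the product of the Borel algebras.
\<close>

instance compact_metric_space \<subseteq> second_countable_topology
proof
  have "\<exists>K. finite K \<and> (UNIV :: 'a set) \<subseteq> (\<Union>x\<in>K. ball x (inverse (real (Suc n))))" for n
    using compact_UNIV[where 'a='a] inverse_positive_iff_positive
    unfolding compact_eq_totally_bounded by (metis of_nat_0_less_iff zero_less_Suc)
  then obtain K :: "nat \<Rightarrow> 'a set" where K: "\<And>n. finite (K n)"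
      "\<And>n. UNIV \<subseteq> (\<Union>x\<in>K n. ball x (inverse (real (Suc n))))"
    by metis
  define B where "B = (\<Union>n. (\<lambda>x. ball x (inverse (real (Suc n)))) ` K n)"
  have "countable B"
    unfolding B_def using K(1) by (intro countable_UN countableI_type countable_image countable_finite)
  moreover have "topological_basis B"
  proof (rule topological_basisI)
    fix U :: "'a set" and x assume "open U" "x \<in> U"
    then obtain e where e: "e > 0" "ball x e \<subseteq> U"
      by (meson openE)
    obtain n where n: "inverse (real (Suc n)) < e / 2"
      using reals_Archimedean[of "e / 2"] e by auto
    obtain y where y: "y \<in> K n" "x \<in> ball y (inverse (real (Suc n)))"
      using K(2)[of n] by blast
    have "ball y (inverse (real (Suc n))) \<subseteq> ball x e"
    proof
      fix z assume "z \<in> ball y (inverse (real (Suc n)))"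
      then show "z \<in> ball x e"
        using y(2) n dist_triangle[of x z y] by (simp add: dist_commute)
    qed
    then show "\<exists>B'\<in>B. x \<in> B' \<and> B' \<subseteq> U"
      using y e unfolding B_def by blast
  qed (auto simp: B_def)
  ultimately show "\<exists>B :: 'a set set. countable B \<and> open = generate_topology B"
    using topological_basis_imp_subbasis by blast
qed

record ('x, 'a) cmdp =
  states :: "'x measure"
  actions :: "'a measure"
  trans_kernel :: "'x \<times> 'a \<Rightarrow> 'x measure"
  cost :: "'x \<times> 'a \<Rightarrow> real"
  ccost :: "nat \<Rightarrow> 'x \<times> 'a \<Rightarrow> real"
  init_law :: "'x measure"

text \<open>
  \<open>states\<close> and \<open>actions\<close> are used as measurable spaces only.
  A history at time \<open>t\<close> is a pair \<open>(h, x)\<close>, where \<open>h\<close> lists the state-action pairs at the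
  times before \<open>t\<close> and \<open>x\<close> is the state at time \<open>t\<close>.
\<close>

definition histories :: "('x, 'a) cmdp \<Rightarrow> nat \<Rightarrow> ((nat \<Rightarrow> 'x \<times> 'a) \<times> 'x) measure" where
  "histories M t = PiM {0..<t} (\<lambda>_. states M \<Otimes>\<^sub>M actions M) \<Otimes>\<^sub>M states M"

type_synonym ('x, 'a) policy = "nat \<Rightarrow> (nat \<Rightarrow> 'x \<times> 'a) \<times> 'x \<Rightarrow> 'a measure"

definition policies :: "('x, 'a) cmdp \<Rightarrow> ('x, 'a) policy set" where
  "policies M = {\<pi>. \<forall>t. \<pi> t \<in> histories M t \<rightarrow>\<^sub>M prob_algebra (actions M)}"

definition state_law :: "('x, 'a) cmdp \<Rightarrow> nat \<Rightarrow> (nat \<Rightarrow> 'x \<times> 'a) \<Rightarrow> 'x measure" where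
  "state_law M t h = (if t = 0 then init_law M else trans_kernel M (h (t - 1)))"

text \<open>
  Conditional law of the state-action pair at time \<open>t\<close>, given the pairs at earlier times.
\<close>

definition step_law ::
  "('x, 'a) cmdp \<Rightarrow> ('x, 'a) policy \<Rightarrow> nat \<Rightarrow> (nat \<Rightarrow> 'x \<times> 'a) \<Rightarrow> ('x \<times> 'a) measure" where
  "step_law M \<pi> t h =
     state_law M t h \<bind> (\<lambda>x. distr (\<pi> t (h, x)) (states M \<Otimes>\<^sub>M actions M) (Pair x))"

lemma step_law_kernel:
  assumes init: "init_law M \<in> space (prob_algebra (states M))"
    and trans: "trans_kernel M \<in> states M \<Otimes>\<^sub>M actions M \<rightarrow>\<^sub>M prob_algebra (states M)"
    and \<pi>: "\<pi> \<in> policies M"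
  shows "step_law M \<pi> t \<in> PiM {0..<t} (\<lambda>_. states M \<Otimes>\<^sub>M actions M)
           \<rightarrow>\<^sub>M prob_algebra (states M \<Otimes>\<^sub>M actions M)"
proof -
  let ?H = "PiM {0..<t} (\<lambda>_. states M \<Otimes>\<^sub>M actions M)"
  have state: "state_law M t \<in> ?H \<rightarrow>\<^sub>M prob_algebra (states M)"
  proof (cases "t = 0")
    case True
    then show ?thesis using init by (simp add: state_law_def[abs_def])
  next
    case False
    then have "(\<lambda>h. h (t - 1)) \<in> ?H \<rightarrow>\<^sub>M states M \<Otimes>\<^sub>M actions M"
      by (intro measurable_component_singleton) auto
    from measurable_compose[OF this trans] False show ?thesis
      by (simp add: state_law_def[abs_def])
  qed
  have "\<pi> t \<in> ?H \<Otimes>\<^sub>M states M \<rightarrow>\<^sub>M prob_algebra (actions M)"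
    using \<pi> by (simp add: policies_def histories_def)
  then have "(\<lambda>z. distr (\<pi> t z) (states M \<Otimes>\<^sub>M actions M) (Pair (snd z)))
      \<in> ?H \<Otimes>\<^sub>M states M \<rightarrow>\<^sub>M prob_algebra (states M \<Otimes>\<^sub>M actions M)"
    by (rule measurable_distr_prob_space2) (simp add: case_prod_unfold)
  then show ?thesis
    unfolding step_law_def[abs_def]
    by (intro measurable_bind_prob_space2[OF state]) (simp add: case_prod_unfold)
qed

lemma Ionescu_Tulcea_step_law:
  assumes "init_law M \<in> space (prob_algebra (states M))"
    and "trans_kernel M \<in> states M \<Otimes>\<^sub>M actions M \<rightarrow>\<^sub>M prob_algebra (states M)"
    and "\<pi> \<in> policies M"
  shows "Ionescu_Tulcea (step_law M \<pi>) (\<lambda>_. states M \<Otimes>\<^sub>M actions M)"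
proof (rule Ionescu_Tulcea.intro, goal_cases)
  case (1 i)
  show ?case
    by (intro measurable_prob_algebraD step_law_kernel assms)
next
  case (2 i x)
  then show ?case
    using measurable_space[OF step_law_kernel[OF assms] 2] by (simp add: space_prob_algebra)
qed

text \<open>
  The law of the whole trajectory is the measure given by the Ionescu-Tulcea theorem
  (the constants below are those underlying \<open>PF.lim\<close> in the locale \<^locale>\<open>Ionescu_Tulcea\<close>).
\<close>

definition path_law :: "('x, 'a) cmdp \<Rightarrow> ('x, 'a) policy \<Rightarrow> (nat \<Rightarrow> 'x \<times> 'a) measure" where
  "path_law M \<pi> =
     projective_family.lim UNIV
       (Ionescu_Tulcea.CI (step_law M \<pi>) (\<lambda>_. states M \<Otimes>\<^sub>M actions M))
       (\<lambda>_. states M \<Otimes>\<^sub>M actions M)"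

definition disc_cost ::
  "real \<Rightarrow> ('x, 'a) cmdp \<Rightarrow> ('x \<times> 'a \<Rightarrow> real) \<Rightarrow> ('x, 'a) policy \<Rightarrow> real" where
  "disc_cost \<beta> M f \<pi> = (1 - \<beta>) * (\<integral>\<omega>. (\<Sum>t. \<beta> ^ t * f (\<omega> t)) \<partial>path_law M \<pi>)"

definition feasible :: "real \<Rightarrow> nat \<Rightarrow> (nat \<Rightarrow> real) \<Rightarrow> ('x, 'a) cmdp \<Rightarrow> ('x, 'a) policy set" where
  "feasible \<beta> q k M = {\<pi> \<in> policies M. \<forall>l\<in>{1..q}. disc_cost \<beta> M (ccost M l) \<pi> \<le> k l}"

text \<open>The value is \<open>\<infinity>\<close> if no policy is feasible.\<close>

definition opt_value :: "real \<Rightarrow> nat \<Rightarrow> (nat \<Rightarrow> real) \<Rightarrow> ('x, 'a) cmdp \<Rightarrow> ereal" where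
  "opt_value \<beta> q k M = (INF \<pi>\<in>feasible \<beta> q k M. ereal (disc_cost \<beta> M (cost M) \<pi>))"

definition weakly_continuous_kernel ::
  "('x::topological_space \<times> 'a::topological_space \<Rightarrow> 'x measure) \<Rightarrow> bool" where
  "weakly_continuous_kernel p \<longleftrightarrow>
     (\<forall>f :: 'x \<Rightarrow> real. continuous_on UNIV f \<and> bounded (range f) \<longrightarrow>
        continuous_on UNIV (\<lambda>z. \<integral>y. f y \<partial>p z))"

definition nearest_point_map :: "'x::metric_space set \<Rightarrow> ('x \<Rightarrow> 'x) \<Rightarrow> bool" where
  "nearest_point_map Y Q \<longleftrightarrow>
     Q \<in> borel \<rightarrow>\<^sub>M count_space Y \<and> (\<forall>x. Q x \<in> Y \<and> (\<forall>y\<in>Y. dist x (Q x) \<le> dist x y))"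

text \<open>
  The finite-state model on \<open>Y\<close> with quantizer \<open>Q\<close>; the cell of \<open>y\<close> is \<open>Q -` {y}\<close>.
  The measure \<^term>\<open>uniform_measure \<nu> S\<close> is the normalised restriction
  \<open>\<nu>(\<cdot> \<inter> S) / \<nu>(S)\<close>, regarded as a measure on the whole space.
\<close>

definition cell_measure :: "'x measure \<Rightarrow> ('x \<Rightarrow> 'x) \<Rightarrow> 'x \<Rightarrow> 'x measure" where
  "cell_measure \<nu> Q y = uniform_measure \<nu> (Q -` {y})"

definition finite_model ::
  "'x set \<Rightarrow> ('x \<Rightarrow> 'x) \<Rightarrow> 'x measure \<Rightarrow> ('x, 'a) cmdp \<Rightarrow> ('x, 'a) cmdp" where
  "finite_model Y Q \<nu> M =
    \<lparr> states = count_space Y,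
      actions = actions M,
      trans_kernel = (\<lambda>(y, a). point_measure Y
        (\<lambda>z. \<integral>\<^sup>+x. emeasure (trans_kernel M (x, a)) (Q -` {z}) \<partial>cell_measure \<nu> Q y)),
      cost = (\<lambda>(y, a). \<integral>x. cost M (x, a) \<partial>cell_measure \<nu> Q y),
      ccost = (\<lambda>l (y, a). \<integral>x. ccost M l (x, a) \<partial>cell_measure \<nu> Q y),
      init_law = distr (init_law M) (count_space Y) Q \<rparr>"

end

theory Submission
  imports Defs
begin

text \<open>
  The proof compares linear functionals instead of policies.  A policy \<open>\<pi>\<close> has an occupation
  measure \<open>\<mu>\<close>, the law of the state-action pair at an independent geometric time, and
  its discounted costs are the integrals \<open>\<integral>c d\<mu>\<close> and \<open>\<integral>d\<^sub>l d\<mu>\<close>.  The constrained problem thus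
  minimizes one linear functional over a set of measures, subject to upper bounds on
  finitely many others.

  Convex analysis reduces constrained values to unconstrained ones.  If sets
  \<open>F\<^sub>n\<close> and \<open>G\<close> of functionals are convex and uniformly bounded on each test function, and if
  \<open>inf {L f | L \<in> F\<^sub>n}\<close> tends to \<open>inf {L f | L \<in> G}\<close> for every
  continuous \<open>f\<close>, then the infima under constraints converge as well, provided that \<open>G\<close>
  contains a strictly feasible point.  This is \<open>converging_infima_constrained\<close>; constraints are
  added one at a time, and for a single constraint the argument takes place in the plane
  of the values \<open>(L d, L f)\<close>, where a separating line is a Lagrange multiplier.

  The set of all occupation measures lies between two convex sets.  The larger one consists
  of the solutions \<open>\<mu>\<close> of the balance equation \<open>\<mu>\<^sub>X = (1 - \<beta>) \<gamma> + \<beta> \<mu> p\<close>, which every occupation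
  measure satisfies (\<open>balanced_occupation\<close>).  The smaller one consists of the
  solutions that disintegrate as \<open>\<mu> = \<mu>\<^sub>X \<otimes> \<phi>\<close>; each of them is the occupation measure of the
  stationary policy \<open>\<phi>\<close> (\<open>cost_of_balanced_randomized\<close>).  A mixture of two of them is of the same kind, since the
  Radon-Nikodym density of a component with respect to the mixed state law tells with which
  probability each of the two kernels has to be used (\<open>randomized_by_mixture\<close>).

  For the unconstrained values let \<open>V\<close> be a continuous approximate solution of the Bellman equation
  of the original model, and let \<open>g (x, a) = (1 - \<beta>) f (x, a) + \<beta> \<integral>V dp(\<cdot>|x, a) - V x\<close>.  The balance equation gives
  \<open>\<integral>g d\<mu> = (1 - \<beta>) (\<integral>f d\<mu> - \<integral>V d\<gamma>)\<close>.  As \<open>g\<close> is nearly nonnegative, \<open>\<integral>f d\<mu>\<close> is at least about \<open>\<integral>V d\<gamma>\<close> for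
  all solutions \<open>\<mu>\<close> of the balance equation; a measurable selector on which \<open>g\<close> nearly vanishes attains this
  value.  Weak continuity of \<open>p\<close> and compactness make \<open>V\<close> and \<open>g\<close> uniformly continuous, so on a fine grid
  the corresponding function of the finite model is close to the cell averages of \<open>g\<close>
  (\<open>bellman_gap_MY\<close>), and the same \<open>V\<close> and the same selector serve all finite models.
  Hence the unconstrained infima over the smaller and the larger sets of the finite models, and over those of the
  original model, all agree with \<open>\<integral>V d\<gamma>\<close> up to an error that becomes arbitrarily small.  By the convex analysis
  the same holds for the constrained infima, and the optimal values lie between them.
\<close>

section \<open>Constrained infima over convex sets of functionals\<close>

text \<open>
  The infimum of \<open>L f\<close> over \<open>L \<in> F n\<close> tends to the infimum over \<open>L \<in> G\<close>, spelt out as an upper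
  and a lower estimate.  In this form it makes sense for empty sets too, which occur among the
  constrained sets for small \<open>n\<close>.
\<close>

definition converging_infima ::
  "(nat \<Rightarrow> (('z \<Rightarrow> real) \<Rightarrow> real) set) \<Rightarrow> (('z \<Rightarrow> real) \<Rightarrow> real) set \<Rightarrow> ('z \<Rightarrow> real) \<Rightarrow> bool" where
  "converging_infima F G f \<longleftrightarrow>
     (\<forall>L\<in>G. \<forall>e>0. \<forall>\<^sub>F n in sequentially. \<exists>L'\<in>F n. L' f < L f + e) \<and>
     (\<forall>r. (\<forall>L\<in>G. r \<le> L f) \<longrightarrow> (\<forall>e>0. \<forall>\<^sub>F n in sequentially. \<forall>L'\<in>F n. r - e < L' f))"

text \<open>
  It is enough that all sets share an approximate infimum \<open>w\<close>, which may depend on the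
  precision \<open>e\<close>.
\<close>

lemma converging_infima_of_common_value:
  assumes "\<And>e. e > 0 \<Longrightarrow> \<exists>w. (\<forall>L\<in>G. w - e \<le> L f) \<and> (\<exists>L\<in>G. L f \<le> w + e) \<and>
    (\<forall>\<^sub>F n in sequentially. (\<forall>L\<in>F n. w - e \<le> L f) \<and> (\<exists>L\<in>F n. L f \<le> w + e))"
  shows "converging_infima F G f"
  unfolding converging_infima_def
proof (intro conjI ballI allI impI)
  fix L and e :: real assume L: "L \<in> G" and e: "e > 0"
  obtain w where w: "\<forall>L\<in>G. w - e / 3 \<le> L f" "\<forall>\<^sub>F n in sequentially.
      (\<forall>L\<in>F n. w - e / 3 \<le> L f) \<and> (\<exists>L\<in>F n. L f \<le> w + e / 3)"
    using assms[of "e / 3"] e by auto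
  have "w + e / 3 < L f + e" using w(1) L e by force
  with w(2) show "\<forall>\<^sub>F n in sequentially. \<exists>L'\<in>F n. L' f < L f + e"
    by (auto elim!: eventually_mono intro: le_less_trans)
next
  fix r e :: real assume r: "\<forall>L\<in>G. r \<le> L f" and e: "e > 0"
  obtain w where w: "\<exists>L\<in>G. L f \<le> w + e / 3" "\<forall>\<^sub>F n in sequentially.
      (\<forall>L\<in>F n. w - e / 3 \<le> L f) \<and> (\<exists>L\<in>F n. L f \<le> w + e / 3)"
    using assms[of "e / 3"] e by auto
  have "r - e < w - e / 3" using w(1) r e by force
  with w(2) show "\<forall>\<^sub>F n in sequentially. \<forall>L'\<in>F n. r - e < L' f"
    by (auto elim!: eventually_mono intro: less_le_trans)
qed

text \<open>
  Functionals are used on the test functions \<open>D\<close> only.  They stem from integrals, which are not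
  additive on arbitrary functions, and equality of two functionals matters only on \<open>D\<close>.
\<close>

definition affine_on :: "('z \<Rightarrow> real) set \<Rightarrow> (('z \<Rightarrow> real) \<Rightarrow> real) set \<Rightarrow> bool" where
  "affine_on D F \<longleftrightarrow> (\<forall>L\<in>F. \<forall>f\<in>D. \<forall>g\<in>D. \<forall>s\<in>{0..1}.
     L (\<lambda>z. s * f z + (1 - s) * g z) = s * L f + (1 - s) * L g)"

definition convex_on_tests :: "('z \<Rightarrow> real) set \<Rightarrow> (('z \<Rightarrow> real) \<Rightarrow> real) set \<Rightarrow> bool" where
  "convex_on_tests D F \<longleftrightarrow> (\<forall>L1\<in>F. \<forall>L2\<in>F. \<forall>s\<in>{0..1}. \<exists>L\<in>F. \<forall>f\<in>D. L f = s * L1 f + (1 - s) * L2 f)"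

text \<open>
  A hyperplane separating \<open>C\<close> from the quadrant \<open>{..k} \<times> {..<w}\<close> has a normal with nonnegative
  coordinates because the quadrant is unbounded in both directions; scaled to sum \<open>1\<close>, the normal
  is \<open>(s, 1 - s)\<close>.
\<close>

lemma separation_from_quadrant:
  fixes C :: "(real \<times> real) set"
  assumes "convex C" and disj: "\<And>p. p \<in> C \<Longrightarrow> fst p \<le> k \<Longrightarrow> w \<le> snd p"
  shows "\<exists>s\<in>{0..1}. \<forall>p\<in>C. s * k + (1 - s) * w \<le> s * fst p + (1 - s) * snd p"
proof (cases "C = {}")
  case True
  then show ?thesis by (intro bexI[of _ 0]) auto
next
  case False
  let ?R = "{..k} \<times> {..<w}"
  have "convex ?R"
    by (intro convex_Times) auto
  moreover have "(k, w - 1) \<in> ?R" by simp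
  moreover have "?R \<inter> C = {}"
    using disj by force
  ultimately obtain a b where a: "a \<noteq> 0" and R: "\<And>p. p \<in> ?R \<Longrightarrow> inner a p \<le> b"
    and C: "\<And>p. p \<in> C \<Longrightarrow> b \<le> inner a p"
    using separating_hyperplane_sets[of ?R C] \<open>convex C\<close> False by blast
  obtain a1 a2 where a_eq: "a = (a1, a2)" by (cases a)
  have R': "a1 * x + a2 * y \<le> b" if "x \<le> k" "y < w" for x y
    using R[of "(x, y)"] that by (simp add: a_eq)
  have "a1 \<ge> 0"
  proof (rule ccontr)
    assume "\<not> a1 \<ge> 0"
    \<comment> \<open>Moving far enough into the quadrant would exceed the bound \<open>b\<close> if the coordinate were negative.\<close>
    define t where "t = (\<bar>b - a1 * k - a2 * (w - 1)\<bar> + 1) / (- a1)"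
    have "t \<ge> 0" and "- a1 * t = \<bar>b - a1 * k - a2 * (w - 1)\<bar> + 1"
      using \<open>\<not> a1 \<ge> 0\<close> unfolding t_def by (auto intro!: divide_nonneg_nonpos)
    then show False using R'[of "k - t" "w - 1"] by (auto simp: algebra_simps)
  qed
  have "a2 \<ge> 0"
  proof (rule ccontr)
    assume "\<not> a2 \<ge> 0"
    define t where "t = (\<bar>b - a1 * k - a2 * (w - 1)\<bar> + 1) / (- a2)"
    have "t \<ge> 0" and "- a2 * t = \<bar>b - a1 * k - a2 * (w - 1)\<bar> + 1"
      using \<open>\<not> a2 \<ge> 0\<close> unfolding t_def by (auto intro!: divide_nonneg_nonpos)
    then show False using R'[of k "w - 1 - t"] by (auto simp: algebra_simps)
  qed
  have corner: "a1 * k + a2 * w \<le> b"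
  proof (rule field_le_epsilon)
    fix e :: real assume "e > 0"
    have "a1 * k + a2 * (w - e / (a2 + 1)) \<le> b"
      using \<open>a2 \<ge> 0\<close> \<open>e > 0\<close> by (intro R') auto
    moreover have "a2 * (e / (a2 + 1)) \<le> e"
      using \<open>a2 \<ge> 0\<close> \<open>e > 0\<close> by (simp add: field_simps)
    ultimately show "a1 * k + a2 * w \<le> b + e"
      by (simp add: right_diff_distrib)
  qed
  have pos: "a1 + a2 > 0"
    using a \<open>a1 \<ge> 0\<close> \<open>a2 \<ge> 0\<close> by (cases "a1 = 0") (auto simp: a_eq zero_prod_def)
  show ?thesis
  proof (intro bexI[of _ "a1 / (a1 + a2)"] ballI)
    show "a1 / (a1 + a2) \<in> {0..1}"
      using \<open>a1 \<ge> 0\<close> \<open>a2 \<ge> 0\<close> pos by (auto simp: divide_simps)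
    fix p assume "p \<in> C"
    have "a1 * k + a2 * w \<le> a1 * fst p + a2 * snd p"
      using C[OF \<open>p \<in> C\<close>] corner by (cases p) (simp add: a_eq)
    moreover have "1 - a1 / (a1 + a2) = a2 / (a1 + a2)"
      using pos by (simp add: field_simps)
    ultimately show "a1 / (a1 + a2) * k + (1 - a1 / (a1 + a2)) * w
        \<le> a1 / (a1 + a2) * fst p + (1 - a1 / (a1 + a2)) * snd p"
      using pos by (simp add: add_divide_distrib[symmetric] divide_right_mono)
  qed
qed

text \<open>
  Lagrange duality for one constraint, obtained by separating the image of \<open>F\<close> under
  \<open>L \<mapsto> (L d, L f)\<close>.  The normalisation \<open>s \<in> {0..1}\<close> instead of a multiplier in \<open>[0, \<infinity>)\<close> keeps the
  multipliers in a compact set, uniformly in \<open>F\<close>.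
\<close>

lemma multiplier_for_functionals:
  assumes "convex_on_tests D F" "d \<in> D" "f \<in> D"
    and "\<And>L. L \<in> F \<Longrightarrow> L d \<le> k \<Longrightarrow> w \<le> L f"
  shows "\<exists>s\<in>{0..1}. \<forall>L\<in>F. s * k + (1 - s) * w \<le> s * L d + (1 - s) * L f"
proof -
  let ?C = "(\<lambda>L. (L d, L f)) ` F"
  have "convex ?C"
  proof (rule convexI)
    fix p q and u v :: real
    assume pq: "p \<in> ?C" "q \<in> ?C" and uv: "0 \<le> u" "0 \<le> v" "u + v = 1"
    then obtain L1 L2 where L12: "L1 \<in> F" "L2 \<in> F" "p = (L1 d, L1 f)" "q = (L2 d, L2 f)" by auto
    have v: "v = 1 - u" "u \<in> {0..1}" using uv by auto
    obtain L where "L \<in> F" "\<forall>f\<in>D. L f = u * L1 f + (1 - u) * L2 f"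
      using assms(1) L12 v unfolding convex_on_tests_def by blast
    then show "u *\<^sub>R p + v *\<^sub>R q \<in> ?C"
      using L12 v assms(2,3) by (intro image_eqI[of _ _ L]) auto
  qed
  from separation_from_quadrant[OF this, of k w] assms(4) show ?thesis
    by force
qed

text \<open>
  In both directions the constrained problem is replaced by the unconstrained problem for the
  test function \<open>s d + (1 - s) f\<close>, with a multiplier \<open>s\<close> from separation.  For the lower estimate, \<open>s\<close> comes from
  \<open>G\<close> and a single test function suffices; the strictly feasible \<open>L0\<close> ensures \<open>s < 1\<close>.  For the upper
  estimate, a set \<open>F n\<close> violating it supplies its own \<open>s\<close>, depending on \<open>n\<close>; the convergence is therefore
  used on a finite grid of multipliers at once, and uniform bounds control the passage to the nearest grid point.
\<close>

lemma converging_infima_one_constraint: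
  fixes F :: "nat \<Rightarrow> (('z \<Rightarrow> real) \<Rightarrow> real) set"
  assumes D: "\<And>f g s. f \<in> D \<Longrightarrow> g \<in> D \<Longrightarrow> s \<in> {0..1} \<Longrightarrow> (\<lambda>z. s * f z + (1 - s) * g z) \<in> D"
    and affine: "\<And>n. affine_on D (F n)" "affine_on D G"
    and convex: "\<And>n. convex_on_tests D (F n)" "convex_on_tests D G"
    and bounded: "\<And>f. f \<in> D \<Longrightarrow> \<exists>B. \<forall>n. \<forall>L\<in>F n. \<bar>L f\<bar> \<le> B"
    and conv: "\<And>f. f \<in> D \<Longrightarrow> converging_infima F G f"
    and d: "d \<in> D" and slater: "L0 \<in> G" "L0 d < k" and f: "f \<in> D"
  shows "converging_infima (\<lambda>n. {L \<in> F n. L d \<le> k}) {L \<in> G. L d \<le> k} f"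
proof -
  define h where "h s = (\<lambda>z. s * d z + (1 - s) * f z)" for s
  have h: "h s \<in> D" if "s \<in> {0..1}" for s
    unfolding h_def using D d f that by blast
  have Fh: "L (h s) = s * L d + (1 - s) * L f" if "L \<in> F n" "s \<in> {0..1}" for L n s
    using affine(1)[of n] that d f unfolding affine_on_def h_def by blast
  have Gh: "L (h s) = s * L d + (1 - s) * L f" if "L \<in> G" "s \<in> {0..1}" for L s
    using affine(2) that d f unfolding affine_on_def h_def by blast
  have "\<forall>\<^sub>F n in sequentially. \<exists>L'\<in>{L \<in> F n. L d \<le> k}. L' f < L1 f + e"
    if L1: "L1 \<in> G" "L1 d \<le> k" and e: "e > 0" for L1 e
  proof -
    define w where "w = L1 f + e"
    obtain L2 where L2: "L2 \<in> G" "L2 d < k" "L2 f < w"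
    proof -
      \<comment> \<open>A small weight on \<open>L0\<close> makes the constraint strict at the cost of at most \<open>e / 2\<close> in \<open>L f\<close>.\<close>
      define u where "u = min 1 (e / (2 * (\<bar>L0 f - L1 f\<bar> + 1)))"
      have "e / (2 * (\<bar>L0 f - L1 f\<bar> + 1)) > 0" using e
        by (intro divide_pos_pos mult_pos_pos zero_less_two add_nonneg_pos abs_ge_zero zero_less_one) simp_all
      then have u: "0 < u" "u \<le> 1" unfolding u_def by auto
      obtain L where L: "L \<in> G" "\<forall>f\<in>D. L f = u * L0 f + (1 - u) * L1 f"
        using convex(2)[unfolded convex_on_tests_def, rule_format, OF slater(1) L1(1), of u] u by auto
      have "u * L0 d + (1 - u) * L1 d < u * k + (1 - u) * k"
        using u slater L1 by (intro add_less_le_mono mult_strict_left_mono mult_left_mono) auto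
      moreover have "L d = u * L0 d + (1 - u) * L1 d" using L(2) d by blast
      ultimately have "L d < k" by (simp add: algebra_simps)
      have "u * (L0 f - L1 f) \<le> u * (\<bar>L0 f - L1 f\<bar> + 1)"
        using u by (intro mult_left_mono) auto
      also have "\<dots> \<le> e / (2 * (\<bar>L0 f - L1 f\<bar> + 1)) * (\<bar>L0 f - L1 f\<bar> + 1)"
        unfolding u_def by (intro mult_right_mono) auto
      also have "\<dots> = e / 2"
      proof -
        have "e / (2 * a) * a = e / 2" if "a \<noteq> 0" for a :: real using that by simp
        moreover have "\<bar>L0 f - L1 f\<bar> + 1 \<noteq> 0" using abs_ge_zero[of "L0 f - L1 f"] by linarith
        ultimately show ?thesis .
      qed
      finally have "u * (L0 f - L1 f) \<le> e / 2" .
      moreover have "L f = u * L0 f + (1 - u) * L1 f" using L(2) f by blast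
      ultimately have "L f < w" using e unfolding w_def by (simp add: algebra_simps)
      with L \<open>L d < k\<close> that show thesis by blast
    qed
    \<comment> \<open>\<open>L2\<close> violates every separating inequality of the corner \<open>(k, w)\<close> by at least this margin.\<close>
    define \<eta> where "\<eta> = min (k - L2 d) (w - L2 f)"
    have \<eta>: "\<eta> > 0" using L2 unfolding \<eta>_def by simp
    have gap: "L2 (h s) \<le> s * k + (1 - s) * w - \<eta>" if s: "s \<in> {0..1}" for s
    proof -
      have "s * L2 d + (1 - s) * L2 f \<le> s * (k - \<eta>) + (1 - s) * (w - \<eta>)"
        using s unfolding \<eta>_def by (intro add_mono mult_left_mono) auto
      then show ?thesis using Gh[OF L2(1) s] by (simp add: algebra_simps)
    qed
    obtain Bd where Bd: "\<And>n L. L \<in> F n \<Longrightarrow> \<bar>L d\<bar> \<le> Bd" using bounded[OF d] by blast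
    obtain Bf where Bf: "\<And>n L. L \<in> F n \<Longrightarrow> \<bar>L f\<bar> \<le> Bf" using bounded[OF f] by blast
    \<comment> \<open>A Lipschitz constant in \<open>s\<close> of the differences that appear when \<open>s\<close> is moved to the grid.\<close>
    define B where "B = \<bar>Bd\<bar> + \<bar>Bf\<bar> + \<bar>k\<bar> + \<bar>w\<bar> + 1"
    have B: "B > 0" unfolding B_def by auto
    obtain N :: nat where N: "N > 0" "B / real N < \<eta> / 2"
    proof -
      obtain N :: nat where "real N > B / (\<eta> / 2)" using reals_Archimedean2 by blast
      moreover have "B / (\<eta> / 2) > 0" using B \<eta> by simp
      ultimately have "N > 0" by (metis of_nat_0_less_iff less_trans)
      moreover have "B / real N < \<eta> / 2"
        using \<open>real N > B / (\<eta> / 2)\<close> \<open>N > 0\<close> \<eta> by (simp add: field_simps)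
      ultimately show thesis using that by blast
    qed
    have "\<forall>\<^sub>F n in sequentially. \<forall>i\<in>{..N}. \<exists>L'\<in>F n. L' (h (i / N)) < L2 (h (i / N)) + \<eta> / 2"
    proof (rule eventually_ball_finite)
      show "\<forall>i\<in>{..N}. \<forall>\<^sub>F n in sequentially. \<exists>L'\<in>F n. L' (h (i / N)) < L2 (h (i / N)) + \<eta> / 2"
      proof
        fix i assume "i \<in> {..N}"
        then have "h (i / N) \<in> D" using N by (intro h) auto
        from conv[OF this] show "\<forall>\<^sub>F n in sequentially. \<exists>L'\<in>F n. L' (h (i / N)) < L2 (h (i / N)) + \<eta> / 2"
          using L2(1) \<eta> unfolding converging_infima_def by (meson half_gt_zero)
      qed
    qed simp
    then show ?thesis
    proof (rule eventually_mono)
      fix n assume grid: "\<forall>i\<in>{..N}. \<exists>L'\<in>F n. L' (h (i / N)) < L2 (h (i / N)) + \<eta> / 2"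
      show "\<exists>L'\<in>{L \<in> F n. L d \<le> k}. L' f < L1 f + e"
      proof (rule ccontr)
        assume "\<not> ?thesis"
        then have below: "\<And>L. L \<in> F n \<Longrightarrow> L d \<le> k \<Longrightarrow> w \<le> L f"
          unfolding w_def by force
        obtain s
          where s: "s \<in> {0..1}" and sep: "\<And>L. L \<in> F n \<Longrightarrow> s * k + (1 - s) * w \<le> s * L d + (1 - s) * L f"
          using multiplier_for_functionals[OF convex(1)[of n] d f, of k w] below by blast
        define i where "i = nat \<lfloor>s * N\<rfloor>"
        have i: "real i \<le> s * N" "s * N < real i + 1"
          using s unfolding i_def by (auto simp: floor_correct)
        have "s * N \<le> N" using s by (auto simp: mult_left_le_one_le)
        then have "i \<le> N" using i by linarith
        define s' where "s' = i / N"
        have "s - s' = (s * N - i) / N"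
          using N by (simp add: s'_def diff_divide_distrib)
        moreover have "(s * N - i) / N \<le> 1 / N"
          using i by (intro divide_right_mono) auto
        moreover have "0 \<le> (s * N - i) / N"
          using i by simp
        ultimately have s': "s' \<in> {0..1}" "s' \<le> s" "s - s' \<le> 1 / N"
          using s by (auto simp: s'_def)
        from grid \<open>i \<le> N\<close> obtain L' where L': "L' \<in> F n" "L' (h s') < L2 (h s') + \<eta> / 2"
          unfolding s'_def by auto
        have "s * k + (1 - s) * w \<le> s * L' d + (1 - s) * L' f" by (rule sep[OF L'(1)])
        also have "\<dots> = (s' * L' d + (1 - s') * L' f) + (s - s') * (L' d - L' f)"
          by (simp add: algebra_simps)
        also have "s' * L' d + (1 - s') * L' f < L2 (h s') + \<eta> / 2"
          using L' Fh s' by simp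
        also have "L2 (h s') \<le> s' * k + (1 - s') * w - \<eta>" by (rule gap[OF s'(1)])
        finally have "\<eta> / 2 < (s - s') * (L' d - L' f - k + w)"
          by (simp add: algebra_simps)
        also have "\<dots> \<le> (s - s') * B"
          using s' Bd[OF L'(1)] Bf[OF L'(1)] unfolding B_def by (intro mult_left_mono) auto
        also have "\<dots> \<le> 1 / N * B" using s' B by (intro mult_right_mono) auto
        finally show False using N by simp
      qed
    qed
  qed
  moreover have "\<forall>\<^sub>F n in sequentially. \<forall>L'\<in>{L \<in> F n. L d \<le> k}. r - e < L' f"
    if r: "\<forall>L\<in>{L \<in> G. L d \<le> k}. r \<le> L f" and e: "e > 0" for r e
  proof -
    from r multiplier_for_functionals[OF convex(2) d f, of k r] obtain s
      where s: "s \<in> {0..1}" and sep: "\<And>L. L \<in> G \<Longrightarrow> s * k + (1 - s) * r \<le> s * L d + (1 - s) * L f"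
      by blast
    have "s < 1"
      using sep[OF slater(1)] slater(2) s by (cases "s = 1") auto
    have "\<forall>L\<in>G. s * k + (1 - s) * r \<le> L (h s)"
      using sep Gh s by simp
    then have "\<forall>\<^sub>F n in sequentially. \<forall>L'\<in>F n. s * k + (1 - s) * r - (1 - s) * e < L' (h s)"
      using conv[OF h[OF s]] e \<open>s < 1\<close> unfolding converging_infima_def by simp
    then show ?thesis
    proof (rule eventually_mono, intro ballI)
      fix n L' assume lower: "\<forall>L'\<in>F n. s * k + (1 - s) * r - (1 - s) * e < L' (h s)"
        and "L' \<in> {L \<in> F n. L d \<le> k}"
      then have L': "L' \<in> F n" "L' d \<le> k" by auto
      have "s * k + (1 - s) * r - (1 - s) * e < s * L' d + (1 - s) * L' f"
        using lower L' Fh[OF L'(1) s] by auto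
      also have "s * L' d \<le> s * k" using s L' by (intro mult_left_mono) auto
      finally have "(1 - s) * (r - e) < (1 - s) * L' f" by (simp add: algebra_simps)
      then show "r - e < L' f" using \<open>s < 1\<close> by simp
    qed
  qed
  ultimately show ?thesis
    unfolding converging_infima_def by auto
qed

definition constrained ::
  "(('z \<Rightarrow> real) \<Rightarrow> real) set \<Rightarrow> (nat \<Rightarrow> 'z \<Rightarrow> real) \<Rightarrow> (nat \<Rightarrow> real) \<Rightarrow> nat \<Rightarrow> (('z \<Rightarrow> real) \<Rightarrow> real) set" where
  "constrained F d k q = {L \<in> F. \<forall>l\<in>{1..q}. L (d l) \<le> k l}"

lemma constrained_0 [simp]: "constrained F d k 0 = F"
  by (simp add: constrained_def)

lemma constrained_Suc:
  "constrained F d k (Suc q) = {L \<in> constrained F d k q. L (d (Suc q)) \<le> k (Suc q)}"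
  by (auto simp: constrained_def atLeastAtMostSuc_conv)

text \<open>
  Convexity survives adding constraints, so that constraints can be added one by one.
\<close>

lemma convex_on_tests_constrained:
  assumes F: "convex_on_tests D F" and d: "\<And>l. l \<in> {1..q} \<Longrightarrow> d l \<in> D"
  shows "convex_on_tests D (constrained F d k q)"
  unfolding convex_on_tests_def
proof (intro ballI)
  fix L1 L2 and s :: real
  assume L12: "L1 \<in> constrained F d k q" "L2 \<in> constrained F d k q" and s: "s \<in> {0..1}"
  then obtain L where L: "L \<in> F" "\<forall>f\<in>D. L f = s * L1 f + (1 - s) * L2 f"
    using F unfolding convex_on_tests_def constrained_def by blast
  have "L (d l) \<le> k l" if "l \<in> {1..q}" for l
  proof -
    have "s * L1 (d l) + (1 - s) * L2 (d l) \<le> s * k l + (1 - s) * k l"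
      using L12 s that unfolding constrained_def by (intro add_mono mult_left_mono) auto
    moreover have "L (d l) = s * L1 (d l) + (1 - s) * L2 (d l)" using L(2) d[OF that] by blast
    ultimately show ?thesis by (simp add: algebra_simps)
  qed
  with L show "\<exists>L\<in>constrained F d k q. \<forall>f\<in>D. L f = s * L1 f + (1 - s) * L2 f"
    unfolding constrained_def by blast
qed

text \<open>
  Induction on the number of constraints.  The induction hypothesis is used for all test functions \<open>f\<close>, since
  the step applies it to the combinations of \<open>d (Suc q)\<close> with the objective.
\<close>

theorem converging_infima_constrained:
  fixes F :: "nat \<Rightarrow> (('z \<Rightarrow> real) \<Rightarrow> real) set"
  assumes D: "\<And>f g s. f \<in> D \<Longrightarrow> g \<in> D \<Longrightarrow> s \<in> {0..1} \<Longrightarrow> (\<lambda>z. s * f z + (1 - s) * g z) \<in> D"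
    and affine: "\<And>n. affine_on D (F n)" "affine_on D G"
    and convex: "\<And>n. convex_on_tests D (F n)" "convex_on_tests D G"
    and bounded: "\<And>f. f \<in> D \<Longrightarrow> \<exists>B. \<forall>n. \<forall>L\<in>F n. \<bar>L f\<bar> \<le> B"
    and conv: "\<And>f. f \<in> D \<Longrightarrow> converging_infima F G f"
    and d: "\<And>l. l \<in> {1..q} \<Longrightarrow> d l \<in> D"
    and slater: "L0 \<in> G" "\<And>l. l \<in> {1..q} \<Longrightarrow> L0 (d l) < k l"
    and f: "f \<in> D"
  shows "converging_infima (\<lambda>n. constrained (F n) d k q) (constrained G d k q) f"
  using d slater(2) f
proof (induction q arbitrary: f)
  case 0
  then show ?case using conv by simp
next
  case (Suc q)
  have "converging_infima (\<lambda>n. {L \<in> constrained (F n) d k q. L (d (Suc q)) \<le> k (Suc q)})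
      {L \<in> constrained G d k q. L (d (Suc q)) \<le> k (Suc q)} f"
  proof (rule converging_infima_one_constraint[where D = D])
    show "affine_on D (constrained (F n) d k q)" for n
      using affine(1)[of n] unfolding affine_on_def constrained_def by auto
    show "affine_on D (constrained G d k q)"
      using affine(2) unfolding affine_on_def constrained_def by auto
    show "convex_on_tests D (constrained (F n) d k q)" "convex_on_tests D (constrained G d k q)" for n
      using convex Suc.prems(1) by (auto intro: convex_on_tests_constrained)
    show "\<exists>B. \<forall>n. \<forall>L\<in>constrained (F n) d k q. \<bar>L g\<bar> \<le> B" if "g \<in> D" for g
      using bounded[OF that] unfolding constrained_def by blast
    show "converging_infima (\<lambda>n. constrained (F n) d k q) (constrained G d k q) g" if "g \<in> D" for g
      using Suc that by auto
    show "L0 \<in> constrained G d k q"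
      using slater(1) Suc.prems(2) unfolding constrained_def by (auto intro: less_imp_le)
  qed (use D Suc.prems in auto)
  then show ?case by (simp add: constrained_Suc)
qed

section \<open>Bounded measurable functions, kernels and mixtures\<close>

text \<open>
  Bounded functions are integrable with respect to every probability measure and are preserved by kernels,
  which makes the integral identities below free of integrability conditions.
\<close>

definition bounded_measurable :: "'a measure \<Rightarrow> ('a \<Rightarrow> real) set" where
  "bounded_measurable M = {f \<in> borel_measurable M. \<exists>B. \<forall>x\<in>space M. \<bar>f x\<bar> \<le> B}"

lemma bounded_measurableI:
  "f \<in> borel_measurable M \<Longrightarrow> (\<And>x. x \<in> space M \<Longrightarrow> \<bar>f x\<bar> \<le> B) \<Longrightarrow> f \<in> bounded_measurable M"
  unfolding bounded_measurable_def by blast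

lemma bounded_measurableE:
  assumes "f \<in> bounded_measurable M"
  obtains B where "B \<ge> 0" "f \<in> borel_measurable M" "\<And>x. x \<in> space M \<Longrightarrow> \<bar>f x\<bar> \<le> B"
proof -
  from assms obtain B where "f \<in> borel_measurable M" "\<forall>x\<in>space M. \<bar>f x\<bar> \<le> B"
    unfolding bounded_measurable_def by blast
  then show thesis
    by (intro that[of "\<bar>B\<bar>"]) force+
qed

lemma bounded_measurable_measurable: "f \<in> bounded_measurable M \<Longrightarrow> f \<in> borel_measurable M"
  unfolding bounded_measurable_def by blast

lemma bounded_measurable_compose:
  assumes "f \<in> bounded_measurable N" "g \<in> M \<rightarrow>\<^sub>M N"
  shows "(\<lambda>x. f (g x)) \<in> bounded_measurable M"
  using assms measurable_compose[of g M N f borel] measurable_space[of g M N]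
  unfolding bounded_measurable_def by blast

lemma bounded_measurable_const: "(\<lambda>x. c) \<in> bounded_measurable M"
  by (rule bounded_measurableI[of _ _ "\<bar>c\<bar>"]) auto

lemma bounded_measurable_add:
  assumes "f \<in> bounded_measurable M" "g \<in> bounded_measurable M"
  shows "(\<lambda>x. f x + g x) \<in> bounded_measurable M"
proof -
  obtain A B where "\<And>x. x \<in> space M \<Longrightarrow> \<bar>f x\<bar> \<le> A" "\<And>x. x \<in> space M \<Longrightarrow> \<bar>g x\<bar> \<le> B"
    using assms unfolding bounded_measurable_def by blast
  then have "\<bar>f x + g x\<bar> \<le> A + B" if "x \<in> space M" for x
    using that abs_triangle_ineq[of "f x" "g x"] by (meson add_mono order_trans)
  then show ?thesis
    using assms[THEN bounded_measurable_measurable] by (intro bounded_measurableI) auto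
qed

lemma bounded_measurable_mult:
  assumes "f \<in> bounded_measurable M" "g \<in> bounded_measurable M"
  shows "(\<lambda>x. f x * g x) \<in> bounded_measurable M"
proof -
  obtain A where A: "A \<ge> 0" "\<And>x. x \<in> space M \<Longrightarrow> \<bar>f x\<bar> \<le> A"
    using bounded_measurableE[OF assms(1)] by metis
  obtain B where B: "\<And>x. x \<in> space M \<Longrightarrow> \<bar>g x\<bar> \<le> B"
    using bounded_measurableE[OF assms(2)] by metis
  have "\<bar>f x * g x\<bar> \<le> A * B" if "x \<in> space M" for x
    using that A B[OF that] by (auto simp: abs_mult intro!: mult_mono)
  then show ?thesis
    using assms[THEN bounded_measurable_measurable] by (intro bounded_measurableI) auto
qed

lemma bounded_measurable_diff:
  assumes "f \<in> bounded_measurable M" "g \<in> bounded_measurable M"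
  shows "(\<lambda>x. f x - g x) \<in> bounded_measurable M"
  using bounded_measurable_add[OF assms(1) bounded_measurable_mult[OF bounded_measurable_const[of "-1"] assms(2)]]
  by simp

lemma bounded_measurable_integrable:
  assumes "f \<in> bounded_measurable N" "P \<in> space (prob_algebra N)"
  shows "integrable P f"
proof -
  have sets: "sets P = sets N" and "prob_space P" using assms(2) by (auto simp: space_prob_algebra)
  interpret prob_space P by fact
  obtain B where "f \<in> borel_measurable N" "\<And>x. x \<in> space N \<Longrightarrow> \<bar>f x\<bar> \<le> B"
    using bounded_measurableE[OF assms(1)] by metis
  then show ?thesis
    by (intro integrable_const_bound[of _ B])
       (auto simp: sets_eq_imp_space_eq[OF sets] measurable_cong_sets[OF sets refl])
qed

lemma integral_bounds:
  assumes f: "f \<in> bounded_measurable N" and P: "P \<in> space (prob_algebra N)"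
    and "\<And>x. x \<in> space N \<Longrightarrow> a \<le> f x" "\<And>x. x \<in> space N \<Longrightarrow> f x \<le> b"
  shows "a \<le> (\<integral>x. f x \<partial>P)" "(\<integral>x. f x \<partial>P) \<le> b"
proof -
  have sets: "sets P = sets N" and "prob_space P" using P by (auto simp: space_prob_algebra)
  interpret prob_space P by fact
  have int: "integrable P f" by (rule bounded_measurable_integrable[OF f P])
  show "a \<le> (\<integral>x. f x \<partial>P)"
    using int assms(3) by (intro integral_ge_const) (auto simp: sets_eq_imp_space_eq[OF sets])
  show "(\<integral>x. f x \<partial>P) \<le> b"
    using int assms(4) by (intro integral_le_const) (auto simp: sets_eq_imp_space_eq[OF sets])
qed

lemma abs_integral_bound:
  assumes f: "f \<in> bounded_measurable N" and P: "P \<in> space (prob_algebra N)"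
    and B: "\<And>x. x \<in> space N \<Longrightarrow> \<bar>f x\<bar> \<le> B"
  shows "\<bar>\<integral>x. f x \<partial>P\<bar> \<le> B"
proof -
  have B': "- B \<le> f x" "f x \<le> B" if "x \<in> space N" for x
    using B[OF that] by linarith+
  show ?thesis
    using integral_bounds[OF f P B'] by linarith
qed

lemma integral_kernel_measurable:
  assumes K: "K \<in> M \<rightarrow>\<^sub>M prob_algebra N" and f: "f \<in> bounded_measurable N"
  shows "(\<lambda>x. \<integral>y. f y \<partial>K x) \<in> bounded_measurable M"
proof -
  obtain B where B: "f \<in> borel_measurable N" "\<And>x. x \<in> space N \<Longrightarrow> \<bar>f x\<bar> \<le> B"
    using bounded_measurableE[OF f] by metis
  show ?thesis
  proof (rule bounded_measurableI)
    show "(\<lambda>x. \<integral>y. f y \<partial>K x) \<in> borel_measurable M"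
      using measurable_prob_algebraD[OF K] B(1) by measurable
    show "\<bar>\<integral>y. f y \<partial>K x\<bar> \<le> B" if "x \<in> space M" for x
      using measurable_space[OF K that] B(2) by (intro abs_integral_bound[OF f]) auto
  qed
qed

lemma integral_bind_kernel:
  assumes P: "P \<in> space (prob_algebra M)" and K: "K \<in> M \<rightarrow>\<^sub>M prob_algebra N"
    and f: "f \<in> bounded_measurable N"
  shows "(\<integral>y. f y \<partial>(P \<bind> K)) = (\<integral>x. (\<integral>y. f y \<partial>K x) \<partial>P)"
proof -
  have sets: "sets P = sets M" and "prob_space P" using P by (auto simp: space_prob_algebra)
  interpret prob_space P by fact
  obtain B where B: "f \<in> borel_measurable N" "\<And>x. x \<in> space N \<Longrightarrow> \<bar>f x\<bar> \<le> B"
    using bounded_measurableE[OF f] by metis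
  have K': "K \<in> P \<rightarrow>\<^sub>M subprob_algebra N"
    using measurable_prob_algebraD[OF K] by (simp add: measurable_cong_sets[OF sets refl])
  show ?thesis
  proof (rule integral_bind[where B = B and B' = 1 and K = N])
    show "AE x in P. emeasure (K x) (space (K x)) \<le> ennreal 1"
      using measurable_space[OF K]
      by (intro AE_I2) (auto simp: sets_eq_imp_space_eq[OF sets] space_prob_algebra prob_space.emeasure_space_1)
  qed (use B K' not_empty in \<open>auto intro: finite_measure_axioms\<close>)
qed

definition joint_kernel :: "'x measure \<Rightarrow> 'a measure \<Rightarrow> ('x \<Rightarrow> 'a measure) \<Rightarrow> 'x \<Rightarrow> ('x \<times> 'a) measure" where
  "joint_kernel M N K x = distr (K x) (M \<Otimes>\<^sub>M N) (Pair x)"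

lemma joint_kernel_measurable:
  assumes K: "K \<in> M \<rightarrow>\<^sub>M prob_algebra N"
  shows "joint_kernel M N K \<in> M \<rightarrow>\<^sub>M prob_algebra (M \<Otimes>\<^sub>M N)"
  unfolding joint_kernel_def[abs_def]
  by (rule measurable_distr_prob_space2[OF K]) simp

lemma integral_joint_kernel:
  assumes K: "K \<in> M \<rightarrow>\<^sub>M prob_algebra N" and x: "x \<in> space M"
    and f: "f \<in> borel_measurable (M \<Otimes>\<^sub>M N)"
  shows "(\<integral>z. f z \<partial>joint_kernel M N K x) = (\<integral>a. (f (x, a) :: real) \<partial>K x)"
proof -
  have sets: "sets (K x) = sets N"
    using measurable_space[OF K x] by (auto simp: space_prob_algebra)
  show ?thesis
    unfolding joint_kernel_def using x f
    by (subst integral_distr) (auto simp: measurable_cong_sets[OF sets refl])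
qed

lemma integral_kernel_pair_measurable:
  assumes K: "K \<in> M \<rightarrow>\<^sub>M prob_algebra N" and f: "f \<in> bounded_measurable (M \<Otimes>\<^sub>M N)"
  shows "(\<lambda>x. \<integral>a. f (x, a) \<partial>K x) \<in> bounded_measurable M"
proof -
  have "(\<lambda>x. \<integral>z. f z \<partial>joint_kernel M N K x) \<in> bounded_measurable M"
    by (rule integral_kernel_measurable[OF joint_kernel_measurable[OF K] f])
  moreover have "(\<integral>z. f z \<partial>joint_kernel M N K x) = (\<integral>a. f (x, a) \<partial>K x)" if "x \<in> space M" for x
    using integral_joint_kernel[OF K that] f by (auto dest: bounded_measurable_measurable)
  ultimately show ?thesis
    unfolding bounded_measurable_def by (auto cong: measurable_cong)
qed

text \<open>
  Writing a convex combination as a bind over a coin flip yields, with the lemmas on kernels, its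
  probability property and also its measurability in parameters.
\<close>

definition mixture :: "real \<Rightarrow> 'a measure \<Rightarrow> 'a measure \<Rightarrow> 'a measure" where
  "mixture s P1 P2 = measure_pmf (bernoulli_pmf s) \<bind> (\<lambda>b. if b then P1 else P2)"

lemma measure_pmf_in_prob_algebra: "measure_pmf p \<in> space (prob_algebra (count_space UNIV))"
  by (auto simp: space_prob_algebra measure_pmf.prob_space_axioms)

lemma mixture_in_prob_algebra:
  assumes "P1 \<in> space (prob_algebra N)" "P2 \<in> space (prob_algebra N)"
  shows "mixture s P1 P2 \<in> space (prob_algebra N)"
  using prob_space_bind'[OF measure_pmf_in_prob_algebra, of "\<lambda>b. if b then P1 else P2" N]
    sets_bind'[OF measure_pmf_in_prob_algebra, of "\<lambda>b. if b then P1 else P2" N] assms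
  by (auto simp: space_prob_algebra mixture_def)

lemma integral_mixture:
  assumes "P1 \<in> space (prob_algebra N)" "P2 \<in> space (prob_algebra N)"
    and f: "f \<in> bounded_measurable N" and s: "s \<in> {0..1}"
  shows "(\<integral>x. f x \<partial>mixture s P1 P2) = s * (\<integral>x. f x \<partial>P1) + (1 - s) * (\<integral>x. f x \<partial>P2)"
proof -
  have "(\<integral>x. f x \<partial>mixture s P1 P2) = (\<integral>b. (\<integral>x. f x \<partial>(if b then P1 else P2)) \<partial>measure_pmf (bernoulli_pmf s))"
    unfolding mixture_def
    by (rule integral_bind_kernel[OF measure_pmf_in_prob_algebra _ f]) (use assms in auto)
  also have "\<dots> = s * (\<integral>x. f x \<partial>P1) + (1 - s) * (\<integral>x. f x \<partial>P2)"
    using s by (subst integral_bernoulli_pmf) auto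
  finally show ?thesis .
qed

lemma mixture_kernel_measurable:
  assumes "K1 \<in> M \<rightarrow>\<^sub>M prob_algebra N" "K2 \<in> M \<rightarrow>\<^sub>M prob_algebra N"
    and w: "w \<in> borel_measurable M" "\<And>x. w x \<in> {0..1}"
  shows "(\<lambda>x. mixture (w x) (K1 x) (K2 x)) \<in> M \<rightarrow>\<^sub>M prob_algebra N"
  unfolding mixture_def
proof (rule measurable_bind_prob_space2)
  show "(\<lambda>x. measure_pmf (bernoulli_pmf (w x))) \<in> M \<rightarrow>\<^sub>M prob_algebra (count_space UNIV)"
  proof (rule measurable_prob_algebraI[OF _ measurable_subprob_algebra])
    fix A :: "bool set"
    have sum_bool: "(\<Sum>b\<in>UNIV. g b) = g True + g False" for g :: "bool \<Rightarrow> ennreal"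
      by (simp add: UNIV_bool add.commute)
    have "emeasure (measure_pmf (bernoulli_pmf (w x))) A =
        ennreal (w x) * indicator A True + ennreal (1 - w x) * indicator A False" for x
    proof -
      have "emeasure (measure_pmf (bernoulli_pmf (w x))) A
          = (\<Sum>b\<in>A. ennreal (pmf (bernoulli_pmf (w x)) b))"
        by (subst emeasure_measure_pmf_finite) (auto simp: sum_ennreal)
      also have "\<dots> = (\<Sum>b\<in>UNIV. ennreal (pmf (bernoulli_pmf (w x)) b) * indicator A b)"
        by (rule sum.mono_neutral_cong_left) (auto simp: indicator_def)
      also have "\<dots> = ennreal (w x) * indicator A True + ennreal (1 - w x) * indicator A False"
        using w(2)[of x] by (subst sum_bool) simp
      finally show ?thesis .
    qed
    then show "(\<lambda>x. emeasure (measure_pmf (bernoulli_pmf (w x))) A) \<in> borel_measurable M"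
      using w(1) by simp
  qed (auto simp: measure_pmf.prob_space_axioms measure_pmf.subprob_space_axioms)
  have "(\<lambda>z. if snd z then K1 (fst z) else K2 (fst z)) \<in> M \<Otimes>\<^sub>M count_space UNIV \<rightarrow>\<^sub>M prob_algebra N"
    using assms(1,2) by measurable
  then show "(\<lambda>(x, b). if b then K1 x else K2 x) \<in> M \<Otimes>\<^sub>M count_space UNIV \<rightarrow>\<^sub>M prob_algebra N"
    by (simp add: case_prod_unfold)
qed

section \<open>Occupation measures of policies\<close>

text \<open>
  Discounting with factor \<open>\<beta>\<close> amounts to stopping at an independent geometric time.
\<close>

lemma integral_geometric_pmf:
  assumes \<beta>: "0 < \<beta>" "\<beta> < 1" and g: "\<And>t. \<bar>g t\<bar> \<le> (B :: real)"
  shows "summable (\<lambda>t. \<beta> ^ t * g t)"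
    and "(\<integral>t. g t \<partial>measure_pmf (geometric_pmf (1 - \<beta>))) = (1 - \<beta>) * (\<Sum>t. \<beta> ^ t * g t)"
proof -
  have summable: "summable (\<lambda>t. norm (\<beta> ^ t * g t))"
  proof (rule summable_comparison_test')
    show "summable (\<lambda>t. \<beta> ^ t * B)"
      using \<beta> by (intro summable_mult2 summable_geometric) auto
    show "norm (norm (\<beta> ^ t * g t)) \<le> \<beta> ^ t * B" for t
      using g[of t] \<beta> by (auto simp: abs_mult intro!: mult_left_mono)
  qed
  then show "summable (\<lambda>t. \<beta> ^ t * g t)"
    by (rule summable_norm_cancel)
  have "(\<integral>t. g t \<partial>measure_pmf (geometric_pmf (1 - \<beta>)))
      = (\<integral>t. pmf (geometric_pmf (1 - \<beta>)) t * g t \<partial>count_space UNIV)"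
    unfolding measure_pmf_eq_density by (subst integral_density) auto
  also have "\<dots> = (\<integral>t. (1 - \<beta>) * (\<beta> ^ t * g t) \<partial>count_space UNIV)"
    using \<beta> by (simp add: mult_ac)
  also have "\<dots> = (1 - \<beta>) * (\<integral>t. \<beta> ^ t * g t \<partial>count_space UNIV)"
    by simp
  also have "(\<integral>t. \<beta> ^ t * g t \<partial>count_space UNIV) = (\<Sum>t. \<beta> ^ t * g t)"
    using summable by (intro integral_count_space_nat) (simp add: integrable_count_space_nat_iff)
  finally show "(\<integral>t. g t \<partial>measure_pmf (geometric_pmf (1 - \<beta>))) = (1 - \<beta>) * (\<Sum>t. \<beta> ^ t * g t)" .
qed

locale discounted_model =
  fixes M :: "('x, 'a) cmdp" and \<beta> :: real
  assumes init: "init_law M \<in> space (prob_algebra (states M))"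
    and trans: "trans_kernel M \<in> states M \<Otimes>\<^sub>M actions M \<rightarrow>\<^sub>M prob_algebra (states M)"
    and discount: "0 < \<beta>" "\<beta> < 1"
begin

abbreviation "SA \<equiv> states M \<Otimes>\<^sub>M actions M"

text \<open>
  The balance equation \<open>\<mu>\<^sub>X = (1 - \<beta>) \<gamma> + \<beta> \<mu> p\<close> of occupation measures, tested on bounded functions of the state.
\<close>

definition balanced :: "('x \<times> 'a) measure \<Rightarrow> bool" where
  "balanced \<mu> \<longleftrightarrow> \<mu> \<in> space (prob_algebra SA) \<and>
     (\<forall>v\<in>bounded_measurable (states M). (\<integral>z. v (fst z) \<partial>\<mu>) =
        (1 - \<beta>) * (\<integral>x. v x \<partial>init_law M) + \<beta> * (\<integral>z. (\<integral>y. v y \<partial>trans_kernel M z) \<partial>\<mu>))"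

text \<open>
  The disintegration \<open>\<mu> = \<mu>\<^sub>X \<otimes> \<phi>\<close>, tested on bounded functions.
\<close>

definition randomized_by :: "('x \<Rightarrow> 'a measure) \<Rightarrow> ('x \<times> 'a) measure \<Rightarrow> bool" where
  "randomized_by \<phi> \<mu> \<longleftrightarrow>
     (\<forall>f\<in>bounded_measurable SA. (\<integral>z. f z \<partial>\<mu>) = (\<integral>z. (\<integral>a. f (fst z, a) \<partial>\<phi> (fst z)) \<partial>\<mu>))"

definition stationary :: "('x \<Rightarrow> 'a measure) \<Rightarrow> ('x, 'a) policy" where
  "stationary \<phi> t = (\<lambda>(h, x). \<phi> x)"

lemma stationary_policy:
  "\<phi> \<in> states M \<rightarrow>\<^sub>M prob_algebra (actions M) \<Longrightarrow> stationary \<phi> \<in> policies M"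
  unfolding policies_def stationary_def histories_def case_prod_unfold by measurable

context
  fixes \<pi> assumes \<pi>: "\<pi> \<in> policies M"
begin

interpretation IT: Ionescu_Tulcea "step_law M \<pi>" "\<lambda>_. SA"
  by (rule Ionescu_Tulcea_step_law[OF init trans \<pi>])

abbreviation (input) "H t \<equiv> PiM {0..<t} (\<lambda>_. SA)"

lemma path_law_in_prob_algebra: "path_law M \<pi> \<in> space (prob_algebra (PiM UNIV (\<lambda>_. SA)))"
proof -
  have sets: "sets (path_law M \<pi>) = sets (PiM UNIV (\<lambda>_. SA))"
    unfolding path_law_def by simp
  have restr: "(\<lambda>x. restrict x {}) \<in> path_law M \<pi> \<rightarrow>\<^sub>M PiM {} (\<lambda>_. SA)"
    unfolding measurable_cong_sets[OF sets refl] by (intro measurable_restrict) auto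
  have "prob_space (distr (path_law M \<pi>) (PiM {} (\<lambda>_. SA)) (\<lambda>x. restrict x {}))"
    unfolding path_law_def using IT.PF.prob_space_P[of "{}"] IT.distr_lim[of "{}"] by simp
  then have "prob_space (path_law M \<pi>)"
    by (rule prob_space_distrD[OF restr])
  with sets show ?thesis by (simp add: space_prob_algebra)
qed

lemma sets_path_law [simp, measurable_cong]: "sets (path_law M \<pi>) = sets (PiM UNIV (\<lambda>_. SA))"
  using path_law_in_prob_algebra by (simp add: space_prob_algebra)

text \<open>
  The projection of the trajectory law to the first \<open>t\<close> pairs is the \<open>t\<close>-fold composition of the step kernels.
\<close>

lemma history_law:
  "distr (path_law M \<pi>) (H t) (\<lambda>\<omega>. restrict \<omega> {0..<t}) = IT.C 0 t (\<lambda>_. undefined)"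
proof -
  have "IT.up_to {0..<t} = t"
  proof (rule antisym)
    show "IT.up_to {0..<t} \<le> t" by (subst IT.up_to_iff) auto
    show "t \<le> IT.up_to {0..<t}"
      using IT.up_to[of "{0..<t}"] by (cases "t = 0") auto
  qed
  have sets: "sets (IT.C 0 t (\<lambda>_. undefined)) = sets (H t)"
    using IT.sets_C[of "\<lambda>_. undefined" 0 t] by (simp add: space_PiM)
  have "distr (path_law M \<pi>) (H t) (\<lambda>\<omega>. restrict \<omega> {0..<t}) = IT.CI {0..<t}"
    unfolding path_law_def by (rule IT.distr_lim) simp
  also have "\<dots> = distr (IT.C 0 t (\<lambda>_. undefined)) (H t) (\<lambda>h. restrict h {0..<t})"
    unfolding IT.CI_def \<open>IT.up_to {0..<t} = t\<close> ..
  also have "\<dots> = distr (IT.C 0 t (\<lambda>_. undefined)) (IT.C 0 t (\<lambda>_. undefined)) (\<lambda>h. h)"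
    using sets sets_eq_imp_space_eq[OF sets] by (intro distr_cong) (auto simp: space_PiM PiE_restrict)
  finally show ?thesis by simp
qed

text \<open>
  The defining property of the trajectory law: given the past, the pair at time \<open>t\<close> is drawn from the step law.
\<close>

lemma expectation_coordinate:
  assumes f: "f \<in> bounded_measurable SA"
  shows "(\<integral>\<omega>. f (\<omega> t) \<partial>path_law M \<pi>) =
    (\<integral>\<omega>. (\<integral>z. f z \<partial>step_law M \<pi> t (restrict \<omega> {0..<t})) \<partial>path_law M \<pi>)"
proof -
  let ?u = "\<lambda>_ :: nat. undefined :: 'x \<times> 'a"
  have f_borel [measurable]: "f \<in> borel_measurable SA"
    by (rule bounded_measurable_measurable[OF f])
  have C: "IT.C 0 t ?u \<in> space (prob_algebra (H t))"
    using IT.sets_C[of ?u 0 t] IT.prob_space_C[of ?u 0 t] by (simp add: space_prob_algebra space_PiM)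
  have eP: "IT.eP t \<in> H t \<rightarrow>\<^sub>M prob_algebra (H (Suc t))"
    by (intro measurable_prob_algebraI IT.measurable_eP IT.prob_space_eP)
  have r: "(\<lambda>\<omega>. restrict \<omega> {0..<n}) \<in> path_law M \<pi> \<rightarrow>\<^sub>M H n" for n
    unfolding measurable_cong_sets[OF sets_path_law refl] by (intro measurable_restrict) auto
  have coord: "(\<lambda>h. h t) \<in> H (Suc t) \<rightarrow>\<^sub>M SA"
    by (intro measurable_component_singleton) auto
  have f_coord: "(\<lambda>h. f (h t)) \<in> bounded_measurable (H (Suc t))"
    by (rule bounded_measurable_compose[OF f coord])
  have K: "step_law M \<pi> t \<in> H t \<rightarrow>\<^sub>M prob_algebra SA"
    by (rule step_law_kernel[OF init trans \<pi>])
  have "(\<integral>\<omega>. f (\<omega> t) \<partial>path_law M \<pi>) =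
      (\<integral>h. f (h t) \<partial>distr (path_law M \<pi>) (H (Suc t)) (\<lambda>\<omega>. restrict \<omega> {0..<Suc t}))"
    by (subst integral_distr[OF r]) (use f_coord in \<open>auto dest: bounded_measurable_measurable\<close>)
  also have "\<dots> = (\<integral>h. f (h t) \<partial>(IT.C 0 t ?u \<bind> IT.eP t))"
    unfolding history_law by simp
  also have "\<dots> = (\<integral>h. (\<integral>h'. f (h' t) \<partial>IT.eP t h) \<partial>IT.C 0 t ?u)"
    by (rule integral_bind_kernel[OF C eP f_coord])
  also have "\<dots> = (\<integral>h. (\<integral>z. f z \<partial>step_law M \<pi> t h) \<partial>IT.C 0 t ?u)"
  proof (rule Bochner_Integration.integral_cong[OF refl])
    fix h assume "h \<in> space (IT.C 0 t ?u)"
    then have h: "h \<in> space (H t)"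
      using IT.space_C[of ?u 0 t] by (simp add: space_PiM)
    have upd: "fun_upd h t \<in> step_law M \<pi> t h \<rightarrow>\<^sub>M H (Suc t)"
      unfolding measurable_cong_sets[OF IT.sets_P[OF h] refl]
      using h by (intro measurable_fun_upd[where J = "{0..<t}"]) auto
    show "(\<integral>h'. f (h' t) \<partial>IT.eP t h) = (\<integral>z. f z \<partial>step_law M \<pi> t h)"
      unfolding IT.eP_def
      by (subst integral_distr[OF upd]) (use f_coord in \<open>auto dest: bounded_measurable_measurable\<close>)
  qed
  also have "\<dots> = (\<integral>\<omega>. (\<integral>z. f z \<partial>step_law M \<pi> t (restrict \<omega> {0..<t})) \<partial>path_law M \<pi>)"
    unfolding history_law[symmetric]
    by (subst integral_distr[OF r])
       (auto intro!: bounded_measurable_measurable[OF integral_kernel_measurable[OF K f]])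
  finally show ?thesis .
qed

lemma integral_step_law:
  assumes h: "h \<in> space (H t)" and f: "f \<in> bounded_measurable SA"
  shows "(\<integral>z. f z \<partial>step_law M \<pi> t h) = (\<integral>x. (\<integral>a. f (x, a) \<partial>\<pi> t (h, x)) \<partial>state_law M t h)"
    and "state_law M t h \<in> space (prob_algebra (states M))"
proof -
  show S: "state_law M t h \<in> space (prob_algebra (states M))"
  proof (cases "t = 0")
    case True
    then show ?thesis using init by (simp add: state_law_def)
  next
    case False
    then have "h (t - 1) \<in> space SA" using h by (auto simp: space_PiM PiE_iff)
    then show ?thesis using False measurable_space[OF trans] by (simp add: state_law_def)
  qed
  have "\<pi> t \<in> H t \<Otimes>\<^sub>M states M \<rightarrow>\<^sub>M prob_algebra (actions M)"
    using \<pi> by (simp add: policies_def histories_def)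
  then have K: "(\<lambda>x. \<pi> t (h, x)) \<in> states M \<rightarrow>\<^sub>M prob_algebra (actions M)"
    using h by (intro measurable_compose[OF measurable_Pair1'])
  have space: "space (state_law M t h) = space (states M)"
    using S by (auto simp: space_prob_algebra dest: sets_eq_imp_space_eq)
  have "step_law M \<pi> t h = state_law M t h \<bind> joint_kernel (states M) (actions M) (\<lambda>x. \<pi> t (h, x))"
    unfolding step_law_def joint_kernel_def[abs_def] ..
  then have "(\<integral>z. f z \<partial>step_law M \<pi> t h) =
      (\<integral>x. (\<integral>z. f z \<partial>joint_kernel (states M) (actions M) (\<lambda>x. \<pi> t (h, x)) x) \<partial>state_law M t h)"
    using integral_bind_kernel[OF S joint_kernel_measurable[OF K] f] by simp
  also have "\<dots> = (\<integral>x. (\<integral>a. f (x, a) \<partial>\<pi> t (h, x)) \<partial>state_law M t h)"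
    using f by (intro Bochner_Integration.integral_cong refl integral_joint_kernel[OF K])
      (auto simp: space dest: bounded_measurable_measurable)
  finally show "(\<integral>z. f z \<partial>step_law M \<pi> t h) = (\<integral>x. (\<integral>a. f (x, a) \<partial>\<pi> t (h, x)) \<partial>state_law M t h)" .
qed

lemma restrict_path: "\<omega> \<in> space (path_law M \<pi>) \<Longrightarrow> restrict \<omega> {0..<t} \<in> space (H t)"
  by (auto simp: sets_eq_imp_space_eq[OF sets_path_law] space_PiM PiE_iff)

text \<open>
  Whatever the policy does, the state at time \<open>t\<close> is drawn from the transition kernel at the previous pair.  The
  choice of the action at time \<open>t\<close> integrates out.
\<close>

lemma expectation_state:
  assumes v: "v \<in> bounded_measurable (states M)"
  shows "(\<integral>\<omega>. v (fst (\<omega> t)) \<partial>path_law M \<pi>) =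
    (if t = 0 then (\<integral>x. v x \<partial>init_law M)
     else (\<integral>\<omega>. (\<integral>y. v y \<partial>trans_kernel M (\<omega> (t - 1))) \<partial>path_law M \<pi>))"
proof -
  have v': "(\<lambda>z. v (fst z)) \<in> bounded_measurable SA"
    by (rule bounded_measurable_compose[OF v measurable_fst])
  interpret prob_space "path_law M \<pi>"
    using path_law_in_prob_algebra by (simp add: space_prob_algebra)
  have "(\<integral>\<omega>. v (fst (\<omega> t)) \<partial>path_law M \<pi>) =
      (\<integral>\<omega>. (\<integral>z. v (fst z) \<partial>step_law M \<pi> t (restrict \<omega> {0..<t})) \<partial>path_law M \<pi>)"
    by (rule expectation_coordinate[OF v'])
  also have "\<dots> = (\<integral>\<omega>. (\<integral>x. v x \<partial>state_law M t (restrict \<omega> {0..<t})) \<partial>path_law M \<pi>)"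
  proof (rule Bochner_Integration.integral_cong[OF refl])
    fix \<omega> assume "\<omega> \<in> space (path_law M \<pi>)"
    then have h: "restrict \<omega> {0..<t} \<in> space (H t)" by (rule restrict_path)
    have S: "state_law M t (restrict \<omega> {0..<t}) \<in> space (prob_algebra (states M))"
      by (rule integral_step_law(2)[OF h v'])
    have "\<pi> t \<in> H t \<Otimes>\<^sub>M states M \<rightarrow>\<^sub>M prob_algebra (actions M)"
      using \<pi> by (simp add: policies_def histories_def)
    then have K: "(\<lambda>x. \<pi> t (restrict \<omega> {0..<t}, x)) \<in> states M \<rightarrow>\<^sub>M prob_algebra (actions M)"
      using h by (intro measurable_compose[OF measurable_Pair1'])
    have "(\<integral>a. v x \<partial>\<pi> t (restrict \<omega> {0..<t}, x)) = v x" if "x \<in> space (states M)" for x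
      using measurable_space[OF K that] by (simp add: space_prob_algebra prob_space.prob_space)
    then show "(\<integral>z. v (fst z) \<partial>step_law M \<pi> t (restrict \<omega> {0..<t})) =
        (\<integral>x. v x \<partial>state_law M t (restrict \<omega> {0..<t}))"
      using S unfolding integral_step_law(1)[OF h v']
      by (intro Bochner_Integration.integral_cong refl)
         (auto simp: space_prob_algebra dest: sets_eq_imp_space_eq)
  qed
  also have "\<dots> = (if t = 0 then (\<integral>x. v x \<partial>init_law M)
     else (\<integral>\<omega>. (\<integral>y. v y \<partial>trans_kernel M (\<omega> (t - 1))) \<partial>path_law M \<pi>))"
    by (auto simp: state_law_def prob_space)
  finally show ?thesis .
qed

definition "occupation = measure_pmf (geometric_pmf (1 - \<beta>)) \<bind>
  (\<lambda>t. distr (path_law M \<pi>) SA (\<lambda>\<omega>. \<omega> t))"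

lemma coordinate_measurable: "(\<lambda>\<omega>. \<omega> t) \<in> path_law M \<pi> \<rightarrow>\<^sub>M SA"
  unfolding measurable_cong_sets[OF sets_path_law refl] by measurable

lemma coordinate_kernel:
  "(\<lambda>t. distr (path_law M \<pi>) SA (\<lambda>\<omega>. \<omega> t)) \<in> count_space UNIV \<rightarrow>\<^sub>M prob_algebra SA"
proof -
  interpret prob_space "path_law M \<pi>"
    using path_law_in_prob_algebra by (simp add: space_prob_algebra)
  show ?thesis
    by (auto simp: space_prob_algebra intro!: prob_space_distr coordinate_measurable)
qed

lemma occupation_in_prob_algebra: "occupation \<in> space (prob_algebra SA)"
  using prob_space_bind'[OF measure_pmf_in_prob_algebra coordinate_kernel]
    sets_bind'[OF measure_pmf_in_prob_algebra coordinate_kernel]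
  by (auto simp: space_prob_algebra occupation_def)

lemma abs_expectation_coordinate:
  assumes f: "f \<in> bounded_measurable SA" and B: "\<And>z. z \<in> space SA \<Longrightarrow> \<bar>f z\<bar> \<le> B"
  shows "\<bar>\<integral>\<omega>. f (\<omega> t) \<partial>path_law M \<pi>\<bar> \<le> B"
proof (rule abs_integral_bound[OF _ path_law_in_prob_algebra])
  show "(\<lambda>\<omega>. f (\<omega> t)) \<in> bounded_measurable (PiM UNIV (\<lambda>_. SA))"
    by (rule bounded_measurable_compose[OF f]) measurable
  show "\<bar>f (\<omega> t)\<bar> \<le> B" if "\<omega> \<in> space (PiM UNIV (\<lambda>_. SA))" for \<omega>
    using that by (intro B) (auto simp: space_PiM PiE_iff)
qed

lemma integral_occupation:
  assumes f: "f \<in> bounded_measurable SA"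
  shows "summable (\<lambda>t. \<beta> ^ t * (\<integral>\<omega>. f (\<omega> t) \<partial>path_law M \<pi>))"
    and "(\<integral>z. f z \<partial>occupation) = (1 - \<beta>) * (\<Sum>t. \<beta> ^ t * (\<integral>\<omega>. f (\<omega> t) \<partial>path_law M \<pi>))"
proof -
  obtain B where B: "\<And>z. z \<in> space SA \<Longrightarrow> \<bar>f z\<bar> \<le> B"
    using bounded_measurableE[OF f] by metis
  note bound = abs_expectation_coordinate[OF f B]
  show "summable (\<lambda>t. \<beta> ^ t * (\<integral>\<omega>. f (\<omega> t) \<partial>path_law M \<pi>))"
    by (rule integral_geometric_pmf(1)[OF discount bound])
  have "(\<integral>z. f z \<partial>occupation) =
      (\<integral>t. (\<integral>z. f z \<partial>distr (path_law M \<pi>) SA (\<lambda>\<omega>. \<omega> t)) \<partial>measure_pmf (geometric_pmf (1 - \<beta>)))"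
    unfolding occupation_def
    by (rule integral_bind_kernel[OF measure_pmf_in_prob_algebra coordinate_kernel f])
  also have "\<dots> = (\<integral>t. (\<integral>\<omega>. f (\<omega> t) \<partial>path_law M \<pi>) \<partial>measure_pmf (geometric_pmf (1 - \<beta>)))"
    using f by (subst integral_distr[OF coordinate_measurable]) (auto dest: bounded_measurable_measurable)
  also have "\<dots> = (1 - \<beta>) * (\<Sum>t. \<beta> ^ t * (\<integral>\<omega>. f (\<omega> t) \<partial>path_law M \<pi>))"
    by (rule integral_geometric_pmf(2)[OF discount bound])
  finally show "(\<integral>z. f z \<partial>occupation) = (1 - \<beta>) * (\<Sum>t. \<beta> ^ t * (\<integral>\<omega>. f (\<omega> t) \<partial>path_law M \<pi>))" .
qed

text \<open>
  Boundedness of \<open>f\<close> and \<open>\<beta> < 1\<close> allow the discounted sum and the expectation to be interchanged.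
\<close>

lemma disc_cost_eq_integral_occupation:
  assumes f: "f \<in> bounded_measurable SA"
  shows "disc_cost \<beta> M f \<pi> = (\<integral>z. f z \<partial>occupation)"
proof -
  obtain B where B: "\<And>z. z \<in> space SA \<Longrightarrow> \<bar>f z\<bar> \<le> B"
    using bounded_measurableE[OF f] by metis
  interpret prob_space "path_law M \<pi>"
    using path_law_in_prob_algebra by (simp add: space_prob_algebra)
  have f_coord: "(\<lambda>\<omega>. f (\<omega> t)) \<in> bounded_measurable (PiM UNIV (\<lambda>_. SA))" for t
    by (rule bounded_measurable_compose[OF f]) measurable
  have coord_space: "\<omega> t \<in> space SA" if "\<omega> \<in> space (path_law M \<pi>)" for \<omega> t
    using that by (auto simp: sets_eq_imp_space_eq[OF sets_path_law] space_PiM PiE_iff)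
  have "(\<integral>\<omega>. (\<Sum>t. \<beta> ^ t * f (\<omega> t)) \<partial>path_law M \<pi>) = (\<Sum>t. \<integral>\<omega>. \<beta> ^ t * f (\<omega> t) \<partial>path_law M \<pi>)"
  proof (rule integral_suminf)
    show "integrable (path_law M \<pi>) (\<lambda>\<omega>. \<beta> ^ t * f (\<omega> t))" for t
      by (intro integrable_mult_right bounded_measurable_integrable[OF f_coord path_law_in_prob_algebra])
    have le: "norm (\<beta> ^ t * f (\<omega> t)) \<le> \<beta> ^ t * B" if "\<omega> \<in> space (path_law M \<pi>)" for \<omega> t
      using B[OF coord_space[OF that]] discount by (auto simp: abs_mult intro!: mult_left_mono)
    have geo: "summable (\<lambda>t. \<beta> ^ t * B)"
      using discount by (intro summable_mult2 summable_geometric) auto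
    show "AE \<omega> in path_law M \<pi>. summable (\<lambda>t. norm (\<beta> ^ t * f (\<omega> t)))"
      using le by (intro AE_I2 summable_comparison_test'[OF geo]) auto
    have "(\<integral>\<omega>. norm (\<beta> ^ t * f (\<omega> t)) \<partial>path_law M \<pi>) \<le> \<beta> ^ t * B" for t
      using le by (intro integral_le_const integrable_norm integrable_mult_right
          bounded_measurable_integrable[OF f_coord path_law_in_prob_algebra]) auto
    then show "summable (\<lambda>t. \<integral>\<omega>. norm (\<beta> ^ t * f (\<omega> t)) \<partial>path_law M \<pi>)"
      by (intro summable_comparison_test'[OF geo]) (simp add: Bochner_Integration.integral_nonneg)
  qed
  then show ?thesis
    unfolding disc_cost_def integral_occupation(2)[OF f] by simp
qed

text \<open>
  The initial law contributes the summand \<open>t = 0\<close>; the remaining summands, shifted by one, carry a factor \<open>\<beta>\<close>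
  and the transition kernel.
\<close>

lemma balanced_occupation: "balanced occupation"
  unfolding balanced_def
proof (intro conjI ballI occupation_in_prob_algebra)
  fix v assume v: "v \<in> bounded_measurable (states M)"
  let ?E = "\<lambda>f t. \<integral>\<omega>. f (\<omega> t) \<partial>path_law M \<pi>"
  let ?v = "\<lambda>z. v (fst z)" and ?pv = "\<lambda>z. \<integral>y. v y \<partial>trans_kernel M z"
  have v': "?v \<in> bounded_measurable SA"
    by (rule bounded_measurable_compose[OF v measurable_fst])
  have pv: "?pv \<in> bounded_measurable SA"
    by (rule integral_kernel_measurable[OF trans v])
  have "(\<Sum>t. \<beta> ^ t * ?E ?v t) = ?E ?v 0 + (\<Sum>t. \<beta> ^ Suc t * ?E ?v (Suc t))"
    using suminf_split_head[OF integral_occupation(1)[OF v']] by simp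
  also have "?E ?v 0 = (\<integral>x. v x \<partial>init_law M)"
    by (simp add: expectation_state[OF v])
  also have "(\<lambda>t. \<beta> ^ Suc t * ?E ?v (Suc t)) = (\<lambda>t. \<beta> * (\<beta> ^ t * ?E ?pv t))"
    by (simp add: expectation_state[OF v] mult.assoc)
  also have "(\<Sum>t. \<beta> * (\<beta> ^ t * ?E ?pv t)) = \<beta> * (\<Sum>t. \<beta> ^ t * ?E ?pv t)"
    by (rule suminf_mult[OF integral_occupation(1)[OF pv]])
  finally show "(\<integral>z. v (fst z) \<partial>occupation) =
      (1 - \<beta>) * (\<integral>x. v x \<partial>init_law M) + \<beta> * (\<integral>z. (\<integral>y. v y \<partial>trans_kernel M z) \<partial>occupation)"
    unfolding integral_occupation(2)[OF v'] integral_occupation(2)[OF pv] by (simp add: algebra_simps)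
qed

end

text \<open>
  The disintegration holds for the pair at each fixed time, because both sides have the same conditional
  expectation given the past.
\<close>

lemma randomized_by_occupation_stationary:
  assumes \<phi>: "\<phi> \<in> states M \<rightarrow>\<^sub>M prob_algebra (actions M)"
  shows "randomized_by \<phi> (occupation (stationary \<phi>))"
  unfolding randomized_by_def
proof
  fix f assume f: "f \<in> bounded_measurable SA"
  note pol = stationary_policy[OF \<phi>]
  let ?g = "\<lambda>x. \<integral>a. f (x, a) \<partial>\<phi> x"
  have g: "?g \<in> bounded_measurable (states M)"
    by (rule integral_kernel_pair_measurable[OF \<phi> f])
  have g': "(\<lambda>z. ?g (fst z)) \<in> bounded_measurable SA"
    by (rule bounded_measurable_compose[OF g measurable_fst])
  have "(\<integral>\<omega>. f (\<omega> t) \<partial>path_law M (stationary \<phi>)) = (\<integral>\<omega>. ?g (fst (\<omega> t)) \<partial>path_law M (stationary \<phi>))" for t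
    unfolding expectation_coordinate[OF pol f] expectation_coordinate[OF pol g']
  proof (rule Bochner_Integration.integral_cong[OF refl])
    fix \<omega> assume "\<omega> \<in> space (path_law M (stationary \<phi>))"
    note h = restrict_path[OF pol this, of t]
    have eq: "?g x = (\<integral>a. ?g x \<partial>\<phi> x)" if "x \<in> space (states M)" for x
      using measurable_space[OF \<phi> that] by (simp add: space_prob_algebra prob_space.prob_space)
    have sp: "space (state_law M t (restrict \<omega> {0..<t})) = space (states M)"
      using integral_step_law(2)[OF pol h f] by (auto simp: space_prob_algebra dest: sets_eq_imp_space_eq)
    have "(\<integral>x. ?g x \<partial>state_law M t (restrict \<omega> {0..<t})) =
        (\<integral>x. (\<integral>a. ?g x \<partial>\<phi> x) \<partial>state_law M t (restrict \<omega> {0..<t}))"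
      by (rule Bochner_Integration.integral_cong[OF refl], rule eq, simp only: sp)
    then show "(\<integral>z. f z \<partial>step_law M (stationary \<phi>) t (restrict \<omega> {0..<t})) =
        (\<integral>z. ?g (fst z) \<partial>step_law M (stationary \<phi>) t (restrict \<omega> {0..<t}))"
      unfolding integral_step_law(1)[OF pol h f] integral_step_law(1)[OF pol h g']
      by (simp only: stationary_def split fst_conv)
  qed
  then show "(\<integral>z. f z \<partial>occupation (stationary \<phi>)) = (\<integral>z. ?g (fst z) \<partial>occupation (stationary \<phi>))"
    unfolding integral_occupation(2)[OF pol f] integral_occupation(2)[OF pol g'] by simp
qed

end

section \<open>Stationary randomized policies\<close>

text \<open>
  If \<open>s P1 \<le> P\<close>, then the density of \<open>s P1\<close> with respect to \<open>P\<close> is almost everywhere at most \<open>1\<close>.  It can be changed on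
  a null set to take values in \<open>{0..1}\<close> everywhere, and then serves as a mixing probability.
\<close>

lemma dominated_law_has_weight:
  assumes P: "P \<in> space (prob_algebra N)" and P1: "P1 \<in> space (prob_algebra N)" and s: "s \<in> {0..1}"
    and le: "\<And>A. A \<in> sets N \<Longrightarrow> s * measure P1 A \<le> measure P A"
  shows "\<exists>w. w \<in> borel_measurable N \<and> (\<forall>x. w x \<in> {0..1}) \<and>
    (\<forall>f\<in>bounded_measurable N. s * (\<integral>x. f x \<partial>P1) = (\<integral>x. w x * f x \<partial>P))"
proof -
  have sets [measurable_cong]: "sets P = sets N" "sets P1 = sets N" and "prob_space P" "prob_space P1"
    using P P1 by (auto simp: space_prob_algebra)
  interpret P: prob_space P by fact
  interpret P1: prob_space P1 by fact
  define Q where "Q = density P1 (\<lambda>_. ennreal s)"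
  have Q_sets: "sets Q = sets P" by (simp add: Q_def sets)
  have Q_eq: "emeasure Q A = ennreal (s * measure P1 A)" if "A \<in> sets P" for A
    using s that by (simp add: Q_def emeasure_density_const sets P1.emeasure_eq_measure ennreal_mult')
  have Q_le: "emeasure Q A \<le> emeasure P A" if "A \<in> sets P" for A
    using le[of A] that by (simp add: Q_eq P.emeasure_eq_measure sets ennreal_leI)
  interpret Q: finite_measure Q
    by (rule finite_measureI) (simp add: Q_eq sets_eq_imp_space_eq[OF Q_sets])
  have "absolutely_continuous P Q"
    unfolding absolutely_continuous_def
  proof
    fix A assume "A \<in> null_sets P"
    then show "A \<in> null_sets Q"
      using Q_le[of A] by (auto simp: null_sets_def Q_sets)
  qed
  then obtain g where g [measurable]: "g \<in> borel_measurable P" and g_dens: "density P g = Q"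
    using P.Radon_Nikodym[OF _ Q_sets] by blast
  have "AE x in P. g x \<le> 1"
  proof -
    \<comment> \<open>Integrating the excess of \<open>g\<close> over \<open>1\<close> gives \<open>0\<close>, since \<open>s P1\<close> does not exceed \<open>P\<close> on the set where \<open>g > 1\<close>.\<close>
    let ?A = "{x \<in> space P. 1 < g x}"
    have A: "?A \<in> sets P" by measurable
    have "emeasure P ?A + (\<integral>\<^sup>+x. (g x - 1) * indicator ?A x \<partial>P)
        = (\<integral>\<^sup>+x. indicator ?A x + (g x - 1) * indicator ?A x \<partial>P)"
      by (subst nn_integral_add) auto
    also have "\<dots> = (\<integral>\<^sup>+x. g x * indicator ?A x \<partial>P)"
      by (intro nn_integral_cong) (auto simp: indicator_def)
    also have "\<dots> = emeasure Q ?A"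
      unfolding g_dens[symmetric] by (rule emeasure_density[symmetric]) (use A in auto)
    also have "\<dots> \<le> emeasure P ?A + 0" using Q_le[OF A] by simp
    finally have "(\<integral>\<^sup>+x. (g x - 1) * indicator ?A x \<partial>P) = 0"
      by (simp add: P.emeasure_eq_measure ennreal_add_left_cancel_le)
    then have "AE x in P. (g x - 1) * indicator ?A x = 0"
      by (subst (asm) nn_integral_0_iff_AE) auto
    with AE_space show ?thesis
      by eventually_elim (auto simp: indicator_def not_less[symmetric] diff_eq_0_iff_ennreal split: if_splits)
  qed
  define w where "w x = min 1 (enn2real (g x))" for x
  have w: "w \<in> borel_measurable N"
    unfolding w_def using g by (simp add: measurable_cong_sets[OF sets(1) refl])
  have w_AE: "AE x in P. g x = ennreal (w x)"
    using \<open>AE x in P. g x \<le> 1\<close>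
  proof eventually_elim
    fix x assume "g x \<le> 1"
    then obtain r where r: "g x = ennreal r" "0 \<le> r" by (cases "g x") (auto simp: top_unique)
    with \<open>g x \<le> 1\<close> show "g x = ennreal (w x)" by (simp add: w_def min_def)
  qed
  have w01: "w x \<in> {0..1}" for x by (auto simp: w_def)
  have Q_dens: "Q = density P (\<lambda>x. ennreal (w x))"
    unfolding g_dens[symmetric] using w_AE w by (intro density_cong) (auto simp: measurable_cong_sets[OF sets(1) refl])
  have "s * (\<integral>x. f x \<partial>P1) = (\<integral>x. w x * f x \<partial>P)" if f: "f \<in> bounded_measurable N" for f
  proof -
    have fb [measurable]: "f \<in> borel_measurable N" by (rule bounded_measurable_measurable[OF f])
    have "s * (\<integral>x. f x \<partial>P1) = (\<integral>x. f x \<partial>Q)"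
      unfolding Q_def using s by (subst integral_density) auto
    also have "\<dots> = (\<integral>x. w x * f x \<partial>P)"
      unfolding Q_dens using w01 w
      by (subst integral_density) (auto simp: measurable_cong_sets[OF sets(1) refl])
    finally show ?thesis .
  qed
  with w w01 show ?thesis by blast
qed

text \<open>
  The amount by which the action misses optimality in the Bellman equation if \<open>v\<close> is taken as value function.  The
  factor \<open>1 - \<beta>\<close> on the cost matches the normalisation of the discounted criterion.
\<close>

definition bellman_gap ::
  "real \<Rightarrow> ('x \<times> 'a \<Rightarrow> 'x measure) \<Rightarrow> ('x \<times> 'a \<Rightarrow> real) \<Rightarrow> ('x \<Rightarrow> real) \<Rightarrow> 'x \<times> 'a \<Rightarrow> real" where
  "bellman_gap \<beta> p f v z = (1 - \<beta>) * f z + \<beta> * (\<integral>y. v y \<partial>p z) - v (fst z)"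

context discounted_model
begin

lemma integral_state_law:
  assumes "\<mu> \<in> space (prob_algebra SA)" "v \<in> bounded_measurable (states M)"
  shows "(\<integral>x. v x \<partial>distr \<mu> (states M) fst) = (\<integral>z. v (fst z) \<partial>\<mu>)"
proof -
  have "sets \<mu> = sets SA" using assms(1) by (simp add: space_prob_algebra)
  then have "fst \<in> \<mu> \<rightarrow>\<^sub>M states M" using measurable_cong_sets[of \<mu> SA "states M"] by simp
  then show ?thesis
    using assms(2) by (subst integral_distr) (auto dest: bounded_measurable_measurable)
qed

lemma balanced_mixture:
  assumes "balanced \<mu>1" "balanced \<mu>2" and s: "s \<in> {0..1}"
  shows "balanced (mixture s \<mu>1 \<mu>2)"
  unfolding balanced_def
proof (intro conjI ballI)
  have \<mu>: "\<mu>1 \<in> space (prob_algebra SA)" "\<mu>2 \<in> space (prob_algebra SA)"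
    using assms unfolding balanced_def by auto
  show "mixture s \<mu>1 \<mu>2 \<in> space (prob_algebra SA)" by (rule mixture_in_prob_algebra[OF \<mu>])
  fix v assume v: "v \<in> bounded_measurable (states M)"
  have v': "(\<lambda>z. v (fst z)) \<in> bounded_measurable SA"
    by (rule bounded_measurable_compose[OF v measurable_fst])
  have pv: "(\<lambda>z. \<integral>y. v y \<partial>trans_kernel M z) \<in> bounded_measurable SA"
    by (rule integral_kernel_measurable[OF trans v])
  have eq: "(\<integral>z. v (fst z) \<partial>\<mu>) = (1 - \<beta>) * (\<integral>x. v x \<partial>init_law M) +
      \<beta> * (\<integral>z. (\<integral>y. v y \<partial>trans_kernel M z) \<partial>\<mu>)" if "balanced \<mu>" for \<mu>
    using that v unfolding balanced_def by blast
  show "(\<integral>z. v (fst z) \<partial>mixture s \<mu>1 \<mu>2) = (1 - \<beta>) * (\<integral>x. v x \<partial>init_law M) +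
      \<beta> * (\<integral>z. (\<integral>y. v y \<partial>trans_kernel M z) \<partial>mixture s \<mu>1 \<mu>2)"
    unfolding integral_mixture[OF \<mu> v' s] integral_mixture[OF \<mu> pv s] eq[OF assms(1)] eq[OF assms(2)]
    by (simp add: algebra_simps)
qed

text \<open>
  Let \<open>\<mu> = s \<mu>1 + (1 - s) \<mu>2\<close>.  Given the state \<open>x\<close>, a sample from \<open>\<mu>\<close> comes from \<open>\<mu>1\<close> with the posterior probability
  \<open>w x\<close>, where \<open>w\<close> is the density of the state law of \<open>s \<mu>1\<close> with respect to that of \<open>\<mu>\<close>.  So \<open>\<mu>\<close> is
  randomized by the kernel that uses \<open>\<phi>1\<close> with probability \<open>w x\<close> and \<open>\<phi>2\<close> otherwise.
\<close>

lemma randomized_by_mixture: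
  assumes \<mu>: "\<mu>1 \<in> space (prob_algebra SA)" "\<mu>2 \<in> space (prob_algebra SA)" and s: "s \<in> {0..1}"
    and \<phi>1: "\<phi>1 \<in> states M \<rightarrow>\<^sub>M prob_algebra (actions M)" "randomized_by \<phi>1 \<mu>1"
    and \<phi>2: "\<phi>2 \<in> states M \<rightarrow>\<^sub>M prob_algebra (actions M)" "randomized_by \<phi>2 \<mu>2"
  shows "\<exists>\<phi>. \<phi> \<in> states M \<rightarrow>\<^sub>M prob_algebra (actions M) \<and> randomized_by \<phi> (mixture s \<mu>1 \<mu>2)"
proof -
  let ?\<mu> = "mixture s \<mu>1 \<mu>2"
  have \<mu>_mix: "?\<mu> \<in> space (prob_algebra SA)" by (rule mixture_in_prob_algebra[OF \<mu>])
  have marg: "distr \<mu> (states M) fst \<in> space (prob_algebra (states M))"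
    if "\<mu> \<in> space (prob_algebra SA)" for \<mu>
    using measurable_space[OF measurable_distr_prob_space[OF measurable_fst] that] by simp
  have marg_mix: "(\<integral>x. v x \<partial>distr ?\<mu> (states M) fst) =
      s * (\<integral>x. v x \<partial>distr \<mu>1 (states M) fst) + (1 - s) * (\<integral>x. v x \<partial>distr \<mu>2 (states M) fst)"
    if v: "v \<in> bounded_measurable (states M)" for v
  proof -
    have v': "(\<lambda>z. v (fst z)) \<in> bounded_measurable SA"
      by (rule bounded_measurable_compose[OF v measurable_fst])
    show ?thesis
      unfolding integral_state_law[OF \<mu>(1) v] integral_state_law[OF \<mu>(2) v] integral_state_law[OF \<mu>_mix v]
      by (rule integral_mixture[OF \<mu> v' s])
  qed
  have "s * measure (distr \<mu>1 (states M) fst) A \<le> measure (distr ?\<mu> (states M) fst) A"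
    if A: "A \<in> sets (states M)" for A
  proof -
    have ind: "indicator A \<in> bounded_measurable (states M)"
      using A by (intro bounded_measurableI[of _ _ 1]) auto
    have int: "(\<integral>x. indicator A x \<partial>P) = measure P A" if "P \<in> space (prob_algebra (states M))" for P
      using that A sets.sets_into_space[OF A] sets_eq_imp_space_eq[of P "states M"]
      by (auto simp: space_prob_algebra Int_absorb2)
    show ?thesis
      using marg_mix[OF ind] s unfolding int[OF marg[OF \<mu>(1)]] int[OF marg[OF \<mu>(2)]] int[OF marg[OF \<mu>_mix]]
      by simp
  qed
  from dominated_law_has_weight[OF marg[OF \<mu>_mix] marg[OF \<mu>(1)] s this]
  obtain w where w: "w \<in> borel_measurable (states M)" "\<And>x. w x \<in> {0..1}"
    and w1: "\<And>v. v \<in> bounded_measurable (states M) \<Longrightarrow>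
      s * (\<integral>x. v x \<partial>distr \<mu>1 (states M) fst) = (\<integral>x. w x * v x \<partial>distr ?\<mu> (states M) fst)"
    by blast
  have wb: "w \<in> bounded_measurable (states M)"
    using w by (intro bounded_measurableI[of _ _ 1]) auto
  have w2: "(1 - s) * (\<integral>x. v x \<partial>distr \<mu>2 (states M) fst) =
      (\<integral>x. (1 - w x) * v x \<partial>distr ?\<mu> (states M) fst)" if v: "v \<in> bounded_measurable (states M)" for v
  proof -
    have "(\<integral>x. (1 - w x) * v x \<partial>distr ?\<mu> (states M) fst) =
        (\<integral>x. v x \<partial>distr ?\<mu> (states M) fst) - (\<integral>x. w x * v x \<partial>distr ?\<mu> (states M) fst)"
      using bounded_measurable_integrable[OF v marg[OF \<mu>_mix]]
        bounded_measurable_integrable[OF bounded_measurable_mult[OF wb v] marg[OF \<mu>_mix]]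
      by (simp add: left_diff_distrib)
    then show ?thesis using marg_mix[OF v] w1[OF v] by simp
  qed
  define \<phi> where "\<phi> x = mixture (w x) (\<phi>1 x) (\<phi>2 x)" for x
  have \<phi>: "\<phi> \<in> states M \<rightarrow>\<^sub>M prob_algebra (actions M)"
    unfolding \<phi>_def[abs_def] by (rule mixture_kernel_measurable[OF \<phi>1(1) \<phi>2(1) w])
  have "(\<integral>z. f z \<partial>?\<mu>) = (\<integral>z. (\<integral>a. f (fst z, a) \<partial>\<phi> (fst z)) \<partial>?\<mu>)" if f: "f \<in> bounded_measurable SA" for f
  proof -
    define g1 g2 where "g1 x = (\<integral>a. f (x, a) \<partial>\<phi>1 x)" and "g2 x = (\<integral>a. f (x, a) \<partial>\<phi>2 x)" for x
    have g: "g1 \<in> bounded_measurable (states M)" "g2 \<in> bounded_measurable (states M)"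
      unfolding g1_def[abs_def] g2_def[abs_def]
      by (rule integral_kernel_pair_measurable[OF \<phi>1(1) f] integral_kernel_pair_measurable[OF \<phi>2(1) f])+
    have g\<phi>: "(\<integral>a. f (x, a) \<partial>\<phi> x) = w x * g1 x + (1 - w x) * g2 x" if x: "x \<in> space (states M)" for x
    proof -
      have "(\<lambda>a. f (x, a)) \<in> bounded_measurable (actions M)"
        by (rule bounded_measurable_compose[OF f]) (use x in simp)
      then show ?thesis
        unfolding \<phi>_def g1_def g2_def
        using measurable_space[OF \<phi>1(1) x] measurable_space[OF \<phi>2(1) x] w(2)
        by (intro integral_mixture)
    qed
    have "(\<integral>z. f z \<partial>?\<mu>) = s * (\<integral>z. f z \<partial>\<mu>1) + (1 - s) * (\<integral>z. f z \<partial>\<mu>2)"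
      by (rule integral_mixture[OF \<mu> f s])
    also have "(\<integral>z. f z \<partial>\<mu>1) = (\<integral>x. g1 x \<partial>distr \<mu>1 (states M) fst)"
      unfolding integral_state_law[OF \<mu>(1) g(1)] unfolding g1_def
      by (rule \<phi>1(2)[unfolded randomized_by_def, rule_format, OF f])
    also have "(\<integral>z. f z \<partial>\<mu>2) = (\<integral>x. g2 x \<partial>distr \<mu>2 (states M) fst)"
      unfolding integral_state_law[OF \<mu>(2) g(2)] unfolding g2_def
      by (rule \<phi>2(2)[unfolded randomized_by_def, rule_format, OF f])
    also have "s * (\<integral>x. g1 x \<partial>distr \<mu>1 (states M) fst) + (1 - s) * (\<integral>x. g2 x \<partial>distr \<mu>2 (states M) fst)
        = (\<integral>x. w x * g1 x + (1 - w x) * g2 x \<partial>distr ?\<mu> (states M) fst)"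
      unfolding w1[OF g(1)] w2[OF g(2)]
      by (intro Bochner_Integration.integral_add[symmetric] bounded_measurable_integrable[OF _ marg[OF \<mu>_mix]]
          bounded_measurable_mult bounded_measurable_diff bounded_measurable_const wb g)
    also have "\<dots> = (\<integral>x. (\<integral>a. f (x, a) \<partial>\<phi> x) \<partial>distr ?\<mu> (states M) fst)"
      by (intro Bochner_Integration.integral_cong refl) (simp add: g\<phi>)
    also have "\<dots> = (\<integral>z. (\<integral>a. f (fst z, a) \<partial>\<phi> (fst z)) \<partial>?\<mu>)"
      by (rule integral_state_law[OF \<mu>_mix integral_kernel_pair_measurable[OF \<phi> f]])
    finally show ?thesis .
  qed
  with \<phi> show ?thesis unfolding randomized_by_def by blast
qed

text \<open>
  Disintegration followed by balance expresses \<open>\<integral>f d\<mu>\<close> through the initial law and \<open>\<beta>\<close> times the integral of the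
  expected value of \<open>f\<close> one step later.  The first part is common to \<open>\<mu>1\<close> and \<open>\<mu>2\<close>, so each iteration shrinks
  the difference by \<open>\<beta>\<close>, while the sup norm of the function does not grow.
\<close>

lemma balanced_randomized_unique:
  assumes \<phi>: "\<phi> \<in> states M \<rightarrow>\<^sub>M prob_algebra (actions M)"
    and \<mu>1: "balanced \<mu>1" "randomized_by \<phi> \<mu>1" and \<mu>2: "balanced \<mu>2" "randomized_by \<phi> \<mu>2"
    and f: "f \<in> bounded_measurable SA"
  shows "(\<integral>z. f z \<partial>\<mu>1) = (\<integral>z. f z \<partial>\<mu>2)"
proof -
  have \<mu>: "\<mu>1 \<in> space (prob_algebra SA)" "\<mu>2 \<in> space (prob_algebra SA)"
    using \<mu>1 \<mu>2 unfolding balanced_def by auto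
  have decay: "\<bar>(\<integral>z. f z \<partial>\<mu>1) - (\<integral>z. f z \<partial>\<mu>2)\<bar> \<le> \<beta> ^ n * (2 * B)"
    if "f \<in> bounded_measurable SA" "\<And>z. z \<in> space SA \<Longrightarrow> \<bar>f z\<bar> \<le> B" for f B n
    using that
  proof (induction n arbitrary: f)
    case 0
    have "\<bar>\<integral>z. f z \<partial>\<mu>1\<bar> \<le> B" "\<bar>\<integral>z. f z \<partial>\<mu>2\<bar> \<le> B"
      by (rule abs_integral_bound[OF 0(1)], use \<mu> 0 in auto)+
    then show ?case by (simp add: abs_le_iff)
  next
    case (Suc n)
    let ?g = "\<lambda>x. \<integral>a. f (x, a) \<partial>\<phi> x"
    let ?h = "\<lambda>z. \<integral>y. ?g y \<partial>trans_kernel M z"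
    have g: "?g \<in> bounded_measurable (states M)"
      by (rule integral_kernel_pair_measurable[OF \<phi> Suc.prems(1)])
    have g_bound: "\<bar>?g x\<bar> \<le> B" if x: "x \<in> space (states M)" for x
    proof (rule abs_integral_bound)
      show "(\<lambda>a. f (x, a)) \<in> bounded_measurable (actions M)"
        by (rule bounded_measurable_compose[OF Suc.prems(1)]) (use x in simp)
    qed (use measurable_space[OF \<phi> x] Suc.prems(2) x in \<open>auto simp: space_pair_measure\<close>)
    have h: "?h \<in> bounded_measurable SA"
      by (rule integral_kernel_measurable[OF trans g])
    have h_bound: "\<bar>?h z\<bar> \<le> B" if z: "z \<in> space SA" for z
      by (rule abs_integral_bound[OF g measurable_space[OF trans z] g_bound])
    have step: "(\<integral>z. f z \<partial>\<mu>) = (1 - \<beta>) * (\<integral>x. ?g x \<partial>init_law M) + \<beta> * (\<integral>z. ?h z \<partial>\<mu>)"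
      if "balanced \<mu>" "randomized_by \<phi> \<mu>" for \<mu>
    proof -
      have "(\<integral>z. f z \<partial>\<mu>) = (\<integral>z. ?g (fst z) \<partial>\<mu>)"
        using that(2) Suc.prems(1) unfolding randomized_by_def by blast
      also have "\<dots> = (1 - \<beta>) * (\<integral>x. ?g x \<partial>init_law M) + \<beta> * (\<integral>z. ?h z \<partial>\<mu>)"
        by (rule that(1)[unfolded balanced_def, THEN conjunct2, rule_format, OF g])
      finally show ?thesis .
    qed
    have "(\<integral>z. f z \<partial>\<mu>1) - (\<integral>z. f z \<partial>\<mu>2) = \<beta> * ((\<integral>z. ?h z \<partial>\<mu>1) - (\<integral>z. ?h z \<partial>\<mu>2))"
      unfolding step[OF \<mu>1] step[OF \<mu>2] by (simp add: algebra_simps)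
    then have "\<bar>(\<integral>z. f z \<partial>\<mu>1) - (\<integral>z. f z \<partial>\<mu>2)\<bar> = \<beta> * \<bar>(\<integral>z. ?h z \<partial>\<mu>1) - (\<integral>z. ?h z \<partial>\<mu>2)\<bar>"
      using discount by (simp add: abs_mult)
    also have "\<dots> \<le> \<beta> * (\<beta> ^ n * (2 * B))"
      using discount Suc.IH[OF h h_bound] by (intro mult_left_mono) auto
    finally show ?case by simp
  qed
  obtain B where B: "\<And>z. z \<in> space SA \<Longrightarrow> \<bar>f z\<bar> \<le> B"
    using bounded_measurableE[OF f] by metis
  have "(\<lambda>n. \<beta> ^ n * (2 * B)) \<longlonglongrightarrow> 0 * (2 * B)"
    using discount by (intro tendsto_mult LIMSEQ_power_zero tendsto_const) auto
  then have "\<bar>(\<integral>z. f z \<partial>\<mu>1) - (\<integral>z. f z \<partial>\<mu>2)\<bar> \<le> 0"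
    using decay[OF f B] by (intro LIMSEQ_le_const[where X = "\<lambda>n. \<beta> ^ n * (2 * B)"]) auto
  then show ?thesis by simp
qed

lemma cost_of_balanced_randomized:
  assumes "\<phi> \<in> states M \<rightarrow>\<^sub>M prob_algebra (actions M)" "balanced \<mu>" "randomized_by \<phi> \<mu>"
    and f: "f \<in> bounded_measurable SA"
  shows "disc_cost \<beta> M f (stationary \<phi>) = (\<integral>z. f z \<partial>\<mu>)"
  unfolding disc_cost_eq_integral_occupation[OF stationary_policy[OF assms(1)] f]
  using balanced_occupation[OF stationary_policy[OF assms(1)]]
    randomized_by_occupation_stationary[OF assms(1)] assms
  by (intro balanced_randomized_unique) auto

text \<open>
  The balance equation cancels the terms with \<open>v\<close>, except for the initial law.
\<close>

lemma integral_bellman_gap: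
  assumes \<mu>: "balanced \<mu>" and f: "f \<in> bounded_measurable SA" and v: "v \<in> bounded_measurable (states M)"
  shows "bellman_gap \<beta> (trans_kernel M) f v \<in> bounded_measurable SA"
    and "(\<integral>z. bellman_gap \<beta> (trans_kernel M) f v z \<partial>\<mu>) = (1 - \<beta>) * ((\<integral>z. f z \<partial>\<mu>) - (\<integral>x. v x \<partial>init_law M))"
proof -
  have \<mu>': "\<mu> \<in> space (prob_algebra SA)" using \<mu> by (simp add: balanced_def)
  have v': "(\<lambda>z. v (fst z)) \<in> bounded_measurable SA"
    by (rule bounded_measurable_compose[OF v measurable_fst])
  have pv: "(\<lambda>z. \<integral>y. v y \<partial>trans_kernel M z) \<in> bounded_measurable SA"
    by (rule integral_kernel_measurable[OF trans v])
  show "bellman_gap \<beta> (trans_kernel M) f v \<in> bounded_measurable SA"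
    unfolding bellman_gap_def[abs_def]
    by (intro bounded_measurable_diff bounded_measurable_add bounded_measurable_mult bounded_measurable_const f pv v')
  have "(\<integral>z. bellman_gap \<beta> (trans_kernel M) f v z \<partial>\<mu>) =
      (1 - \<beta>) * (\<integral>z. f z \<partial>\<mu>) + \<beta> * (\<integral>z. (\<integral>y. v y \<partial>trans_kernel M z) \<partial>\<mu>) - (\<integral>z. v (fst z) \<partial>\<mu>)"
    unfolding bellman_gap_def using bounded_measurable_integrable[OF f \<mu>']
      bounded_measurable_integrable[OF pv \<mu>'] bounded_measurable_integrable[OF v' \<mu>'] by simp
  also have "(\<integral>z. v (fst z) \<partial>\<mu>) =
      (1 - \<beta>) * (\<integral>x. v x \<partial>init_law M) + \<beta> * (\<integral>z. (\<integral>y. v y \<partial>trans_kernel M z) \<partial>\<mu>)"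
    using \<mu> v unfolding balanced_def by blast
  finally show "(\<integral>z. bellman_gap \<beta> (trans_kernel M) f v z \<partial>\<mu>) = (1 - \<beta>) * ((\<integral>z. f z \<partial>\<mu>) - (\<integral>x. v x \<partial>init_law M))"
    by (simp add: algebra_simps)
qed

text \<open>
  The verification bound: it covers every policy, as only the balance equation of \<open>\<mu>\<close> enters.
\<close>

lemma balanced_cost_ge:
  assumes \<mu>: "balanced \<mu>" and f: "f \<in> bounded_measurable SA" and v: "v \<in> bounded_measurable (states M)"
    and gap: "\<And>z. z \<in> space SA \<Longrightarrow> - e \<le> bellman_gap \<beta> (trans_kernel M) f v z"
  shows "(\<integral>x. v x \<partial>init_law M) - e / (1 - \<beta>) \<le> (\<integral>z. f z \<partial>\<mu>)"
proof -
  have "(\<integral>x. v x \<partial>init_law M) \<le> (\<integral>z. f z \<partial>\<mu>) + e / (1 - \<beta>)"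
  proof -
    obtain B where "\<And>z. z \<in> space SA \<Longrightarrow> \<bar>bellman_gap \<beta> (trans_kernel M) f v z\<bar> \<le> B"
      using bounded_measurableE[OF integral_bellman_gap(1)[OF \<mu> f v]] by metis
    then have "- e \<le> (\<integral>z. bellman_gap \<beta> (trans_kernel M) f v z \<partial>\<mu>)"
      using \<mu> gap by (intro integral_bounds(1)[OF integral_bellman_gap(1)[OF \<mu> f v], where b = B])
        (auto simp: balanced_def abs_le_iff)
    then show ?thesis
      unfolding integral_bellman_gap(2)[OF \<mu> f v] using discount by (simp add: field_simps)
  qed
  then show ?thesis by simp
qed

text \<open>
  The stationary deterministic policy that plays \<open>s\<close> attains the value, since its
  occupation measure lives on the graph of \<open>s\<close>.
\<close>

lemma selector_cost_le:
  assumes s: "s \<in> states M \<rightarrow>\<^sub>M actions M"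
    and f: "f \<in> bounded_measurable SA" and v: "v \<in> bounded_measurable (states M)"
    and gap: "\<And>x. x \<in> space (states M) \<Longrightarrow> bellman_gap \<beta> (trans_kernel M) f v (x, s x) \<le> e"
  shows "\<exists>\<phi> \<mu>. \<phi> \<in> states M \<rightarrow>\<^sub>M prob_algebra (actions M) \<and> balanced \<mu> \<and> randomized_by \<phi> \<mu> \<and>
    (\<integral>z. f z \<partial>\<mu>) \<le> (\<integral>x. v x \<partial>init_law M) + e / (1 - \<beta>)"
proof -
  define \<phi> where "\<phi> = (\<lambda>x. return (actions M) (s x))"
  have \<phi>: "\<phi> \<in> states M \<rightarrow>\<^sub>M prob_algebra (actions M)"
    unfolding \<phi>_def using s by measurable
  define \<mu> where "\<mu> = occupation (stationary \<phi>)"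
  have \<mu>: "balanced \<mu>" "randomized_by \<phi> \<mu>"
    unfolding \<mu>_def using balanced_occupation[OF stationary_policy[OF \<phi>]]
      randomized_by_occupation_stationary[OF \<phi>] by auto
  note g = integral_bellman_gap(1)[OF \<mu>(1) f v]
  let ?g = "\<lambda>z. bellman_gap \<beta> (trans_kernel M) f v (fst z, s (fst z))"
  have g': "?g \<in> bounded_measurable SA"
    by (rule bounded_measurable_compose[OF g]) (use s in measurable)
  have "(\<integral>z. bellman_gap \<beta> (trans_kernel M) f v z \<partial>\<mu>) = (\<integral>z. (\<integral>a. bellman_gap \<beta> (trans_kernel M) f v (fst z, a) \<partial>\<phi> (fst z)) \<partial>\<mu>)"
    using \<mu>(2) g unfolding randomized_by_def by blast
  also have "\<dots> = (\<integral>z. ?g z \<partial>\<mu>)"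
  proof (rule Bochner_Integration.integral_cong[OF refl])
    fix z assume "z \<in> space \<mu>"
    then have x: "fst z \<in> space (states M)"
      using \<mu>(1) by (auto simp: balanced_def space_prob_algebra space_pair_measure dest!: sets_eq_imp_space_eq)
    have "(\<lambda>a. bellman_gap \<beta> (trans_kernel M) f v (fst z, a)) \<in> borel_measurable (actions M)"
      using bounded_measurable_measurable[OF g] x by measurable
    then show "(\<integral>a. bellman_gap \<beta> (trans_kernel M) f v (fst z, a) \<partial>\<phi> (fst z)) = ?g z"
      unfolding \<phi>_def using measurable_space[OF s x] by (subst integral_return) auto
  qed
  also have "\<dots> \<le> e"
  proof -
    obtain B where "\<And>z. z \<in> space SA \<Longrightarrow> \<bar>?g z\<bar> \<le> B"
      using bounded_measurableE[OF g'] by metis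
    then show ?thesis
      using \<mu>(1) by (intro integral_bounds(2)[OF g', where a = "- B"])
        (auto simp: balanced_def abs_le_iff space_pair_measure minus_le_iff intro!: gap)
  qed
  finally have "(\<integral>z. f z \<partial>\<mu>) \<le> (\<integral>x. v x \<partial>init_law M) + e / (1 - \<beta>)"
    unfolding integral_bellman_gap(2)[OF \<mu>(1) f v] using discount by (simp add: field_simps)
  with \<phi> \<mu> show ?thesis by blast
qed

end

section \<open>Approximate solutions of the Bellman equation\<close>

lemma compact_UNIV_prod: "compact (UNIV :: ('x::compact_metric_space \<times> 'a::compact_metric_space) set)"
  using compact_Times[OF compact_UNIV compact_UNIV] by (simp add: UNIV_Times_UNIV)

lemma continuous_on_compact_UNIV:
  fixes f :: "'b::metric_space \<Rightarrow> real"
  assumes "compact (UNIV :: 'b set)" "continuous_on UNIV f"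
  shows "\<exists>B\<ge>0. \<forall>x. \<bar>f x\<bar> \<le> B" "e > 0 \<Longrightarrow> \<exists>\<delta>>0. \<forall>x y. dist x y < \<delta> \<longrightarrow> \<bar>f x - f y\<bar> \<le> e"
proof -
  have "bounded (range f)"
    using compact_continuous_image[OF assms(2,1)] by (rule compact_imp_bounded)
  then show "\<exists>B\<ge>0. \<forall>x. \<bar>f x\<bar> \<le> B"
    by (auto simp: bounded_pos intro: less_imp_le)
  assume "e > 0"
  then show "\<exists>\<delta>>0. \<forall>x y. dist x y < \<delta> \<longrightarrow> \<bar>f x - f y\<bar> \<le> e"
    using compact_uniformly_continuous[OF assms(2,1)]
    unfolding uniformly_continuous_on_def dist_real_def by (metis UNIV_I less_imp_le)
qed

lemma continuous_bounded_measurable: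
  fixes f :: "'b::metric_space \<Rightarrow> real"
  assumes "compact (UNIV :: 'b set)" "continuous_on UNIV f"
  shows "f \<in> bounded_measurable borel"
proof -
  obtain B where "\<forall>x. \<bar>f x\<bar> \<le> B" using continuous_on_compact_UNIV(1)[OF assms] by blast
  then show ?thesis
    using assms(2) by (intro bounded_measurableI[of _ _ B] borel_measurable_continuous_onI) auto
qed

text \<open>
  Uniform continuity on the compact product makes the family \<open>h (\<cdot>, a)\<close> equicontinuous, so its minimum over \<open>a\<close> is continuous.
\<close>

lemma continuous_partial_minimum:
  fixes h :: "'x::compact_metric_space \<times> 'a::compact_metric_space \<Rightarrow> real"
  assumes h: "continuous_on UNIV h"
  shows "\<exists>m. continuous_on UNIV m \<and> (\<forall>x a. m x \<le> h (x, a)) \<and> (\<forall>x. \<exists>a. m x = h (x, a))"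
proof -
  have "\<exists>a. \<forall>b. h (x, a) \<le> h (x, b)" for x
  proof -
    have "continuous_on UNIV (\<lambda>a. h (x, a))"
      by (rule continuous_on_compose2[OF h]) (auto intro!: continuous_intros)
    from continuous_attains_inf[OF compact_UNIV _ this] show ?thesis by auto
  qed
  then obtain s where s: "\<And>x b. h (x, s x) \<le> h (x, b)" by metis
  have "continuous_on UNIV (\<lambda>x. h (x, s x))"
    unfolding continuous_on_iff
  proof (intro ballI allI impI)
    fix x :: 'x and e :: real assume "e > 0"
    then obtain \<delta> where \<delta>: "\<delta> > 0" "\<And>z w. dist z w < \<delta> \<Longrightarrow> \<bar>h z - h w\<bar> \<le> e / 2"
      using continuous_on_compact_UNIV(2)[OF compact_UNIV_prod h, of "e / 2"] by auto
    have "dist (h (y, s y)) (h (x, s x)) < e" if "dist y x < \<delta>" for y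
    proof -
      have "\<bar>h (y, a) - h (x, a)\<bar> \<le> e / 2" for a
        using that by (intro \<delta>(2)) (simp add: dist_Pair_Pair)
      from this[of "s x"] this[of "s y"] show ?thesis
        using s[of y "s x"] s[of x "s y"] \<open>e > 0\<close> unfolding dist_real_def abs_le_iff by linarith
    qed
    with \<delta>(1) show "\<exists>d>0. \<forall>y\<in>UNIV. dist y x < d \<longrightarrow> dist (h (y, s y)) (h (x, s x)) < e" by blast
  qed
  with s show ?thesis by (intro exI[of _ "\<lambda>x. h (x, s x)"]) auto
qed

text \<open>
  With a strict inequality an action can be taken from a countable dense set: the first one that works depends
  measurably on the state.
\<close>

lemma measurable_near_selector:
  fixes g :: "'x::compact_metric_space \<times> 'a::compact_metric_space \<Rightarrow> real"
  assumes g: "continuous_on UNIV g" and ex: "\<And>x. \<exists>a. g (x, a) < e"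
  shows "\<exists>s\<in>borel \<rightarrow>\<^sub>M borel. \<forall>x. g (x, s x) < e"
proof -
  obtain D :: "'a set" where D: "countable D" "\<And>U. open U \<Longrightarrow> U \<noteq> {} \<Longrightarrow> \<exists>d\<in>D. d \<in> U"
    using countable_dense_setE by blast
  have "D \<noteq> {}" using D(2)[of UNIV] by auto
  define r where "r = from_nat_into D"
  have r: "range r = D" unfolding r_def using D(1) \<open>D \<noteq> {}\<close> by (simp add: range_from_nat_into)
  have sect: "continuous_on UNIV (\<lambda>a. g (x, a))" "continuous_on UNIV (\<lambda>x. g (x, a))" for x a
    by (rule continuous_on_compose2[OF g]; auto intro!: continuous_intros)+
  have "\<exists>n. g (x, r n) < e" for x
  proof -
    have "open {a. g (x, a) < e}" using sect(1) by (intro open_Collect_less continuous_intros)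
    moreover have "{a. g (x, a) < e} \<noteq> {}" using ex by auto
    ultimately obtain d where "d \<in> D" "g (x, d) < e" using D(2) by blast
    with r show ?thesis by (metis imageE)
  qed
  then have "g (x, r (LEAST n. g (x, r n) < e)) < e" for x by (rule LeastI_ex)
  moreover have "(\<lambda>x. r (LEAST n. g (x, r n) < e)) \<in> borel \<rightarrow>\<^sub>M borel"
  proof -
    have "(\<lambda>x. g (x, r n)) \<in> borel_measurable borel" for n
      by (rule borel_measurable_continuous_onI[OF sect(2)])
    then have "(\<lambda>x. LEAST n. g (x, r n) < e) \<in> borel \<rightarrow>\<^sub>M count_space UNIV"
      by (intro measurable_Least) measurable
    then show ?thesis by (rule measurable_compose) simp
  qed
  ultimately show ?thesis
    by (intro bexI[of _ "\<lambda>x. r (LEAST n. g (x, r n) < e)"]) auto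
qed

lemma continuous_bellman_gap:
  fixes p :: "'x::compact_metric_space \<times> 'a::compact_metric_space \<Rightarrow> 'x measure"
  assumes weak: "weakly_continuous_kernel p" and f: "continuous_on UNIV f" and v: "continuous_on UNIV v"
  shows "continuous_on UNIV (\<lambda>z. (1 - \<beta>) * f z + \<beta> * (\<integral>y. v y \<partial>p z))"
    and "continuous_on UNIV (bellman_gap \<beta> p f v)"
proof -
  have "bounded (range v)"
    using compact_continuous_image[OF v compact_UNIV] by (rule compact_imp_bounded)
  then have "continuous_on UNIV (\<lambda>z. \<integral>y. v y \<partial>p z)"
    using weak v unfolding weakly_continuous_kernel_def by blast
  then show *: "continuous_on UNIV (\<lambda>z. (1 - \<beta>) * f z + \<beta> * (\<integral>y. v y \<partial>p z))"
    using f by (intro continuous_intros)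
  have "continuous_on UNIV (\<lambda>z :: 'x \<times> 'a. v (fst z))"
    by (rule continuous_on_compose2[OF v]) (auto intro!: continuous_intros)
  from continuous_on_diff[OF * this] show "continuous_on UNIV (bellman_gap \<beta> p f v)"
    unfolding bellman_gap_def[abs_def] .
qed

text \<open>
  Value iteration from \<open>0\<close>.  The gap of the iterate \<open>V n\<close> has the minimum \<open>V (Suc n) x - V n x\<close> over the actions, and
  consecutive iterates differ by at most \<open>\<beta> ^ n\<close> times a constant.  Weak continuity of the kernel keeps all iterates continuous.
\<close>

lemma approximate_bellman_solution:
  fixes p :: "'x::compact_metric_space \<times> 'a::compact_metric_space \<Rightarrow> 'x measure"
  assumes kernel: "p \<in> borel \<Otimes>\<^sub>M borel \<rightarrow>\<^sub>M prob_algebra borel"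
    and weak: "weakly_continuous_kernel p" and f: "continuous_on UNIV f"
    and \<beta>: "0 < \<beta>" "\<beta> < 1" and e: "e > 0"
  shows "\<exists>v. continuous_on UNIV v \<and> (\<forall>z. - e \<le> bellman_gap \<beta> p f v z) \<and> (\<forall>x. \<exists>a. bellman_gap \<beta> p f v (x, a) \<le> e)"
proof -
  define h where "h v z = (1 - \<beta>) * f z + \<beta> * (\<integral>y. v y \<partial>p z)" for v z
  have "\<forall>v. \<exists>m. continuous_on UNIV v \<longrightarrow>
      continuous_on UNIV m \<and> (\<forall>x a. m x \<le> h v (x, a)) \<and> (\<forall>x. \<exists>a. m x = h v (x, a))"
    using continuous_partial_minimum[OF continuous_bellman_gap(1)[OF weak f]] unfolding h_def by blast
  then obtain T where T: "\<And>v. continuous_on UNIV v \<Longrightarrow> continuous_on UNIV (T v)"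
    "\<And>v x a. continuous_on UNIV v \<Longrightarrow> T v x \<le> h v (x, a)"
    "\<And>v x. continuous_on UNIV v \<Longrightarrow> \<exists>a. T v x = h v (x, a)"
    by metis
  define V where "V n = (T ^^ n) (\<lambda>_. 0)" for n
  have V: "continuous_on UNIV (V n)" for n
    by (induction n) (auto simp: V_def T(1) intro: continuous_on_const)
  have V_Suc: "V (Suc n) = T (V n)" for n by (simp add: V_def)
  obtain B where B: "B \<ge> 0" "\<And>x. \<bar>V 1 x\<bar> \<le> B"
    using continuous_on_compact_UNIV(1)[OF compact_UNIV V[of 1]] by blast
  have p: "p z \<in> space (prob_algebra borel)" for z
    using measurable_space[OF kernel] by (auto simp: space_pair_measure)
  have contr: "\<bar>h v z - h w z\<bar> \<le> \<beta> * b"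
    if "continuous_on UNIV v" "continuous_on UNIV w" "\<And>x. \<bar>v x - w x\<bar> \<le> b" for v w b z
  proof -
    note m = continuous_bounded_measurable[OF compact_UNIV that(1)]
      continuous_bounded_measurable[OF compact_UNIV that(2)]
    have "\<bar>\<integral>y. v y - w y \<partial>p z\<bar> \<le> b"
      by (rule abs_integral_bound[OF bounded_measurable_diff[OF m] p that(3)])
    then have "\<bar>(\<integral>y. v y \<partial>p z) - (\<integral>y. w y \<partial>p z)\<bar> \<le> b"
      using bounded_measurable_integrable[OF m(1) p] bounded_measurable_integrable[OF m(2) p] by simp
    then have "\<beta> * \<bar>(\<integral>y. v y \<partial>p z) - (\<integral>y. w y \<partial>p z)\<bar> \<le> \<beta> * b"
      using \<beta> by simp
    moreover have "h v z - h w z = \<beta> * ((\<integral>y. v y \<partial>p z) - (\<integral>y. w y \<partial>p z))"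
      by (simp add: h_def right_diff_distrib)
    ultimately show ?thesis using \<beta> by (simp add: abs_mult)
  qed
  have step: "\<bar>V (Suc n) x - V n x\<bar> \<le> \<beta> ^ n * B" for n x
  proof (induction n arbitrary: x)
    case 0
    then show ?case using B(2)[of x] by (simp add: V_def)
  next
    case (Suc n)
    have c: "\<bar>h (V (Suc n)) z - h (V n) z\<bar> \<le> \<beta> ^ Suc n * B" for z
      using contr[OF V V Suc] by (simp add: mult.assoc)
    obtain a where a: "T (V (Suc n)) x = h (V (Suc n)) (x, a)" using T(3)[OF V] by blast
    obtain b where b: "T (V n) x = h (V n) (x, b)" using T(3)[OF V] by blast
    show ?case
      using c[of "(x, a)"] c[of "(x, b)"] T(2)[OF V, of "Suc n" x b] T(2)[OF V, of n x a] a b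
      unfolding V_Suc[of "Suc n"] V_Suc[of n] abs_le_iff by linarith
  qed
  have "(\<lambda>n. \<beta> ^ n * B) \<longlonglongrightarrow> 0 * B"
    using \<beta> by (intro tendsto_mult LIMSEQ_power_zero tendsto_const) auto
  then have "\<forall>\<^sub>F n in sequentially. \<beta> ^ n * B < e"
    using e by (intro order_tendstoD) auto
  then obtain n where n: "\<beta> ^ n * B < e" by (auto simp: eventually_sequentially)
  have gap: "bellman_gap \<beta> p f (V n) z = h (V n) z - V n (fst z)" for z
    by (simp add: bellman_gap_def h_def)
  have "- e \<le> bellman_gap \<beta> p f (V n) (x, a)" for x a
    using T(2)[OF V, of n x a] step[of n x] n unfolding gap V_Suc abs_le_iff by simp
  moreover have "\<exists>a. bellman_gap \<beta> p f (V n) (x, a) \<le> e" for x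
  proof -
    obtain a where "T (V n) x = h (V n) (x, a)" using T(3)[OF V] by blast
    then show ?thesis
      using step[of n x] n unfolding gap V_Suc abs_le_iff by (intro exI[of _ a]) simp
  qed
  ultimately show ?thesis using V by (intro exI[of _ "V n"]) auto
qed

section \<open>The quantized models\<close>

lemma cell_measure_prob:
  assumes \<nu>: "finite_measure \<nu>" "sets \<nu> = sets borel" "emeasure \<nu> (Q -` {y}) > 0"
  shows "cell_measure \<nu> Q y \<in> space (prob_algebra borel)"
    and "AE x in cell_measure \<nu> Q y. Q x = y"
proof -
  have pos: "emeasure \<nu> (Q -` {y}) \<noteq> 0" using \<nu>(3) by auto
  have fin: "emeasure \<nu> (Q -` {y}) \<noteq> \<infinity>"
    using finite_measure.emeasure_finite[OF \<nu>(1)] by auto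
  have "prob_space (uniform_measure \<nu> (Q -` {y}))"
    by (rule prob_space_uniform_measure[OF pos fin])
  then show "cell_measure \<nu> Q y \<in> space (prob_algebra borel)"
    by (simp add: space_prob_algebra cell_measure_def \<nu>(2))
  show "AE x in cell_measure \<nu> Q y. Q x = y"
    unfolding cell_measure_def
    by (rule AE_uniform_measureI) (auto intro: emeasure_neq_0_sets[OF pos])
qed

lemma cell_average_bounds:
  assumes \<nu>: "finite_measure \<nu>" "sets \<nu> = sets borel" "emeasure \<nu> (Q -` {y}) > 0"
    and f: "f \<in> bounded_measurable borel"
  shows "(\<And>x. Q x = y \<Longrightarrow> a \<le> f x) \<Longrightarrow> a \<le> (\<integral>x. f x \<partial>cell_measure \<nu> Q y)"
    and "(\<And>x. Q x = y \<Longrightarrow> f x \<le> a) \<Longrightarrow> (\<integral>x. f x \<partial>cell_measure \<nu> Q y) \<le> a"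
proof -
  note C = cell_measure_prob[OF \<nu>]
  interpret prob_space "cell_measure \<nu> Q y"
    using C(1) by (simp add: space_prob_algebra)
  have int: "integrable (cell_measure \<nu> Q y) f" by (rule bounded_measurable_integrable[OF f C(1)])
  show "a \<le> (\<integral>x. f x \<partial>cell_measure \<nu> Q y)" if "\<And>x. Q x = y \<Longrightarrow> a \<le> f x"
    using C(2) that by (intro integral_ge_const[OF int]) auto
  show "(\<integral>x. f x \<partial>cell_measure \<nu> Q y) \<le> a" if "\<And>x. Q x = y \<Longrightarrow> f x \<le> a"
    using C(2) that by (intro integral_le_const[OF int]) auto
qed

text \<open>
  The costs of the finite model as an operator on the costs of the original model.
\<close>

definition cell_average ::
  "'x measure \<Rightarrow> ('x \<Rightarrow> 'x) \<Rightarrow> ('x \<times> 'a \<Rightarrow> real) \<Rightarrow> 'x \<times> 'a \<Rightarrow> real" where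
  "cell_average \<nu> Q f = (\<lambda>(y, a). \<integral>x. f (x, a) \<partial>cell_measure \<nu> Q y)"

locale quantized_model = discounted_model M \<beta>
  for M :: "('x::compact_metric_space, 'a::compact_metric_space) cmdp" and \<beta> +
  fixes Y :: "'x set" and Q :: "'x \<Rightarrow> 'x" and \<nu> :: "'x measure"
  assumes states: "states M = borel" and actions: "actions M = borel"
    and finite_grid: "finite Y"
    and Q_measurable: "Q \<in> borel \<rightarrow>\<^sub>M count_space Y"
    and finite_weight: "finite_measure \<nu>" and weight_sets: "sets \<nu> = sets borel"
    and weight_pos: "\<And>y. y \<in> Y \<Longrightarrow> emeasure \<nu> (Q -` {y}) > 0"
begin

abbreviation "MY \<equiv> finite_model Y Q \<nu> M"
abbreviation "cell \<equiv> cell_measure \<nu> Q"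

lemma finite_model_simps:
  "states MY = count_space Y" "actions MY = borel"
  "init_law MY = distr (init_law M) (count_space Y) Q"
  "cost MY = cell_average \<nu> Q (cost M)" "ccost MY l = cell_average \<nu> Q (ccost M l)"
  "trans_kernel MY (y, a) = point_measure Y
        (\<lambda>z. \<integral>\<^sup>+x. emeasure (trans_kernel M (x, a)) (Q -` {z}) \<partial>cell y)"
  by (simp_all add: finite_model_def actions cell_average_def)

lemma cell: "y \<in> Y \<Longrightarrow> cell y \<in> space (prob_algebra borel)"
  by (rule cell_measure_prob[OF finite_weight weight_sets weight_pos])

lemma Q_in: "Q x \<in> Y"
  using measurable_space[OF Q_measurable] by auto

lemma cell_sets: "Q -` {z} \<in> sets borel"
proof (cases "z \<in> Y")
  case True
  then show ?thesis using measurable_sets[OF Q_measurable, of "{z}"] by auto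
next
  case False
  then have "Q -` {z} = {}" using Q_in by auto
  then show ?thesis by simp
qed

lemma trans_prob: "trans_kernel M z \<in> space (prob_algebra borel)"
  using measurable_space[OF trans, of z] by (simp add: states actions space_pair_measure)

lemma trans_cell_measurable:
  "(\<lambda>z'. emeasure (trans_kernel M z') (Q -` {z})) \<in> borel_measurable (borel \<Otimes>\<^sub>M borel)"
  using trans cell_sets[of z] measurable_prob_algebraD unfolding states actions
  by (intro measurable_emeasure_kernel) auto

lemma sum_trans_cells: "(\<Sum>z\<in>Y. emeasure (trans_kernel M z') (Q -` {z})) = 1"
proof -
  interpret prob_space "trans_kernel M z'" using trans_prob by (simp add: space_prob_algebra)
  have sets: "sets (trans_kernel M z') = sets borel" using trans_prob by (simp add: space_prob_algebra)
  have "(\<Sum>z\<in>Y. emeasure (trans_kernel M z') (Q -` {z})) = emeasure (trans_kernel M z') (\<Union>z\<in>Y. Q -` {z})"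
    using cell_sets finite_grid by (intro sum_emeasure) (auto simp: sets disjoint_family_on_def)
  also have "(\<Union>z\<in>Y. Q -` {z}) = space (trans_kernel M z')"
    using Q_in sets_eq_imp_space_eq[OF sets] by auto
  finally show ?thesis by (simp add: emeasure_space_1)
qed

lemma cell_measurable:
  assumes "y \<in> Y"
  shows "h \<in> borel_measurable (borel \<Otimes>\<^sub>M borel) \<Longrightarrow> (\<lambda>x. h (x, a)) \<in> borel_measurable (cell y)"
proof -
  have sets: "sets (cell y) = sets borel" using cell[OF assms] by (simp add: space_prob_algebra)
  assume "h \<in> borel_measurable (borel \<Otimes>\<^sub>M borel)"
  then show "(\<lambda>x. h (x, a)) \<in> borel_measurable (cell y)"
    unfolding measurable_cong_sets[OF sets refl] by measurable
qed

lemma cell_nn_integral_measurable: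
  assumes y: "y \<in> Y" and h: "h \<in> borel_measurable (borel \<Otimes>\<^sub>M (borel :: 'a measure))"
  shows "(\<lambda>a. \<integral>\<^sup>+x. h (x, a) \<partial>cell y) \<in> borel_measurable borel"
proof -
  interpret prob_space "cell y" using cell[OF y] by (simp add: space_prob_algebra)
  have sets [measurable_cong]: "sets (cell y) = sets borel" using cell[OF y] by (simp add: space_prob_algebra)
  have "(\<lambda>(a, x). h (x, a)) \<in> borel_measurable ((borel :: 'a measure) \<Otimes>\<^sub>M cell y)"
    using h by measurable
  then show ?thesis by (rule borel_measurable_nn_integral)
qed

lemma init_MY: "init_law MY \<in> space (prob_algebra (states MY))"
  using measurable_space[OF measurable_distr_prob_space[OF Q_measurable]] init
  by (simp add: finite_model_simps states)

text \<open>
  A map from a product with a countable discrete factor is measurable if its sections are.  The weights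
  of the cells sum to \<open>1\<close> because the cells partition the space.
\<close>

lemma trans_MY: "trans_kernel MY \<in> states MY \<Otimes>\<^sub>M actions MY \<rightarrow>\<^sub>M prob_algebra (states MY)"
  unfolding finite_model_simps
proof (rule measurable_pair_measure_countable1)
  show "countable Y" using finite_grid by (rule countable_finite)
  fix y assume y: "y \<in> Y"
  let ?w = "\<lambda>a z. \<integral>\<^sup>+x. emeasure (trans_kernel M (x, a)) (Q -` {z}) \<partial>cell y"
  interpret prob_space "cell y" using cell[OF y] by (simp add: space_prob_algebra)
  have "(\<lambda>a. point_measure Y (?w a)) \<in> borel \<rightarrow>\<^sub>M prob_algebra (count_space Y)"
  proof (rule measurable_prob_algebraI[OF _ measurable_subprob_algebra])
    show p: "prob_space (point_measure Y (?w a))" for a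
    proof
      have "emeasure (point_measure Y (?w a)) Y = (\<Sum>z\<in>Y. ?w a z)"
        using finite_grid by (intro emeasure_point_measure_finite) auto
      also have "\<dots> = (\<integral>\<^sup>+x. (\<Sum>z\<in>Y. emeasure (trans_kernel M (x, a)) (Q -` {z})) \<partial>cell y)"
        by (rule nn_integral_sum[symmetric]) (rule cell_measurable[OF y trans_cell_measurable])
      also have "\<dots> = 1"
        unfolding sum_trans_cells using emeasure_space_1 by simp
      finally show "emeasure (point_measure Y (?w a)) (space (point_measure Y (?w a))) = 1"
        by (simp add: space_point_measure)
    qed
    show "subprob_space (point_measure Y (?w a))" for a
      by (rule prob_space_imp_subprob_space[OF p])
    show "sets (point_measure Y (?w a)) = sets (count_space Y)" for a
      by (rule sets_point_measure_count_space)
    fix A assume "A \<in> sets (count_space Y)"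
    then have "emeasure (point_measure Y (?w a)) A = (\<Sum>z\<in>A. ?w a z)" for a
      using finite_grid by (intro emeasure_point_measure_finite) auto
    then show "(\<lambda>a. emeasure (point_measure Y (?w a)) A) \<in> borel_measurable borel"
      using cell_nn_integral_measurable[OF y trans_cell_measurable] by simp
  qed
  then show "(\<lambda>a. trans_kernel MY (y, a)) \<in> borel \<rightarrow>\<^sub>M prob_algebra (count_space Y)"
    by (simp add: finite_model_simps)
qed

sublocale MY: discounted_model MY \<beta>
  by unfold_locales (rule init_MY trans_MY discount)+

lemma cell_average_measurable:
  assumes f: "f \<in> bounded_measurable (borel \<Otimes>\<^sub>M borel)"
  shows "cell_average \<nu> Q f \<in> bounded_measurable (states MY \<Otimes>\<^sub>M actions MY)"
proof -
  obtain B where "f \<in> borel_measurable (borel \<Otimes>\<^sub>M borel)"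
    "\<And>z. z \<in> space (borel \<Otimes>\<^sub>M borel) \<Longrightarrow> \<bar>f z\<bar> \<le> B"
    using bounded_measurableE[OF f] by metis
  then have B: "f \<in> borel_measurable (borel \<Otimes>\<^sub>M borel)" "\<And>z. \<bar>f z\<bar> \<le> B"
    by (simp_all add: space_pair_measure)
  show ?thesis
    unfolding finite_model_simps
  proof (rule bounded_measurableI)
    show "cell_average \<nu> Q f \<in> borel_measurable (count_space Y \<Otimes>\<^sub>M borel)"
    proof (rule measurable_pair_measure_countable1)
      show "countable Y" using finite_grid by (rule countable_finite)
      fix y assume y: "y \<in> Y"
      interpret prob_space "cell y" using cell[OF y] by (simp add: space_prob_algebra)
      have sets [measurable_cong]: "sets (cell y) = sets borel" using cell[OF y] by (simp add: space_prob_algebra)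
      have "(\<lambda>(a, x). f (x, a)) \<in> borel_measurable ((borel :: 'a measure) \<Otimes>\<^sub>M cell y)"
        using B(1) by measurable
      then show "(\<lambda>a. cell_average \<nu> Q f (y, a)) \<in> borel_measurable borel"
        unfolding cell_average_def split by (rule borel_measurable_lebesgue_integral)
    qed
    fix z assume "z \<in> space (count_space Y \<Otimes>\<^sub>M (borel :: 'a measure))"
    then have "fst z \<in> Y" by (auto simp: space_pair_measure)
    moreover have "(\<lambda>x. f (x, snd z)) \<in> bounded_measurable borel"
      by (rule bounded_measurable_compose[OF f]) measurable
    ultimately show "\<bar>cell_average \<nu> Q f z\<bar> \<le> B"
      unfolding cell_average_def case_prod_unfold using B(2) cell
      by (intro abs_integral_bound[where N = borel]) auto
  qed
qed

text \<open>
  A step of the finite model is: draw a state from the cell, make a step of the original model, and quantize.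
\<close>

lemma integral_trans_MY:
  assumes y: "y \<in> Y" and v: "v \<in> bounded_measurable borel"
  shows "(\<integral>z. v z \<partial>trans_kernel MY (y, a)) = (\<integral>x. (\<integral>x'. v (Q x') \<partial>trans_kernel M (x, a)) \<partial>cell y)"
proof -
  let ?m = "\<lambda>x z. measure (trans_kernel M (x, a)) (Q -` {z})"
  have prob: "prob_space (trans_kernel M (x, a))" "prob_space (cell y)" for x
    using trans_prob cell[OF y] by (auto simp: space_prob_algebra)
  have m: "(\<lambda>x. ?m x z) \<in> bounded_measurable borel" for z
  proof (rule bounded_measurableI[of _ _ 1])
    have "(\<lambda>x. emeasure (trans_kernel M (x, a)) (Q -` {z})) \<in> borel_measurable borel"
      using trans_cell_measurable[of z] by measurable
    then show "(\<lambda>x. ?m x z) \<in> borel_measurable borel"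
      unfolding measure_def by measurable
    show "\<bar>?m x z\<bar> \<le> 1" for x
      using prob_space.prob_le_1[OF prob(1)] by simp
  qed
  have w: "(\<integral>\<^sup>+x. emeasure (trans_kernel M (x, a)) (Q -` {z}) \<partial>cell y) = ennreal (\<integral>x. ?m x z \<partial>cell y)" for z
  proof -
    have "(\<integral>\<^sup>+x. emeasure (trans_kernel M (x, a)) (Q -` {z}) \<partial>cell y) = (\<integral>\<^sup>+x. ennreal (?m x z) \<partial>cell y)"
      using prob by (intro nn_integral_cong) (simp add: finite_measure.emeasure_eq_measure prob_space.finite_measure)
    also have "\<dots> = ennreal (\<integral>x. ?m x z \<partial>cell y)"
      by (intro nn_integral_eq_integral bounded_measurable_integrable[OF m cell[OF y]]) auto
    finally show ?thesis .
  qed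
  have "(\<integral>z. v z \<partial>trans_kernel MY (y, a)) = (\<integral>z. v z \<partial>point_measure Y (\<lambda>z. ennreal (\<integral>x. ?m x z \<partial>cell y)))"
    unfolding finite_model_simps w ..
  also have "\<dots> = (\<Sum>z\<in>Y. (\<integral>x. ?m x z \<partial>cell y) * v z)"
    using finite_grid by (subst lebesgue_integral_point_measure_finite) (auto intro: Bochner_Integration.integral_nonneg)
  also have "\<dots> = (\<integral>x. (\<Sum>z\<in>Y. ?m x z * v z) \<partial>cell y)"
    using bounded_measurable_integrable[OF m cell[OF y]] by (simp add: Bochner_Integration.integral_sum)
  also have "\<dots> = (\<integral>x. (\<integral>x'. v (Q x') \<partial>trans_kernel M (x, a)) \<partial>cell y)"
  proof (rule Bochner_Integration.integral_cong[OF refl])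
    fix x
    interpret prob_space "trans_kernel M (x, a)" by (rule prob)
    have sets: "sets (trans_kernel M (x, a)) = sets borel" using trans_prob by (simp add: space_prob_algebra)
    have "(\<integral>x'. v (Q x') \<partial>trans_kernel M (x, a)) =
        (\<integral>x'. (\<Sum>z\<in>Y. indicator (Q -` {z}) x' * v z) \<partial>trans_kernel M (x, a))"
      using Q_in finite_grid by (intro Bochner_Integration.integral_cong refl)
        (simp add: indicator_def sum.delta)
    also have "\<dots> = (\<Sum>z\<in>Y. ?m x z * v z)"
      using cell_sets by (subst Bochner_Integration.integral_sum) (auto simp: sets emeasure_eq_measure)
    finally show "(\<Sum>z\<in>Y. ?m x z * v z) = (\<integral>x'. v (Q x') \<partial>trans_kernel M (x, a))" ..
  qed
  finally show ?thesis .
qed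

lemma integral_quantized_bound:
  assumes P: "P \<in> space (prob_algebra borel)" and v: "v \<in> bounded_measurable borel"
    and osc: "\<And>x. \<bar>v (Q x) - v x\<bar> \<le> e"
  shows "\<bar>(\<integral>x. v (Q x) \<partial>P) - (\<integral>x. v x \<partial>P)\<bar> \<le> e"
proof -
  have "Q \<in> borel \<rightarrow>\<^sub>M borel"
    using measurable_compose[OF Q_measurable, of "\<lambda>x. x" borel] by simp
  then have vQ: "(\<lambda>x. v (Q x)) \<in> bounded_measurable borel"
    by (rule bounded_measurable_compose[OF v])
  have "\<bar>\<integral>x. v (Q x) - v x \<partial>P\<bar> \<le> e"
    by (rule abs_integral_bound[OF bounded_measurable_diff[OF vQ v] P osc])
  then show ?thesis
    using bounded_measurable_integrable[OF vQ P] bounded_measurable_integrable[OF v P] by simp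
qed

text \<open>
  Inside the cell of \<open>y\<close>, the two integrands differ by the oscillation of \<open>v\<close> twice: once at the successor state,
  which is quantized, and once at the current state, which is replaced by \<open>y\<close>.
\<close>

lemma bellman_gap_MY:
  assumes y: "y \<in> Y" and f: "f \<in> bounded_measurable (borel \<Otimes>\<^sub>M borel)" and v: "v \<in> bounded_measurable borel"
    and osc: "\<And>x. \<bar>v (Q x) - v x\<bar> \<le> e"
  shows "\<bar>bellman_gap \<beta> (trans_kernel MY) (cell_average \<nu> Q f) v (y, a)
    - (\<integral>x. bellman_gap \<beta> (trans_kernel M) f v (x, a) \<partial>cell y)\<bar> \<le> 2 * e"
proof -
  let ?p = "trans_kernel M"
  have e: "e \<ge> 0" using osc abs_ge_zero order_trans by blast
  have vQ: "(\<lambda>x. v (Q x)) \<in> bounded_measurable borel"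
    using measurable_compose[OF Q_measurable, of "\<lambda>x. x" borel] by (intro bounded_measurable_compose[OF v]) simp
  have fa: "(\<lambda>x. f (x, a)) \<in> bounded_measurable borel"
    by (rule bounded_measurable_compose[OF f]) measurable
  have pa: "(\<lambda>x. ?p (x, a)) \<in> borel \<rightarrow>\<^sub>M prob_algebra borel"
    using trans unfolding states actions by measurable
  have pv: "(\<lambda>x. \<integral>x'. w x' \<partial>?p (x, a)) \<in> bounded_measurable borel" if "w \<in> bounded_measurable borel" for w
    by (rule integral_kernel_measurable[OF pa that])
  define u1 where "u1 x = (1 - \<beta>) * f (x, a) + \<beta> * (\<integral>x'. v (Q x') \<partial>?p (x, a)) - v y" for x
  define u2 where "u2 x = bellman_gap \<beta> ?p f v (x, a)" for x
  interpret prob_space "cell y" using cell[OF y] by (simp add: space_prob_algebra)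
  have int: "integrable (cell y) w" if "w \<in> bounded_measurable borel" for w
    by (rule bounded_measurable_integrable[OF that cell[OF y]])
  have u: "u1 \<in> bounded_measurable borel" "u2 \<in> bounded_measurable borel"
    unfolding u1_def[abs_def] u2_def[abs_def] bellman_gap_def fst_conv
    by (intro bounded_measurable_diff bounded_measurable_add bounded_measurable_mult
        bounded_measurable_const fa pv v vQ)+
  have "bellman_gap \<beta> (trans_kernel MY) (cell_average \<nu> Q f) v (y, a) = (\<integral>x. u1 x \<partial>cell y)"
    unfolding bellman_gap_def integral_trans_MY[OF y v] u1_def cell_average_def split fst_conv
    using int[OF fa] int[OF pv[OF vQ]] by (simp add: prob_space)
  moreover have "\<bar>u1 x - u2 x\<bar> \<le> 2 * e" if x: "Q x = y" for x
  proof -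
    have "\<beta> * \<bar>(\<integral>x'. v (Q x') \<partial>?p (x, a)) - (\<integral>x'. v x' \<partial>?p (x, a))\<bar> \<le> 1 * e"
      using discount e by (intro mult_mono integral_quantized_bound[OF trans_prob v osc]) auto
    then have "\<bar>\<beta> * ((\<integral>x'. v (Q x') \<partial>?p (x, a)) - (\<integral>x'. v x' \<partial>?p (x, a)))\<bar> \<le> e"
      using discount by (simp add: abs_mult)
    moreover have "u1 x - u2 x = \<beta> * ((\<integral>x'. v (Q x') \<partial>?p (x, a)) - (\<integral>x'. v x' \<partial>?p (x, a))) + (v x - v (Q x))"
      unfolding u1_def u2_def bellman_gap_def by (simp add: x algebra_simps)
    ultimately show ?thesis using osc[of x] by linarith
  qed
  then have "- (2 * e) \<le> (\<integral>x. u1 x - u2 x \<partial>cell y)" "(\<integral>x. u1 x - u2 x \<partial>cell y) \<le> 2 * e"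
    using cell_average_bounds[OF finite_weight weight_sets weight_pos[OF y] bounded_measurable_diff[OF u]]
    by (simp_all add: abs_le_iff minus_le_iff)
  ultimately show ?thesis
    using int[OF u(1)] int[OF u(2)] unfolding u2_def by (simp add: abs_le_iff)
qed

end

section \<open>Cost functionals and optimal values\<close>

context discounted_model
begin

text \<open>
  The operator \<open>A\<close> turns a test function of the original model into a cost of the present model.  This makes
  the functionals of all models act on the same test functions.
\<close>

definition balanced_functionals :: "('f \<Rightarrow> 'x \<times> 'a \<Rightarrow> real) \<Rightarrow> ('f \<Rightarrow> real) set" where
  "balanced_functionals A = {\<lambda>f. \<integral>z. A f z \<partial>\<mu> |\<mu>. balanced \<mu>}"

definition stationary_functionals :: "('f \<Rightarrow> 'x \<times> 'a \<Rightarrow> real) \<Rightarrow> ('f \<Rightarrow> real) set" where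
  "stationary_functionals A = {\<lambda>f. \<integral>z. A f z \<partial>\<mu> |\<mu>. balanced \<mu> \<and>
  (\<exists>\<phi>. \<phi> \<in> states M \<rightarrow>\<^sub>M prob_algebra (actions M) \<and> randomized_by \<phi> \<mu>)}"

lemma stationary_functionals_subset: "stationary_functionals A \<subseteq> balanced_functionals A"
  unfolding stationary_functionals_def balanced_functionals_def by blast

lemma balanced_functional_bound:
  assumes "L \<in> balanced_functionals A" "A f \<in> bounded_measurable SA" "\<And>z. z \<in> space SA \<Longrightarrow> \<bar>A f z\<bar> \<le> B"
  shows "\<bar>L f\<bar> \<le> B"
  using assms abs_integral_bound[OF assms(2)] unfolding balanced_functionals_def balanced_def by blast

lemma convex_functionals:
  assumes A: "\<And>f. f \<in> D \<Longrightarrow> A f \<in> bounded_measurable SA"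
  shows "convex_on_tests D (balanced_functionals A)" "convex_on_tests D (stationary_functionals A)"
proof -
  have mix: "(\<integral>z. A f z \<partial>mixture s \<mu>1 \<mu>2) = s * (\<integral>z. A f z \<partial>\<mu>1) + (1 - s) * (\<integral>z. A f z \<partial>\<mu>2)"
    if "balanced \<mu>1" "balanced \<mu>2" "s \<in> {0..1}" "f \<in> D" for s \<mu>1 \<mu>2 f
    using that(1,2) integral_mixture[OF _ _ A[OF that(4)] that(3), of \<mu>1 \<mu>2] by (simp add: balanced_def)
  show "convex_on_tests D (balanced_functionals A)"
    unfolding convex_on_tests_def
  proof (intro ballI)
    fix L1 L2 and s :: real
    assume "L1 \<in> balanced_functionals A" "L2 \<in> balanced_functionals A" and s: "s \<in> {0..1}"
    then obtain \<mu>1 \<mu>2 where \<mu>: "balanced \<mu>1" "balanced \<mu>2"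
      and L: "L1 = (\<lambda>f. \<integral>z. A f z \<partial>\<mu>1)" "L2 = (\<lambda>f. \<integral>z. A f z \<partial>\<mu>2)"
      unfolding balanced_functionals_def by blast
    have "(\<lambda>f. \<integral>z. A f z \<partial>mixture s \<mu>1 \<mu>2) \<in> balanced_functionals A"
      unfolding balanced_functionals_def using balanced_mixture[OF \<mu> s] by blast
    then show "\<exists>L\<in>balanced_functionals A. \<forall>f\<in>D. L f = s * L1 f + (1 - s) * L2 f"
      by (rule bexI[rotated]) (use mix[OF \<mu> s] in \<open>simp add: L\<close>)
  qed
  show "convex_on_tests D (stationary_functionals A)"
    unfolding convex_on_tests_def
  proof (intro ballI)
    fix L1 L2 and s :: real
    assume "L1 \<in> stationary_functionals A" "L2 \<in> stationary_functionals A" and s: "s \<in> {0..1}"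
    then obtain \<mu>1 \<mu>2 \<phi>1 \<phi>2 where \<mu>: "balanced \<mu>1" "balanced \<mu>2"
      and \<phi>1: "\<phi>1 \<in> states M \<rightarrow>\<^sub>M prob_algebra (actions M)" "randomized_by \<phi>1 \<mu>1"
      and \<phi>2: "\<phi>2 \<in> states M \<rightarrow>\<^sub>M prob_algebra (actions M)" "randomized_by \<phi>2 \<mu>2"
      and L: "L1 = (\<lambda>f. \<integral>z. A f z \<partial>\<mu>1)" "L2 = (\<lambda>f. \<integral>z. A f z \<partial>\<mu>2)"
      unfolding stationary_functionals_def by blast
    have "\<mu>1 \<in> space (prob_algebra SA)" "\<mu>2 \<in> space (prob_algebra SA)"
      using \<mu> by (auto simp: balanced_def)
    from randomized_by_mixture[OF this s \<phi>1 \<phi>2] balanced_mixture[OF \<mu> s]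
    have "(\<lambda>f. \<integral>z. A f z \<partial>mixture s \<mu>1 \<mu>2) \<in> stationary_functionals A"
      unfolding stationary_functionals_def by blast
    then show "\<exists>L\<in>stationary_functionals A. \<forall>f\<in>D. L f = s * L1 f + (1 - s) * L2 f"
      by (rule bexI[rotated]) (use mix[OF \<mu> s] in \<open>simp add: L\<close>)
  qed
qed

lemma affine_functionals:
  assumes A: "\<And>f. f \<in> D \<Longrightarrow> A f \<in> bounded_measurable SA"
    and affine: "\<And>f g s z. f \<in> D \<Longrightarrow> g \<in> D \<Longrightarrow> s \<in> {0..1} \<Longrightarrow> z \<in> space SA \<Longrightarrow>
      A (\<lambda>z. s * f z + (1 - s) * g z) z = s * A f z + (1 - s) * A g z"
  shows "affine_on D (balanced_functionals A)" "affine_on D (stationary_functionals A)"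
proof -
  show "affine_on D (balanced_functionals A)"
    unfolding affine_on_def
  proof (intro ballI)
    fix L f g and s :: real
    assume "L \<in> balanced_functionals A" and fg: "f \<in> D" "g \<in> D" and s: "s \<in> {0..1}"
    then obtain \<mu> where \<mu>: "balanced \<mu>" and L: "L = (\<lambda>f. \<integral>z. A f z \<partial>\<mu>)"
      unfolding balanced_functionals_def by blast
    have \<mu>': "\<mu> \<in> space (prob_algebra SA)" using \<mu> by (simp add: balanced_def)
    then have "space \<mu> = space SA" by (auto simp: space_prob_algebra dest: sets_eq_imp_space_eq)
    then have "L (\<lambda>z. s * f z + (1 - s) * g z) = (\<integral>z. s * A f z + (1 - s) * A g z \<partial>\<mu>)"
      unfolding L using fg s by (intro Bochner_Integration.integral_cong refl affine) auto
    also have "\<dots> = s * L f + (1 - s) * L g"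
      unfolding L using bounded_measurable_integrable[OF A[OF fg(1)] \<mu>']
        bounded_measurable_integrable[OF A[OF fg(2)] \<mu>'] by simp
    finally show "L (\<lambda>z. s * f z + (1 - s) * g z) = s * L f + (1 - s) * L g" .
  qed
  then show "affine_on D (stationary_functionals A)"
    using stationary_functionals_subset unfolding affine_on_def by blast
qed

lemma policy_functional:
  assumes A: "\<And>f. f \<in> D \<Longrightarrow> A f \<in> bounded_measurable SA" and \<pi>: "\<pi> \<in> policies M"
  shows "\<exists>L\<in>balanced_functionals A. \<forall>f\<in>D. disc_cost \<beta> M (A f) \<pi> = L f"
proof (intro bexI[of _ "\<lambda>f. \<integral>z. A f z \<partial>occupation \<pi>"] ballI)
  show "(\<lambda>f. \<integral>z. A f z \<partial>occupation \<pi>) \<in> balanced_functionals A"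
    unfolding balanced_functionals_def using balanced_occupation[OF \<pi>] by blast
qed (rule disc_cost_eq_integral_occupation[OF \<pi> A])

lemma stationary_functional_policy:
  assumes A: "\<And>f. f \<in> D \<Longrightarrow> A f \<in> bounded_measurable SA" and L: "L \<in> stationary_functionals A"
  shows "\<exists>\<pi>\<in>policies M. \<forall>f\<in>D. disc_cost \<beta> M (A f) \<pi> = L f"
proof -
  from L obtain \<mu> \<phi> where \<mu>: "balanced \<mu>" and \<phi>: "\<phi> \<in> states M \<rightarrow>\<^sub>M prob_algebra (actions M)"
    "randomized_by \<phi> \<mu>" and L: "L = (\<lambda>f. \<integral>z. A f z \<partial>\<mu>)"
    unfolding stationary_functionals_def by blast
  show ?thesis
    unfolding L
  proof (rule bexI[of _ "stationary \<phi>"], rule ballI)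
    fix f assume "f \<in> D"
    then show "disc_cost \<beta> M (A f) (stationary \<phi>) = (\<integral>z. A f z \<partial>\<mu>)"
      by (intro cost_of_balanced_randomized[OF \<phi>(1) \<mu> \<phi>(2)] A)
  qed (rule stationary_policy[OF \<phi>(1)])
qed

text \<open>
  Every policy yields a balanced functional.
\<close>

lemma opt_value_ge:
  assumes A: "\<And>f. f \<in> D \<Longrightarrow> A f \<in> bounded_measurable SA"
    and c: "cost M = A c" "c \<in> D" and d: "\<And>l. l \<in> {1..q} \<Longrightarrow> ccost M l = A (d l) \<and> d l \<in> D"
    and lower: "\<And>L. L \<in> constrained (balanced_functionals A) d k q \<Longrightarrow> r \<le> L c"
  shows "ereal r \<le> opt_value \<beta> q k M"
  unfolding opt_value_def
proof (rule INF_greatest)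
  fix \<pi> assume "\<pi> \<in> feasible \<beta> q k M"
  then have \<pi>: "\<pi> \<in> policies M" "\<And>l. l \<in> {1..q} \<Longrightarrow> disc_cost \<beta> M (ccost M l) \<pi> \<le> k l"
    unfolding feasible_def by auto
  from policy_functional[where D = D and A = A, OF A \<pi>(1)] obtain L
    where L: "L \<in> balanced_functionals A" "\<And>f. f \<in> D \<Longrightarrow> disc_cost \<beta> M (A f) \<pi> = L f" by blast
  have "L \<in> constrained (balanced_functionals A) d k q"
    unfolding constrained_def using L \<pi>(2) d by fastforce
  then show "ereal r \<le> ereal (disc_cost \<beta> M (cost M) \<pi>)"
    using lower L(2)[OF c(2)] c(1) by simp
qed

text \<open>
  Every stationary functional comes from a policy.
\<close>

lemma opt_value_le:
  assumes A: "\<And>f. f \<in> D \<Longrightarrow> A f \<in> bounded_measurable SA"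
    and c: "cost M = A c" "c \<in> D" and d: "\<And>l. l \<in> {1..q} \<Longrightarrow> ccost M l = A (d l) \<and> d l \<in> D"
    and L: "L \<in> constrained (stationary_functionals A) d k q"
  shows "opt_value \<beta> q k M \<le> ereal (L c)"
proof -
  from L obtain \<pi> where \<pi>: "\<pi> \<in> policies M" "\<And>f. f \<in> D \<Longrightarrow> disc_cost \<beta> M (A f) \<pi> = L f"
    using stationary_functional_policy[where D = D and A = A and L = L, OF A] unfolding constrained_def by blast
  have "\<pi> \<in> feasible \<beta> q k M"
    unfolding feasible_def using \<pi> L d by (auto simp: constrained_def)
  then show ?thesis
    unfolding opt_value_def using \<pi>(2)[OF c(2)] c(1) by (intro INF_lower2[of \<pi>]) auto
qed

end

context quantized_model
begin

text \<open>
  The same \<open>v\<close> and the selector \<open>s\<close> of the original model, restricted to the grid, are nearly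
  optimal for the finite model.  One \<open>e\<close> accounts for the quantized initial law.  The gap of the finite model is at least
  \<open>- 3 e\<close>, and at most \<open>4 e\<close> at the selected action: \<open>2 e\<close> from cell averaging, \<open>e\<close> from the gap of the
  original model, and for the selector another \<open>e\<close> for the oscillation of the gap within the cell.
\<close>

lemma MY_functional_bounds:
  assumes f: "f \<in> bounded_measurable (borel \<Otimes>\<^sub>M borel)" and v: "v \<in> bounded_measurable borel"
    and osc: "\<And>x. \<bar>v (Q x) - v x\<bar> \<le> e"
    and gap_ge: "\<And>z. - e \<le> bellman_gap \<beta> (trans_kernel M) f v z"
    and gap_le: "\<And>x. bellman_gap \<beta> (trans_kernel M) f v (x, s x) \<le> e"
    and gap_osc: "\<And>x a. \<bar>bellman_gap \<beta> (trans_kernel M) f v (Q x, a) - bellman_gap \<beta> (trans_kernel M) f v (x, a)\<bar> \<le> e"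
  shows "\<And>L. L \<in> MY.balanced_functionals (cell_average \<nu> Q) \<Longrightarrow>
      (\<integral>x. v x \<partial>init_law M) - (e + 3 * e / (1 - \<beta>)) \<le> L f"
    and "\<exists>L\<in>MY.stationary_functionals (cell_average \<nu> Q).
      L f \<le> (\<integral>x. v x \<partial>init_law M) + (e + 4 * e / (1 - \<beta>))"
proof -
  let ?g = "bellman_gap \<beta> (trans_kernel M) f v"
  let ?gY = "bellman_gap \<beta> (trans_kernel MY) (cell_average \<nu> Q f) v"
  have vY: "v \<in> bounded_measurable (states MY)"
    using v unfolding bounded_measurable_def finite_model_simps by auto
  note fY = cell_average_measurable[OF f]
  have init_borel: "init_law M \<in> space (prob_algebra borel)" using init by (simp add: states)
  have "(\<integral>x. v x \<partial>init_law MY) = (\<integral>x. v (Q x) \<partial>init_law M)"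
    unfolding finite_model_simps
    using init_borel measurable_cong_sets[of "init_law M" borel "count_space Y" "count_space Y"] Q_measurable
    by (subst integral_distr) (auto simp: space_prob_algebra)
  then have init_near: "\<bar>(\<integral>x. v x \<partial>init_law MY) - (\<integral>x. v x \<partial>init_law M)\<bar> \<le> e"
    using integral_quantized_bound[OF init_borel v osc] by simp
  have ga: "(\<lambda>x. ?g (x, a)) \<in> bounded_measurable borel" for a
  proof -
    have "(\<lambda>z. v (fst z)) \<in> bounded_measurable (borel \<Otimes>\<^sub>M borel)"
      by (rule bounded_measurable_compose[OF v measurable_fst])
    moreover have "(\<lambda>z. \<integral>y. v y \<partial>trans_kernel M z) \<in> bounded_measurable (borel \<Otimes>\<^sub>M borel)"
      using integral_kernel_measurable[OF trans] v by (simp add: states actions)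
    ultimately have "?g \<in> bounded_measurable (borel \<Otimes>\<^sub>M borel)"
      unfolding bellman_gap_def[abs_def]
      by (intro bounded_measurable_diff bounded_measurable_add bounded_measurable_mult bounded_measurable_const f)
    then show ?thesis by (rule bounded_measurable_compose) measurable
  qed
  note avg = cell_average_bounds[OF finite_weight weight_sets weight_pos ga]
  have near: "\<bar>?gY (y, a) - (\<integral>x. ?g (x, a) \<partial>cell y)\<bar> \<le> 2 * e" if "y \<in> Y" for y a
    by (rule bellman_gap_MY[OF that f v osc])
  have gY_ge: "- (3 * e) \<le> ?gY z" if "z \<in> space (states MY \<Otimes>\<^sub>M actions MY)" for z
  proof -
    obtain y a where z: "z = (y, a)" by (cases z)
    then have y: "y \<in> Y"
      using that by (simp add: space_pair_measure finite_model_simps)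
    have "- e \<le> (\<integral>x. ?g (x, a) \<partial>cell y)" by (rule avg(1)[OF y gap_ge])
    then show ?thesis using near[OF y, of a] unfolding z by linarith
  qed
  have gY_le: "?gY (y, s y) \<le> 4 * e" if y: "y \<in> space (states MY)" for y
  proof -
    have y: "y \<in> Y" using y by (simp add: finite_model_simps)
    have "?g (x, s y) \<le> 2 * e" if "Q x = y" for x
      using gap_osc[of x "s y"] gap_le[of y] unfolding that by linarith
    then have "(\<integral>x. ?g (x, s y) \<partial>cell y) \<le> 2 * e" by (rule avg(2)[OF y])
    then show ?thesis using near[OF y, of "s y"] by linarith
  qed
  show "(\<integral>x. v x \<partial>init_law M) - (e + 3 * e / (1 - \<beta>)) \<le> L f"
    if L: "L \<in> MY.balanced_functionals (cell_average \<nu> Q)" for L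
  proof -
    from L obtain \<mu> where \<mu>: "MY.balanced \<mu>" and L_eq: "L f = (\<integral>z. cell_average \<nu> Q f z \<partial>\<mu>)"
      unfolding MY.balanced_functionals_def by blast
    show ?thesis
      using MY.balanced_cost_ge[OF \<mu> fY vY gY_ge] init_near unfolding L_eq by linarith
  qed
  have "s \<in> states MY \<rightarrow>\<^sub>M actions MY"
    by (simp add: finite_model_simps)
  from MY.selector_cost_le[OF this fY vY gY_le] obtain \<phi> \<mu>
    where *: "\<phi> \<in> states MY \<rightarrow>\<^sub>M prob_algebra (actions MY)" "MY.balanced \<mu>" "MY.randomized_by \<phi> \<mu>"
      "(\<integral>z. cell_average \<nu> Q f z \<partial>\<mu>) \<le> (\<integral>x. v x \<partial>init_law MY) + 4 * e / (1 - \<beta>)"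
    by blast
  then have "(\<lambda>f. \<integral>z. cell_average \<nu> Q f z \<partial>\<mu>) \<in> MY.stationary_functionals (cell_average \<nu> Q)"
    unfolding MY.stationary_functionals_def by blast
  then show "\<exists>L\<in>MY.stationary_functionals (cell_average \<nu> Q).
      L f \<le> (\<integral>x. v x \<partial>init_law M) + (e + 4 * e / (1 - \<beta>))"
    by (rule bexI[rotated]) (use *(4) init_near in linarith)
qed

lemma cell_average_affine:
  assumes "f \<in> bounded_measurable (borel \<Otimes>\<^sub>M borel)" "g \<in> bounded_measurable (borel \<Otimes>\<^sub>M borel)"
    and z: "z \<in> space (states MY \<Otimes>\<^sub>M actions MY)"
  shows "cell_average \<nu> Q (\<lambda>z. s * f z + (1 - s) * g z) z = s * cell_average \<nu> Q f z + (1 - s) * cell_average \<nu> Q g z"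
proof -
  obtain y a where za: "z = (y, a)" by (cases z)
  then have y: "y \<in> Y"
    using z by (simp add: space_pair_measure finite_model_simps)
  have int: "integrable (cell y) (\<lambda>x. h (x, a))" if "h \<in> bounded_measurable (borel \<Otimes>\<^sub>M borel)" for h
    by (intro bounded_measurable_integrable[OF _ cell[OF y]] bounded_measurable_compose[OF that]) measurable
  show ?thesis
    using int[OF assms(1)] int[OF assms(2)] by (simp add: za cell_average_def)
qed

lemma cell_average_bound:
  assumes f: "f \<in> bounded_measurable (borel \<Otimes>\<^sub>M borel)" and B: "\<And>z. \<bar>f z\<bar> \<le> B"
    and z: "z \<in> space (states MY \<Otimes>\<^sub>M actions MY)"
  shows "\<bar>cell_average \<nu> Q f z\<bar> \<le> B"
proof -
  obtain y a where za: "z = (y, a)" by (cases z)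
  then have y: "y \<in> Y"
    using z by (simp add: space_pair_measure finite_model_simps)
  have "(\<lambda>x. f (x, a)) \<in> bounded_measurable borel"
    by (rule bounded_measurable_compose[OF f]) measurable
  then show ?thesis
    unfolding za cell_average_def split by (rule abs_integral_bound[OF _ cell[OF y] B])
qed

end

section \<open>Convergence of the constrained values\<close>

theorem theorem1:
  fixes p :: "'x::compact_metric_space \<times> 'a::compact_metric_space \<Rightarrow> 'x measure"
    and c :: "'x \<times> 'a \<Rightarrow> real"
    and d :: "nat \<Rightarrow> 'x \<times> 'a \<Rightarrow> real"
    and q :: nat
    and k :: "nat \<Rightarrow> real"
    and \<gamma> :: "'x measure"
    and \<beta> :: real
    and X :: "nat \<Rightarrow> 'x set"
    and Q :: "nat \<Rightarrow> 'x \<Rightarrow> 'x"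
    and \<nu> :: "nat \<Rightarrow> 'x measure"
    and M :: "('x, 'a) cmdp"
  defines "M \<equiv> \<lparr> states = borel, actions = borel, trans_kernel = p, cost = c, ccost = d, init_law = \<gamma> \<rparr>"
  assumes kernel: "p \<in> borel \<Otimes>\<^sub>M borel \<rightarrow>\<^sub>M prob_algebra borel"
    and weak_cont: "weakly_continuous_kernel p"
    and cost: "continuous_on UNIV c" "\<And>z. c z \<ge> 0"
    and ccost: "\<And>l. l \<in> {1..q} \<Longrightarrow> continuous_on UNIV (d l)"
      "\<And>l z. l \<in> {1..q} \<Longrightarrow> d l z \<ge> 0"
    and bounds: "\<And>l. l \<in> {1..q} \<Longrightarrow> k l \<ge> 0"
    and initial: "prob_space \<gamma>" "sets \<gamma> = sets borel"
    and discount: "0 < \<beta>" "\<beta> < 1"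
    and slater: "\<exists>\<pi>\<in>policies M. \<forall>l\<in>{1..q}. disc_cost \<beta> M (d l) \<pi> < k l"
    and grid: "\<And>n. n \<ge> 1 \<Longrightarrow> finite (X n)"
      "\<And>n x. n \<ge> 1 \<Longrightarrow> \<exists>y\<in>X n. dist x y < 1 / real n"
    and quantizer: "\<And>n. n \<ge> 1 \<Longrightarrow> nearest_point_map (X n) (Q n)"
    and weights: "\<And>n. n \<ge> 1 \<Longrightarrow> finite_measure (\<nu> n)"
      "\<And>n. n \<ge> 1 \<Longrightarrow> sets (\<nu> n) = sets borel"
      "\<And>n y. n \<ge> 1 \<Longrightarrow> y \<in> X n \<Longrightarrow> emeasure (\<nu> n) (Q n -` {y}) > 0"
  shows "(\<lambda>n. \<bar>opt_value \<beta> q k (finite_model (X n) (Q n) (\<nu> n) M) - opt_value \<beta> q k M\<bar>)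
           \<longlonglongrightarrow> 0"
proof -
  have M_simps: "states M = borel" "actions M = borel" "trans_kernel M = p" "cost M = c" "ccost M = d"
    "init_law M = \<gamma>"
    by (simp_all add: M_def)
  interpret M: discounted_model M \<beta>
    by unfold_locales (use kernel initial discount in \<open>simp_all add: M_simps space_prob_algebra\<close>)
  \<comment> \<open>Indices are shifted by one because the assumptions on the grids start at \<open>n = 1\<close>.\<close>
  define N where "N n = finite_model (X (Suc n)) (Q (Suc n)) (\<nu> (Suc n)) M" for n
  define A :: "nat \<Rightarrow> ('x \<times> 'a \<Rightarrow> real) \<Rightarrow> 'x \<times> 'a \<Rightarrow> real" where "A n = cell_average (\<nu> (Suc n)) (Q (Suc n))" for n :: nat
  have quantized: "quantized_model M \<beta> (X (Suc n)) (Q (Suc n)) (\<nu> (Suc n))" for n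
  proof (intro quantized_model.intro quantized_model_axioms.intro M.discounted_model_axioms)
    show "Q (Suc n) \<in> borel \<rightarrow>\<^sub>M count_space (X (Suc n))"
      using quantizer[of "Suc n"] by (simp add: nearest_point_map_def)
  qed (simp_all add: M_simps grid(1) weights)
  have model_N: "discounted_model (N n) \<beta>" for n
  proof -
    interpret Q: quantized_model M \<beta> "X (Suc n)" "Q (Suc n)" "\<nu> (Suc n)" by (rule quantized)
    show ?thesis unfolding N_def by (rule Q.MY.discounted_model_axioms)
  qed
  define D :: "('x \<times> 'a \<Rightarrow> real) set" where "D = {f. continuous_on UNIV f}"
  have D_mix: "(\<lambda>z. s * f z + (1 - s) * g z) \<in> D" if "f \<in> D" "g \<in> D" for f g s
    using that unfolding D_def by (auto intro!: continuous_intros)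
  have D_bm: "f \<in> bounded_measurable (borel \<Otimes>\<^sub>M borel)" if "f \<in> D" for f
    using continuous_bounded_measurable[OF compact_UNIV_prod] that by (simp add: D_def borel_prod)
  have D_bound: "\<exists>B. \<forall>z. \<bar>f z\<bar> \<le> B" if "f \<in> D" for f
    using continuous_on_compact_UNIV(1)[OF compact_UNIV_prod, of f] that unfolding D_def by blast
  \<comment> \<open>The occupation functionals of all policies lie between \<open>S\<close> and \<open>T\<close>, and those of the \<open>n\<close>-th finite model
    between \<open>SN n\<close> and \<open>TN n\<close>.\<close>
  define T :: "(('x \<times> 'a \<Rightarrow> real) \<Rightarrow> real) set" where "T = M.balanced_functionals (\<lambda>f. f)"
  define S :: "(('x \<times> 'a \<Rightarrow> real) \<Rightarrow> real) set" where "S = M.stationary_functionals (\<lambda>f. f)"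
  define TN where "TN n = discounted_model.balanced_functionals (N n) \<beta> (A n)" for n
  define SN where "SN n = discounted_model.stationary_functionals (N n) \<beta> (A n)" for n
  have A_bm: "A n f \<in> bounded_measurable (states (N n) \<Otimes>\<^sub>M actions (N n))" if "f \<in> D" for n f
    unfolding A_def N_def by (rule quantized_model.cell_average_measurable[OF quantized D_bm[OF that]])
  have M_bm: "f \<in> bounded_measurable (states M \<Otimes>\<^sub>M actions M)" if "f \<in> D" for f
    using D_bm[OF that] by (simp add: M_simps)
  have convex: "convex_on_tests D T" "convex_on_tests D S" "convex_on_tests D (TN n)" "convex_on_tests D (SN n)" for n
    unfolding T_def S_def TN_def SN_def
    by (rule M.convex_functionals discounted_model.convex_functionals[OF model_N]; erule M_bm A_bm)+
  have A_affine: "A n (\<lambda>z. s * f z + (1 - s) * g z) z = s * A n f z + (1 - s) * A n g z"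
    if "f \<in> D" "g \<in> D" "z \<in> space (states (N n) \<Otimes>\<^sub>M actions (N n))" for f g s z n
    using quantized_model.cell_average_affine[OF quantized D_bm D_bm] that unfolding A_def N_def by blast
  have affine: "affine_on D T" "affine_on D S" "affine_on D (TN n)" "affine_on D (SN n)" for n
    unfolding T_def S_def TN_def SN_def
    by (rule M.affine_functionals discounted_model.affine_functionals[OF model_N];
        auto intro: M_bm A_bm A_affine)+
  have sub: "S \<subseteq> T" "SN n \<subseteq> TN n" for n
    unfolding T_def S_def TN_def SN_def
    by (rule M.stationary_functionals_subset discounted_model.stationary_functionals_subset[OF model_N])+
  have T_bound: "\<bar>L f\<bar> \<le> B" if "L \<in> T" "f \<in> D" "\<And>z. \<bar>f z\<bar> \<le> B" for L f B
    by (rule M.balanced_functional_bound[where A = "\<lambda>f. f", OF that(1)[unfolded T_def] M_bm[OF that(2)] that(3)])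
  have TN_bound: "\<bar>L f\<bar> \<le> B" if "L \<in> TN n" "f \<in> D" "\<And>z. \<bar>f z\<bar> \<le> B" for L f B n
  proof (rule discounted_model.balanced_functional_bound[where A = "A n" and f = f,
        OF model_N[of n] that(1)[unfolded TN_def] A_bm[OF that(2)]])
    show "\<bar>A n f z\<bar> \<le> B" if "z \<in> space (states (N n) \<Otimes>\<^sub>M actions (N n))" for z
      using quantized_model.cell_average_bound[OF quantized D_bm[OF \<open>f \<in> D\<close>] \<open>\<And>z. \<bar>f z\<bar> \<le> B\<close>] that
      unfolding A_def N_def by blast
  qed
  have bounded: "\<exists>B. \<forall>n. \<forall>L\<in>TN n. \<bar>L f\<bar> \<le> B" "\<exists>B. \<forall>n. \<forall>L\<in>SN n. \<bar>L f\<bar> \<le> B"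
    "\<exists>B. \<forall>n :: nat. \<forall>L\<in>S. \<bar>L f\<bar> \<le> B" if f: "f \<in> D" for f
  proof -
    obtain B where "\<And>z. \<bar>f z\<bar> \<le> B" using D_bound[OF f] by blast
    with T_bound[OF _ f] TN_bound[OF _ f] sub have "\<forall>n. \<forall>L\<in>TN n. \<bar>L f\<bar> \<le> B"
      "\<forall>n. \<forall>L\<in>SN n. \<bar>L f\<bar> \<le> B" "\<forall>n :: nat. \<forall>L\<in>S. \<bar>L f\<bar> \<le> B"
      by blast+
    then show "\<exists>B. \<forall>n. \<forall>L\<in>TN n. \<bar>L f\<bar> \<le> B" "\<exists>B. \<forall>n. \<forall>L\<in>SN n. \<bar>L f\<bar> \<le> B"
      "\<exists>B. \<forall>n :: nat. \<forall>L\<in>S. \<bar>L f\<bar> \<le> B"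
      by blast+
  qed
  \<comment> \<open>The approximate solution \<open>v\<close> of the Bellman equation and the selector are chosen once; only the mesh that is needed
    for the finite models to inherit their properties depends on them.\<close>
  have common_value: "\<exists>w. (\<forall>L\<in>T. w - e \<le> L f) \<and> (\<exists>L\<in>S. L f \<le> w + e) \<and>
      (\<forall>\<^sub>F n in sequentially. (\<forall>L\<in>TN n. w - e \<le> L f) \<and> (\<exists>L\<in>SN n. L f \<le> w + e))"
    if f: "f \<in> D" and e: "e > 0" for f e
  proof -
    have f_cont: "continuous_on UNIV f" using f by (simp add: D_def)
    \<comment> \<open>The largest error below is \<open>\<epsilon> + 4 \<epsilon> / (1 - \<beta>)\<close>, which this choice keeps below \<open>e\<close>.\<close>
    define \<epsilon> where "\<epsilon> = e * (1 - \<beta>) / 5"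
    have \<epsilon>: "\<epsilon> > 0" using e discount by (simp add: \<epsilon>_def)
    have \<epsilon>_le: "\<epsilon> / (1 - \<beta>) \<le> e" "\<epsilon> + 3 * \<epsilon> / (1 - \<beta>) \<le> e" "\<epsilon> + 4 * \<epsilon> / (1 - \<beta>) \<le> e"
    proof -
      have "e * b / 5 / b = e / 5" if "b \<noteq> 0" for b :: real using that by simp
      from this[of "1 - \<beta>"] have "\<epsilon> / (1 - \<beta>) = e / 5" using discount by (simp only: \<epsilon>_def)
      moreover have "\<epsilon> \<le> e / 5"
        using e discount by (simp add: \<epsilon>_def mult_left_le)
      moreover have "3 * \<epsilon> / (1 - \<beta>) = 3 * (\<epsilon> / (1 - \<beta>))" "4 * \<epsilon> / (1 - \<beta>) = 4 * (\<epsilon> / (1 - \<beta>))"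
        by simp_all
      ultimately show "\<epsilon> / (1 - \<beta>) \<le> e" "\<epsilon> + 3 * \<epsilon> / (1 - \<beta>) \<le> e" "\<epsilon> + 4 * \<epsilon> / (1 - \<beta>) \<le> e"
        using e by linarith+
    qed
    obtain v where v: "continuous_on UNIV v" and gap_ge': "\<And>z. - (\<epsilon> / 2) \<le> bellman_gap \<beta> p f v z"
      and gap_le': "\<And>x. \<exists>a. bellman_gap \<beta> p f v (x, a) \<le> \<epsilon> / 2"
      using approximate_bellman_solution[OF kernel weak_cont f_cont discount, of "\<epsilon> / 2"] \<epsilon> by auto
    let ?g = "bellman_gap \<beta> p f v"
    have g: "continuous_on UNIV ?g" by (rule continuous_bellman_gap(2)[OF weak_cont f_cont v])
    have gap_ge: "- \<epsilon> \<le> ?g z" for z using gap_ge'[of z] \<epsilon> by linarith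
    have "\<exists>a. ?g (x, a) < \<epsilon>" for x
    proof -
      obtain a where "?g (x, a) \<le> \<epsilon> / 2" using gap_le' by blast
      with \<epsilon> show ?thesis by (intro exI[of _ a]) linarith
    qed
    from measurable_near_selector[OF g this] obtain s where s: "s \<in> borel \<rightarrow>\<^sub>M borel"
      and gap_le: "\<And>x. ?g (x, s x) \<le> \<epsilon>" by (meson less_imp_le)
    have v_bm: "v \<in> bounded_measurable borel" by (rule continuous_bounded_measurable[OF compact_UNIV v])
    have v_states: "v \<in> bounded_measurable (states M)" using v_bm by (simp add: M_simps)
    obtain \<delta>1 where \<delta>1: "\<delta>1 > 0" "\<And>x y. dist x y < \<delta>1 \<Longrightarrow> \<bar>v x - v y\<bar> \<le> \<epsilon>"
      using continuous_on_compact_UNIV(2)[OF compact_UNIV v \<epsilon>] by blast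
    obtain \<delta>2 where \<delta>2: "\<delta>2 > 0" "\<And>z w. dist z w < \<delta>2 \<Longrightarrow> \<bar>?g z - ?g w\<bar> \<le> \<epsilon>"
      using continuous_on_compact_UNIV(2)[OF compact_UNIV_prod g \<epsilon>] by blast
    have "(\<lambda>n. inverse (real (Suc n))) \<longlonglongrightarrow> 0" by (rule LIMSEQ_inverse_real_of_nat)
    then have "\<forall>\<^sub>F n in sequentially. inverse (real (Suc n)) < min \<delta>1 \<delta>2"
      using \<delta>1 \<delta>2 by (intro order_tendstoD) auto
    then have fine: "\<forall>\<^sub>F n in sequentially.
        (\<forall>L\<in>TN n. (\<integral>x. v x \<partial>\<gamma>) - e \<le> L f) \<and> (\<exists>L\<in>SN n. L f \<le> (\<integral>x. v x \<partial>\<gamma>) + e)"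
    proof (rule eventually_mono)
      fix n assume n: "inverse (real (Suc n)) < min \<delta>1 \<delta>2"
      have near: "dist (Q (Suc n) x) x < min \<delta>1 \<delta>2" for x
      proof -
        obtain y where "y \<in> X (Suc n)" "dist x y < 1 / real (Suc n)" using grid(2)[of "Suc n" x] by auto
        moreover have "dist x (Q (Suc n) x) \<le> dist x y"
          using quantizer[of "Suc n"] \<open>y \<in> X (Suc n)\<close> unfolding nearest_point_map_def by auto
        ultimately show ?thesis using n by (simp add: dist_commute inverse_eq_divide)
      qed
      have osc: "\<bar>v (Q (Suc n) x) - v x\<bar> \<le> \<epsilon>" for x using near[of x] by (intro \<delta>1(2)) simp
      have gap_osc: "\<bar>?g (Q (Suc n) x, a) - ?g (x, a)\<bar> \<le> \<epsilon>" for x a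
        using near[of x] by (intro \<delta>2(2)) (simp add: dist_Pair_Pair)
      note * = quantized_model.MY_functional_bounds[OF quantized D_bm[OF f] v_bm, unfolded M_simps,
          OF osc gap_ge gap_le gap_osc, folded A_def N_def]
      have "(\<integral>x. v x \<partial>\<gamma>) - e \<le> L f" if "L \<in> TN n" for L
        using *(1)[OF that[unfolded TN_def]] \<epsilon>_le by linarith
      moreover have "\<exists>L\<in>SN n. L f \<le> (\<integral>x. v x \<partial>\<gamma>) + e"
      proof -
        from *(2) obtain L where "L \<in> SN n" "L f \<le> (\<integral>x. v x \<partial>\<gamma>) + (\<epsilon> + 4 * \<epsilon> / (1 - \<beta>))"
          unfolding SN_def by blast
        with \<epsilon>_le(3) show ?thesis by (intro bexI[of _ L]) linarith+
      qed
      ultimately show "(\<forall>L\<in>TN n. (\<integral>x. v x \<partial>\<gamma>) - e \<le> L f) \<and> (\<exists>L\<in>SN n. L f \<le> (\<integral>x. v x \<partial>\<gamma>) + e)"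
        by blast
    qed
    have lower: "(\<integral>x. v x \<partial>\<gamma>) - e \<le> L f" if "L \<in> T" for L
    proof -
      obtain \<mu> where \<mu>: "M.balanced \<mu>" "L f = (\<integral>z. f z \<partial>\<mu>)"
        using \<open>L \<in> T\<close> unfolding T_def M.balanced_functionals_def by blast
      show ?thesis
        using M.balanced_cost_ge[OF \<mu>(1) M_bm[OF f] v_states, of \<epsilon>] gap_ge \<epsilon>_le unfolding \<mu>(2) M_simps
        by fastforce
    qed
    have "\<exists>L\<in>S. L f \<le> (\<integral>x. v x \<partial>\<gamma>) + e"
    proof -
      have "s \<in> states M \<rightarrow>\<^sub>M actions M" using s by (simp add: M_simps)
      from M.selector_cost_le[OF this M_bm[OF f] v_states, of \<epsilon>] gap_le obtain \<phi> \<mu>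
        where \<mu>: "\<phi> \<in> states M \<rightarrow>\<^sub>M prob_algebra (actions M)" "M.balanced \<mu>" "M.randomized_by \<phi> \<mu>"
          "(\<integral>z. f z \<partial>\<mu>) \<le> (\<integral>x. v x \<partial>\<gamma>) + \<epsilon> / (1 - \<beta>)"
        unfolding M_simps by blast
      then have "(\<lambda>f. \<integral>z. f z \<partial>\<mu>) \<in> S"
        unfolding S_def M.stationary_functionals_def by blast
      then show ?thesis
        by (rule bexI[rotated]) (use \<mu>(4) \<epsilon>_le in linarith)
    qed
    with lower fine show ?thesis by blast
  qed
  have conv: "converging_infima TN T f" "converging_infima SN T f" "converging_infima (\<lambda>_. S) T f"
    if f: "f \<in> D" for f
  proof -
    have "converging_infima F T f" if F: "\<And>n. SN n \<subseteq> F n" "\<And>n. F n \<subseteq> TN n" for F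
    proof (rule converging_infima_of_common_value)
      fix e :: real assume "e > 0"
      from common_value[OF f this] obtain w where w: "\<forall>L\<in>T. w - e \<le> L f" "\<exists>L\<in>S. L f \<le> w + e"
        "\<forall>\<^sub>F n in sequentially. (\<forall>L\<in>TN n. w - e \<le> L f) \<and> (\<exists>L\<in>SN n. L f \<le> w + e)"
        by blast
      from w(3) have "\<forall>\<^sub>F n in sequentially. (\<forall>L\<in>F n. w - e \<le> L f) \<and> (\<exists>L\<in>F n. L f \<le> w + e)"
        by (rule eventually_mono) (use F in blast)
      with w(1,2) sub(1) show "\<exists>w. (\<forall>L\<in>T. w - e \<le> L f) \<and> (\<exists>L\<in>T. L f \<le> w + e) \<and>
          (\<forall>\<^sub>F n in sequentially. (\<forall>L\<in>F n. w - e \<le> L f) \<and> (\<exists>L\<in>F n. L f \<le> w + e))"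
        by (intro exI[of _ w]) blast
    qed
    from this[of TN] this[of SN] sub(2)
    show "converging_infima TN T f" "converging_infima SN T f" by simp_all
    show "converging_infima (\<lambda>_. S) T f"
    proof (rule converging_infima_of_common_value)
      fix e :: real assume "e > 0"
      from common_value[OF f this] obtain w where "\<forall>L\<in>T. w - e \<le> L f" "\<exists>L\<in>S. L f \<le> w + e"
        by blast
      with sub(1) show "\<exists>w. (\<forall>L\<in>T. w - e \<le> L f) \<and> (\<exists>L\<in>T. L f \<le> w + e) \<and>
          (\<forall>\<^sub>F n :: nat in sequentially. (\<forall>L\<in>S. w - e \<le> L f) \<and> (\<exists>L\<in>S. L f \<le> w + e))"
        by (intro exI[of _ w] conjI always_eventually allI) blast+
    qed
  qed
  have c: "c \<in> D" and d: "\<And>l. l \<in> {1..q} \<Longrightarrow> d l \<in> D"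
    using cost ccost by (auto simp: D_def)
  obtain L0 where L0: "L0 \<in> T" "\<And>l. l \<in> {1..q} \<Longrightarrow> L0 (d l) < k l"
  proof -
    obtain \<pi> where \<pi>: "\<pi> \<in> policies M" "\<forall>l\<in>{1..q}. disc_cost \<beta> M (d l) \<pi> < k l" using slater by blast
    obtain L where "L \<in> T" "\<forall>f\<in>D. disc_cost \<beta> M f \<pi> = L f"
      unfolding T_def using M.policy_functional[where D = D and A = "\<lambda>f. f", OF M_bm \<pi>(1)] by blast
    then show thesis using \<pi>(2) d that by metis
  qed
  let ?C = "\<lambda>F. constrained F d k q"
  have conv_TN: "converging_infima (\<lambda>n. ?C (TN n)) (?C T) c"
    by (rule converging_infima_constrained[where D = D, OF D_mix affine(3,1) convex(3,1) bounded(1) conv(1) d L0 c])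
  have conv_SN: "converging_infima (\<lambda>n. ?C (SN n)) (?C T) c"
    by (rule converging_infima_constrained[where D = D, OF D_mix affine(4,1) convex(4,1) bounded(2) conv(2) d L0 c])
  \<comment> \<open>A constant sequence: the constrained infimum over the stationary functionals agrees with the one over
    all balanced functionals.  Therefore the optimal value of the original model is the infimum over \<open>T\<close>.\<close>
  have conv_S: "converging_infima (\<lambda>_. ?C S) (?C T) c"
    by (rule converging_infima_constrained[where D = D, OF D_mix affine(2,1) convex(2,1) bounded(3) conv(3) d L0 c])
  have N_costs: "cost (N n) = A n c" "ccost (N n) l = A n (d l)" for n l
    unfolding N_def A_def by (simp_all add: quantized_model.finite_model_simps[OF quantized] M_simps)
  have M_ge: "ereal r \<le> opt_value \<beta> q k M" if "\<And>L. L \<in> ?C T \<Longrightarrow> r \<le> L c" for r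
    by (rule M.opt_value_ge[where A = "\<lambda>f. f" and D = D and c = c and d = d])
       (use M_bm c d that in \<open>auto simp: M_simps T_def\<close>)
  have M_le: "opt_value \<beta> q k M \<le> ereal (L c)" if "L \<in> ?C S" for L
    by (rule M.opt_value_le[where A = "\<lambda>f. f" and D = D and c = c and d = d])
       (use M_bm c d that in \<open>auto simp: M_simps S_def\<close>)
  have N_ge: "ereal r \<le> opt_value \<beta> q k (N n)" if "\<And>L. L \<in> ?C (TN n) \<Longrightarrow> r \<le> L c" for r n
    by (rule discounted_model.opt_value_ge[OF model_N, where A = "A n" and D = D and c = c and d = d])
       (use A_bm c d that in \<open>auto simp: N_costs TN_def\<close>)
  have N_le: "opt_value \<beta> q k (N n) \<le> ereal (L c)" if "L \<in> ?C (SN n)" for L n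
    by (rule discounted_model.opt_value_le[OF model_N, where A = "A n" and D = D and c = c and d = d])
       (use A_bm c d that in \<open>auto simp: N_costs SN_def\<close>)
  have near_S: "\<exists>L'\<in>?C S. L' c < L c + e" if "L \<in> ?C T" "e > 0" for L e
    using conv_S that unfolding converging_infima_def by (auto simp: eventually_sequentially)
  obtain V where V: "opt_value \<beta> q k M = ereal V"
  proof -
    have "L0 \<in> ?C T" unfolding constrained_def using L0 by (auto intro: less_imp_le)
    from near_S[OF this, of 1] obtain L1 where "L1 \<in> ?C S" by auto
    from M_le[OF this] have "opt_value \<beta> q k M < \<infinity>" by auto
    moreover obtain B where "\<And>z. \<bar>c z\<bar> \<le> B" using D_bound[OF c] by blast
    then have "- B \<le> L c" if "L \<in> ?C T" for L
      using T_bound[OF _ c, of L B] that unfolding constrained_def abs_le_iff by (auto simp: minus_le_iff)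
    then have "ereal (- B) \<le> opt_value \<beta> q k M" by (rule M_ge)
    then have "opt_value \<beta> q k M > - \<infinity>" by auto
    ultimately show thesis using that by (cases "opt_value \<beta> q k M") auto
  qed
  \<comment> \<open>Policies are bounded below by \<open>V\<close> by definition; an element of \<open>T\<close> is compared with nearby
    elements of \<open>S\<close>, which are costs of policies.\<close>
  have V_le: "V \<le> L c" if "L \<in> ?C T" for L
  proof (rule field_le_epsilon)
    fix e :: real assume "e > 0"
    from near_S[OF that this] M_le V show "V \<le> L c + e" by fastforce
  qed
  have V_near: "\<exists>L\<in>?C T. L c < V + e" if "e > 0" for e
  proof (rule ccontr)
    assume "\<not> ?thesis"
    then have "ereal (V + e) \<le> opt_value \<beta> q k M" by (intro M_ge) force
    with V that show False by simp
  qed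
  have "(\<lambda>n. \<bar>opt_value \<beta> q k (N n) - opt_value \<beta> q k M\<bar>) \<longlonglongrightarrow> 0"
  proof (rule order_tendstoI)
    fix a :: ereal assume "a < 0"
    then show "\<forall>\<^sub>F n in sequentially. a < \<bar>opt_value \<beta> q k (N n) - opt_value \<beta> q k M\<bar>"
      by (intro always_eventually allI) (metis abs_ereal_ge0 abs_ereal_pos less_le_trans)
  next
    fix a :: ereal assume "0 < a"
    then obtain e where e: "e > 0" "ereal e < a" using ereal_dense2[of 0 a] by auto
    obtain L where L: "L \<in> ?C T" "L c < V + e / 2" using V_near[of "e / 2"] e by auto
    \<comment> \<open>The upper estimate comes from stationary policies of the finite models, the lower one holds for all
      solutions of their balance equations.\<close>
    have "\<forall>\<^sub>F n in sequentially. \<exists>L'\<in>?C (SN n). L' c < L c + e / 2"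
      using conv_SN L(1) e unfolding converging_infima_def by (meson half_gt_zero)
    moreover have "\<forall>\<^sub>F n in sequentially. \<forall>L'\<in>?C (TN n). V - e < L' c"
      using conv_TN V_le e unfolding converging_infima_def by blast
    ultimately show "\<forall>\<^sub>F n in sequentially. \<bar>opt_value \<beta> q k (N n) - opt_value \<beta> q k M\<bar> < a"
    proof eventually_elim
      case (elim n)
      then obtain L' where L': "L' \<in> ?C (SN n)" "L' c < L c + e / 2" by blast
      have "opt_value \<beta> q k (N n) \<le> ereal (V + e)"
        using N_le[OF L'(1)] L' L(2) by (auto intro: order_trans)
      moreover have "ereal (V - e) \<le> opt_value \<beta> q k (N n)"
        using elim(2) by (intro N_ge) (auto intro: less_imp_le)
      ultimately have "\<bar>opt_value \<beta> q k (N n) - ereal V\<bar> \<le> ereal e"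
        by (cases "opt_value \<beta> q k (N n)") (auto simp: abs_le_iff)
      also note e(2)
      finally show ?case unfolding V .
    qed
  qed
  then show ?thesis
    unfolding N_def by (rule LIMSEQ_imp_Suc)
qed

end
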